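(* Let $X$ be a non-empty, locally compact space, and let $Y$ be a non-empty, closed subspace of $X$. Let $R_Y:\mathrm{C}_{\mathrm c}(X,\mathbb R)\to\mathrm{C}_{\mathrm c}(Y,\mathbb R)$ be the restriction map $f\mapsto f|_Y$, and let $R_Y^\sim:\mathrm{C}_{\mathrm c}(Y,\mathbb R)^\sim\to\mathrm{C}_{\mathrm c}(X,\mathbb R)^\sim$ be its order adjoint, $\langle R_Y^\sim\varphi,f\rangle=\langle\varphi,R_Yf\rangle$. Then: (a) $R_Y^\sim$ is a weak$^\ast$-continuous, injective, and interval preserving lattice homomorphism. (b) $\operatorname{supp}\varphi=\operatorname{supp}R_Y^\sim\varphi$ for all $\varphi\in\mathrm{C}_{\mathrm c}(Y,\mathbb R)^\sim$. (c) The image of $\mathrm{C}_{\mathrm c}(Y,\mathbb R)^\sim$ under $R_Y^\sim$ is the order ideal of $\mathrm{C}_{\mathrm c}(X,\mathbb R)^\sim$ that consists of all elements $\Phi$ of $\mathrm{C}_{\mathrm c}(X,\mathbb R)^\sim$ such that $\operatorname{supp}\Phi\subseteq Y$. (d) Suppose that $g$ is a bounded Borel measurable function on $Y$. Extend $g$ to a Borel measurable function $\widetilde g$ on $X$ by setting $\widetilde g(x):=0$ for $x\in X\setminus Y$. Then $R_Y^\sim(g\varphi)=\widetilde g\,R_Y^\sim\varphi$ for all $\varphi\in\mathrm{C}_{\mathrm c}(Y,\mathbb R)^\sim$.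
   Context: All topological spaces are Hausdorff; vector spaces are real and functions are real-valued. For a non-empty locally compact space $T$, $\mathrm{C}_{\mathrm c}(T,\mathbb R)$ is the vector lattice of continuous, real-valued functions on $T$ with compact support, with pointwise ordering. Its order dual $\mathrm{C}_{\mathrm c}(T,\mathbb R)^\sim$ is the space of linear functionals on it that map order bounded sets to bounded sets (equivalently, differences of two positive functionals), with $\varphi\ge\psi$ iff $\langle\varphi,f\rangle\ge\langle\psi,f\rangle$ for all $f\ge0$; it is a Dedekind complete vector lattice. Its weak$^\ast$-topology is the topology of pointwise convergence on $\mathrm{C}_{\mathrm c}(T,\mathbb R)$. A linear map $L:E\to F$ between vector lattices is a lattice homomorphism if $|Lx|=L|x|$ for all $x$; it is interval preserving if it is positive and $L([0,x])=[0,Lx]$ for all $x\ge0$ in $E$, where $[0,x]=\{z: 0\le z\le x\}$. An order ideal of a vector lattice $E$ is a vector sublattice $F$ such that $x\in F$ whenever $x\in E$, $y\in F$, $|x|\le|y|$. Support: $\varphi\in\mathrm{C}_{\mathrm c}(T,\mathbb R)^\sim$ vanishes on an open set $U\subseteq T$ if $\langle\varphi,f\rangle=0$ for all $f\in \mathrm{C}_{\mathrm c}(T,\mathbb R)$ with $\operatorname{supp} f\subseteq U$; $\operatorname{supp}\varphi$ is the complement of the union of all open sets on which $\varphi$ vanishes. Product with bounded Borel functions: for $\varphi\in \mathrm{C}_{\mathrm c}(T,\mathbb R)^\sim$ and a non-empty, open, relatively compact $U\subseteq T$, there is a unique finite signed regular Borel measure $\mu_U$ on $U$ with $\langle\varphi,h\rangle=\int_U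 h\,d\mu_U$ for all $h\in\mathrm{C}_{\mathrm c}(T,\mathbb R)$ with $\operatorname{supp}h\subseteq U$. For a bounded Borel measurable $g:T\to\mathbb R$, the element $g\varphi$ of $\mathrm{C}_{\mathrm c}(T,\mathbb R)^\sim$ is defined by $\langle g\varphi,f\rangle:=\int_U fg\,d\mu_U$, where $U$ is any open relatively compact neighbourhood of $\operatorname{supp}f$ (this is independent of $U$). *)

theory Defs
  imports "HOL-Analysis.Analysis" "HOL-Library.Function_Algebras"
begin

section \<open>Vector lattices of functions\<close>

text \<open>
  The vector spaces considered here are sets \<open>E\<close> of real-valued functions on some type, with the
  pointwise operations; the order \<open>le\<close> is a separate parameter, since it need not be the
  pointwise one (it is not for the order dual).
\<close>

definition fscale :: "real \<Rightarrow> ('i \<Rightarrow> real) \<Rightarrow> 'i \<Rightarrow> real" where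
  "fscale c x = (\<lambda>i. c * x i)"

definition linear_subspace :: "('i \<Rightarrow> real) set \<Rightarrow> bool" where
  "linear_subspace E \<longleftrightarrow>
     0 \<in> E \<and> (\<forall>x\<in>E. \<forall>y\<in>E. x + y \<in> E) \<and> (\<forall>c. \<forall>x\<in>E. fscale c x \<in> E)"

definition linear_map :: "('i \<Rightarrow> real) set \<Rightarrow> ('j \<Rightarrow> real) set \<Rightarrow>
    (('i \<Rightarrow> real) \<Rightarrow> ('j \<Rightarrow> real)) \<Rightarrow> bool" where
  "linear_map E F L \<longleftrightarrow>
     L \<in> E \<rightarrow> F \<and> (\<forall>x\<in>E. \<forall>y\<in>E. L (x + y) = L x + L y) \<and>
     (\<forall>c. \<forall>x\<in>E. L (fscale c x) = fscale c (L x))"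

definition is_sup :: "'v set \<Rightarrow> ('v \<Rightarrow> 'v \<Rightarrow> bool) \<Rightarrow> 'v set \<Rightarrow> 'v \<Rightarrow> bool" where
  "is_sup E le A s \<longleftrightarrow>
     s \<in> E \<and> (\<forall>a\<in>A. le a s) \<and> (\<forall>u\<in>E. (\<forall>a\<in>A. le a u) \<longrightarrow> le s u)"

definition is_inf :: "'v set \<Rightarrow> ('v \<Rightarrow> 'v \<Rightarrow> bool) \<Rightarrow> 'v set \<Rightarrow> 'v \<Rightarrow> bool" where
  "is_inf E le A s \<longleftrightarrow>
     s \<in> E \<and> (\<forall>a\<in>A. le s a) \<and> (\<forall>u\<in>E. (\<forall>a\<in>A. le u a) \<longrightarrow> le u s)"

definition vector_lattice ::
    "('i \<Rightarrow> real) set \<Rightarrow> (('i \<Rightarrow> real) \<Rightarrow> ('i \<Rightarrow> real) \<Rightarrow> bool) \<Rightarrow> bool" where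
  "vector_lattice E le \<longleftrightarrow>
     linear_subspace E \<and>
     (\<forall>x\<in>E. le x x) \<and>
     (\<forall>x\<in>E. \<forall>y\<in>E. le x y \<longrightarrow> le y x \<longrightarrow> x = y) \<and>
     (\<forall>x\<in>E. \<forall>y\<in>E. \<forall>z\<in>E. le x y \<longrightarrow> le y z \<longrightarrow> le x z) \<and>
     (\<forall>x\<in>E. \<forall>y\<in>E. \<forall>z\<in>E. le x y \<longrightarrow> le (x + z) (y + z)) \<and>
     (\<forall>c\<ge>0. \<forall>x\<in>E. \<forall>y\<in>E. le x y \<longrightarrow> le (fscale c x) (fscale c y)) \<and>
     (\<forall>x\<in>E. \<forall>y\<in>E. (\<exists>s. is_sup E le {x, y} s) \<and> (\<exists>s. is_inf E le {x, y} s))"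

definition lat_sup :: "'v set \<Rightarrow> ('v \<Rightarrow> 'v \<Rightarrow> bool) \<Rightarrow> 'v \<Rightarrow> 'v \<Rightarrow> 'v" where
  "lat_sup E le x y = (THE s. is_sup E le {x, y} s)"

definition lat_inf :: "'v set \<Rightarrow> ('v \<Rightarrow> 'v \<Rightarrow> bool) \<Rightarrow> 'v \<Rightarrow> 'v \<Rightarrow> 'v" where
  "lat_inf E le x y = (THE s. is_inf E le {x, y} s)"

definition lat_abs :: "('i \<Rightarrow> real) set \<Rightarrow> (('i \<Rightarrow> real) \<Rightarrow> ('i \<Rightarrow> real) \<Rightarrow> bool) \<Rightarrow>
    ('i \<Rightarrow> real) \<Rightarrow> ('i \<Rightarrow> real)" where
  "lat_abs E le x = lat_sup E le x (- x)"

definition lattice_homomorphism ::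
    "('i \<Rightarrow> real) set \<Rightarrow> (('i \<Rightarrow> real) \<Rightarrow> ('i \<Rightarrow> real) \<Rightarrow> bool) \<Rightarrow>
     ('j \<Rightarrow> real) set \<Rightarrow> (('j \<Rightarrow> real) \<Rightarrow> ('j \<Rightarrow> real) \<Rightarrow> bool) \<Rightarrow>
     (('i \<Rightarrow> real) \<Rightarrow> ('j \<Rightarrow> real)) \<Rightarrow> bool" where
  "lattice_homomorphism E leE F leF L \<longleftrightarrow>
     vector_lattice E leE \<and> vector_lattice F leF \<and> linear_map E F L \<and>
     (\<forall>x\<in>E. lat_abs F leF (L x) = L (lat_abs E leE x))"

definition order_interval :: "'v set \<Rightarrow> ('v \<Rightarrow> 'v \<Rightarrow> bool) \<Rightarrow> 'v \<Rightarrow> 'v \<Rightarrow> 'v set" where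
  "order_interval E le a b = {z \<in> E. le a z \<and> le z b}"

definition interval_preserving ::
    "('i \<Rightarrow> real) set \<Rightarrow> (('i \<Rightarrow> real) \<Rightarrow> ('i \<Rightarrow> real) \<Rightarrow> bool) \<Rightarrow>
     ('j \<Rightarrow> real) set \<Rightarrow> (('j \<Rightarrow> real) \<Rightarrow> ('j \<Rightarrow> real) \<Rightarrow> bool) \<Rightarrow>
     (('i \<Rightarrow> real) \<Rightarrow> ('j \<Rightarrow> real)) \<Rightarrow> bool" where
  "interval_preserving E leE F leF L \<longleftrightarrow>
     vector_lattice E leE \<and> vector_lattice F leF \<and> linear_map E F L \<and>
     (\<forall>x\<in>E. leE 0 x \<longrightarrow> leF 0 (L x)) \<and>
     (\<forall>x\<in>E. leE 0 x \<longrightarrow> L ` order_interval E leE 0 x = order_interval F leF 0 (L x))"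

definition vector_sublattice :: "('i \<Rightarrow> real) set \<Rightarrow>
    (('i \<Rightarrow> real) \<Rightarrow> ('i \<Rightarrow> real) \<Rightarrow> bool) \<Rightarrow> ('i \<Rightarrow> real) set \<Rightarrow> bool" where
  "vector_sublattice E le F \<longleftrightarrow>
     vector_lattice E le \<and> F \<subseteq> E \<and> linear_subspace F \<and>
     (\<forall>x\<in>F. \<forall>y\<in>F. lat_sup E le x y \<in> F \<and> lat_inf E le x y \<in> F)"

definition order_ideal :: "('i \<Rightarrow> real) set \<Rightarrow>
    (('i \<Rightarrow> real) \<Rightarrow> ('i \<Rightarrow> real) \<Rightarrow> bool) \<Rightarrow> ('i \<Rightarrow> real) set \<Rightarrow> bool" where
  "order_ideal E le F \<longleftrightarrow>
     vector_sublattice E le F \<and>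
     (\<forall>x\<in>E. \<forall>y\<in>F. le (lat_abs E le x) (lat_abs E le y) \<longrightarrow> x \<in> F)"

definition order_bounded :: "'v set \<Rightarrow> ('v \<Rightarrow> 'v \<Rightarrow> bool) \<Rightarrow> 'v set \<Rightarrow> bool" where
  "order_bounded E le A \<longleftrightarrow> (\<exists>a\<in>E. \<exists>b\<in>E. A \<subseteq> order_interval E le a b)"


section \<open>Compactly supported continuous functions and their order dual\<close>

definition fsupp :: "'a topology \<Rightarrow> ('a \<Rightarrow> real) \<Rightarrow> 'a set" where
  "fsupp T f = T closure_of {x \<in> topspace T. f x \<noteq> 0}"

text \<open>
  A function on the space \<open>T\<close> is represented by the total function that is zero off
  \<open>topspace T\<close>. Equality, the vector operations and the pointwise order on \<open>T\<close> are then
  those of the function type.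
\<close>

definition Cc :: "'a topology \<Rightarrow> ('a \<Rightarrow> real) set" where
  "Cc T = {f. continuous_map T euclideanreal f \<and> compactin T (fsupp T f) \<and>
              (\<forall>x. x \<notin> topspace T \<longrightarrow> f x = 0)}"

text \<open>Likewise, a functional on \<open>Cc T\<close> is represented by its extension by zero.\<close>

definition order_dual :: "'a topology \<Rightarrow> (('a \<Rightarrow> real) \<Rightarrow> real) set" where
  "order_dual T = {\<phi>.
     (\<forall>f\<in>Cc T. \<forall>g\<in>Cc T. \<phi> (f + g) = \<phi> f + \<phi> g) \<and>
     (\<forall>c. \<forall>f\<in>Cc T. \<phi> (fscale c f) = c * \<phi> f) \<and>
     (\<forall>A. order_bounded (Cc T) (\<le>) A \<longrightarrow> order_bounded UNIV (\<le>) (\<phi> ` A)) \<and>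
     (\<forall>f. f \<notin> Cc T \<longrightarrow> \<phi> f = 0)}"

definition dual_le ::
    "'a topology \<Rightarrow> (('a \<Rightarrow> real) \<Rightarrow> real) \<Rightarrow> (('a \<Rightarrow> real) \<Rightarrow> real) \<Rightarrow> bool" where
  "dual_le T \<phi> \<psi> \<longleftrightarrow> (\<forall>f\<in>Cc T. 0 \<le> f \<longrightarrow> \<phi> f \<le> \<psi> f)"

definition weak_star :: "'a topology \<Rightarrow> (('a \<Rightarrow> real) \<Rightarrow> real) topology" where
  "weak_star T =
     pullback_topology (order_dual T) (\<lambda>\<phi>. restrict \<phi> (Cc T)) (powertop_real (Cc T))"

definition vanishes_on :: "'a topology \<Rightarrow> (('a \<Rightarrow> real) \<Rightarrow> real) \<Rightarrow> 'a set \<Rightarrow> bool" where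
  "vanishes_on T \<phi> U \<longleftrightarrow> (\<forall>f\<in>Cc T. fsupp T f \<subseteq> U \<longrightarrow> \<phi> f = 0)"

definition dual_supp :: "'a topology \<Rightarrow> (('a \<Rightarrow> real) \<Rightarrow> real) \<Rightarrow> 'a set" where
  "dual_supp T \<phi> = topspace T - \<Union>{U. openin T U \<and> vanishes_on T \<phi> U}"

definition zero_off :: "'a set \<Rightarrow> ('a \<Rightarrow> real) \<Rightarrow> 'a \<Rightarrow> real" where
  "zero_off Y f = (\<lambda>x. if x \<in> Y then f x else 0)"

text \<open>
  In the representation above, \<open>zero_off Y f\<close> is both the restriction to \<open>Y\<close> of a function \<open>f\<close>
  on a larger space, and the extension by zero of a function \<open>f\<close> on \<open>Y\<close>.
\<close>

lemma zero_off_Cc: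
  assumes Y: "closedin X Y" and f: "f \<in> Cc X"
  shows "zero_off Y f \<in> Cc (subtopology X Y)"
proof -
  let ?S = "subtopology X Y"
  have YX: "Y \<subseteq> topspace X" using Y closedin_subset by blast
  have ts: "topspace ?S = Y" using YX by auto
  have cf: "continuous_map X euclideanreal f" and kf: "compactin X (fsupp X f)"
    using f by (auto simp: Cc_def)
  have "continuous_map ?S euclideanreal f" using cf continuous_map_from_subtopology by blast
  then have c: "continuous_map ?S euclideanreal (zero_off Y f)"
    by (rule continuous_map_eq) (auto simp: zero_off_def ts)
  have "{x \<in> topspace ?S. zero_off Y f x \<noteq> 0} \<subseteq> {x \<in> topspace X. f x \<noteq> 0}"
    using YX by (auto simp: zero_off_def split: if_splits)
  then have sub: "fsupp ?S (zero_off Y f) \<subseteq> fsupp X f"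
    unfolding fsupp_def
    by (meson closure_of_mono closure_of_subtopology_subset subset_trans)
  have "closedin ?S (fsupp ?S (zero_off Y f))" by (simp add: fsupp_def)
  then have "closedin X (fsupp ?S (zero_off Y f))" using Y closedin_trans_full by blast
  then have "compactin X (fsupp ?S (zero_off Y f))"
    using kf sub closed_compactin by blast
  moreover have "fsupp ?S (zero_off Y f) \<subseteq> Y"
    using closure_of_subset_topspace[of ?S] ts by (auto simp: fsupp_def)
  ultimately have "compactin ?S (fsupp ?S (zero_off Y f))"
    by (simp add: compactin_subtopology)
  with c YX show ?thesis by (auto simp: Cc_def zero_off_def)
qed

definition order_adjoint :: "'a topology \<Rightarrow> (('a \<Rightarrow> real) \<Rightarrow> ('b \<Rightarrow> real)) \<Rightarrow>
    (('b \<Rightarrow> real) \<Rightarrow> real) \<Rightarrow> (('a \<Rightarrow> real) \<Rightarrow> real)" where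
  "order_adjoint X L \<phi> = (\<lambda>f. if f \<in> Cc X then \<phi> (L f) else 0)"


section \<open>Finite signed regular Borel measures\<close>

definition borel_of :: "'a topology \<Rightarrow> 'a measure" where
  "borel_of T = sigma (topspace T) {U. openin T U}"

text \<open>
  A finite signed measure is a real-valued set function, zero (by convention) off the sigma-algebra.
  Only the sigma-algebra of the argument \<open>M\<close> is relevant.
\<close>

definition finite_signed_measure :: "'a measure \<Rightarrow> ('a set \<Rightarrow> real) \<Rightarrow> bool" where
  "finite_signed_measure M \<mu> \<longleftrightarrow>
     \<mu> {} = 0 \<and>
     (\<forall>A :: nat \<Rightarrow> 'a set. range A \<subseteq> sets M \<longrightarrow> disjoint_family A \<longrightarrow>
        (\<lambda>n. \<mu> (A n)) sums \<mu> (\<Union>n. A n)) \<and>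
     (\<forall>A. A \<notin> sets M \<longrightarrow> \<mu> A = 0)"

text \<open>
  The Jordan decomposition: the positive part of \<open>\<mu>\<close> at \<open>A\<close> is the supremum of \<open>\<mu> B\<close> over the
  measurable \<open>B \<subseteq> A\<close>. Since \<open>\<mu> {} = 0\<close>, truncation of negative values by \<open>ennreal\<close> is harmless.
\<close>

definition pos_variation :: "'a measure \<Rightarrow> ('a set \<Rightarrow> real) \<Rightarrow> 'a measure" where
  "pos_variation M \<mu> =
     measure_of (space M) (sets M) (\<lambda>A. SUP B\<in>{B \<in> sets M. B \<subseteq> A}. ennreal (\<mu> B))"

definition neg_variation :: "'a measure \<Rightarrow> ('a set \<Rightarrow> real) \<Rightarrow> 'a measure" where
  "neg_variation M \<mu> = pos_variation M (- \<mu>)"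

definition signed_integral :: "'a measure \<Rightarrow> ('a set \<Rightarrow> real) \<Rightarrow> ('a \<Rightarrow> real) \<Rightarrow> real" where
  "signed_integral M \<mu> h =
     integral\<^sup>L (pos_variation M \<mu>) h - integral\<^sup>L (neg_variation M \<mu>) h"

definition regular_borel_measure :: "'a topology \<Rightarrow> 'a measure \<Rightarrow> bool" where
  "regular_borel_measure T M \<longleftrightarrow>
     space M = topspace T \<and> sets M = sets (borel_of T) \<and>
     (\<forall>K. compactin T K \<longrightarrow> emeasure M K < \<infinity>) \<and>
     (\<forall>A\<in>sets M. emeasure M A = (INF V\<in>{V. openin T V \<and> A \<subseteq> V}. emeasure M V)) \<and>
     (\<forall>V. openin T V \<longrightarrow> emeasure M V = (SUP K\<in>{K. compactin T K \<and> K \<subseteq> V}. emeasure M K))"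

definition finite_signed_regular_borel :: "'a topology \<Rightarrow> ('a set \<Rightarrow> real) \<Rightarrow> bool" where
  "finite_signed_regular_borel T \<mu> \<longleftrightarrow>
     finite_signed_measure (borel_of T) \<mu> \<and>
     regular_borel_measure T (pos_variation (borel_of T) \<mu>) \<and>
     regular_borel_measure T (neg_variation (borel_of T) \<mu>)"


section \<open>Products of functionals and bounded Borel functions\<close>

definition local_measure ::
    "'a topology \<Rightarrow> (('a \<Rightarrow> real) \<Rightarrow> real) \<Rightarrow> 'a set \<Rightarrow> ('a set \<Rightarrow> real)" where
  "local_measure T \<phi> U =
     (THE \<mu>. finite_signed_regular_borel (subtopology T U) \<mu> \<and>
        (\<forall>h\<in>Cc T. fsupp T h \<subseteq> U \<longrightarrow>
           \<phi> h = signed_integral (borel_of (subtopology T U)) \<mu> h))"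

definition rel_compact_open_nhd :: "'a topology \<Rightarrow> 'a set \<Rightarrow> 'a set \<Rightarrow> bool" where
  "rel_compact_open_nhd T K U \<longleftrightarrow>
     U \<noteq> {} \<and> openin T U \<and> compactin T (T closure_of U) \<and> K \<subseteq> U"

definition bounded_borel :: "'a topology \<Rightarrow> ('a \<Rightarrow> real) \<Rightarrow> bool" where
  "bounded_borel T g \<longleftrightarrow> g \<in> borel_measurable (borel_of T) \<and> bounded (g ` topspace T)"

text \<open>The value does not depend on the choice of the neighbourhood \<open>U\<close> of the support of \<open>f\<close>.\<close>

definition borel_mult ::
    "'a topology \<Rightarrow> ('a \<Rightarrow> real) \<Rightarrow> (('a \<Rightarrow> real) \<Rightarrow> real) \<Rightarrow> (('a \<Rightarrow> real) \<Rightarrow> real)" where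
  "borel_mult T g \<phi> = (\<lambda>f. if f \<in> Cc T then
       (let U = (SOME U. rel_compact_open_nhd T (fsupp T f) U)
        in signed_integral (borel_of (subtopology T U)) (local_measure T \<phi> U) (\<lambda>x. f x * g x))
     else 0)"

end

theory Submission
  imports Defs
begin

text \<open>
  By Tietze's theorem every function in \<open>Cc Y\<close> extends to \<open>Cc X\<close>, between prescribed bounds and with
  support in a prescribed neighbourhood. Hence a functional on \<open>Cc X\<close> is in the image of the adjoint
  as soon as it kills the functions vanishing on \<open>Y\<close>; this property passes to dominated functionals,
  which gives interval preservation and the ideal property. It holds when the support lies in \<open>Y\<close>,
  because a function vanishing on \<open>Y\<close> is approximated, uniformly and under one compactly supported
  bound, by functions whose support misses \<open>Y\<close>. The lattice operations are handled through the
  Riesz--Kantorovich formula for the positive part, which extension of functions transports to \<open>X\<close>.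

  For the products with Borel functions, write \<open>\<phi> = p - q\<close> with \<open>p\<close>, \<open>q\<close> positive and represent them by
  regular Borel measures on the whole space. On every relatively compact open \<open>U\<close> the local signed
  measure is the difference of the two restrictions, so \<open>g \<phi>\<close> is computed by the two global
  measures; and the measure of the adjoint of \<open>p\<close> is the image of the measure of \<open>p\<close> under
  \<open>Y \<subseteq> X\<close>, by uniqueness.
\<close>

section \<open>Compactly supported continuous functions\<close>

text \<open>A functional may be a difference of two infinite measures, so there is in general no
  global signed measure behind it. The product is therefore defined by \<open>local_measure\<close>,
  a definite description over a relatively compact open set that is itself picked by
  \<open>SOME\<close>, and the sets picked on \<open>X\<close> and on \<open>Y\<close> are
  unrelated. This is why products are compared only after both have been expressed by global
  positive measures, where no neighbourhood occurs any more. The global measures need not be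
  sigma-finite. Uniqueness therefore goes through regularity alone: compact sets determine the open
  ones, and open sets determine all others. Integrals against a signed measure are defined by its
  variations, whereas \<open>p\<close> and \<open>q\<close> yield merely some decomposition into
  finite measures \<open>P\<close> and \<open>Q\<close> on \<open>U\<close>. The two agree because
  the positive variation plus \<open>Q\<close> equals \<open>P\<close> plus the negative variation,
  an identity between positive measures.\<close>

lemma Cc_cont: "f \<in> Cc T \<Longrightarrow> continuous_map T euclideanreal f"
  and Cc_compactin: "f \<in> Cc T \<Longrightarrow> compactin T (fsupp T f)"
  by (auto simp: Cc_def)

lemma Cc_off: "f \<in> Cc T \<Longrightarrow> x \<notin> topspace T \<Longrightarrow> f x = 0"
  by (auto simp: Cc_def)

lemma fsupp_closedin [simp]: "closedin T (fsupp T f)"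
  by (simp add: fsupp_def)

lemma fsupp_subset_topspace: "fsupp T f \<subseteq> topspace T"
  by (simp add: closedin_subset)

lemma fsupp_least:
  assumes "closedin T K" "\<And>x. x \<in> topspace T \<Longrightarrow> x \<notin> K \<Longrightarrow> f x = 0"
  shows "fsupp T f \<subseteq> K"
  unfolding fsupp_def by (rule closure_of_minimal) (use assms in auto)

lemma Cc_off_fsupp:
  assumes "f \<in> Cc T" "x \<notin> fsupp T f"
  shows "f x = 0"
proof (cases "x \<in> topspace T")
  case True
  have "{x \<in> topspace T. f x \<noteq> 0} \<subseteq> fsupp T f"
    unfolding fsupp_def by (rule closure_of_subset) auto
  with True assms show ?thesis by auto
qed (simp add: Cc_off[OF assms(1)])

lemma Cc_I:
  assumes "continuous_map T euclideanreal f" "compactin T K" "closedin T K" "\<And>x. x \<notin> K \<Longrightarrow> f x = 0"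
  shows "f \<in> Cc T"
proof -
  have "fsupp T f \<subseteq> K" using assms by (intro fsupp_least) auto
  then have "compactin T (fsupp T f)"
    using assms(2) closed_compactin fsupp_closedin by blast
  moreover have "f x = 0" if "x \<notin> topspace T" for x
    using that assms(3,4) closedin_subset by blast
  ultimately show ?thesis using assms(1) by (auto simp: Cc_def)
qed

lemma Cc_I2:
  assumes c: "continuous_map T euclideanreal h" and f: "f \<in> Cc T" and g: "g \<in> Cc T"
    and 0: "\<And>x. f x = 0 \<Longrightarrow> g x = 0 \<Longrightarrow> h x = 0"
  shows "h \<in> Cc T"
proof (rule Cc_I[OF c])
  show "compactin T (fsupp T f \<union> fsupp T g)"
    using f g by (simp add: Cc_compactin compactin_Un)
  show "closedin T (fsupp T f \<union> fsupp T g)" by (simp add: closedin_Un)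
  show "h x = 0" if "x \<notin> fsupp T f \<union> fsupp T g" for x
    using that by (intro 0 Cc_off_fsupp[OF f] Cc_off_fsupp[OF g]) auto
qed

lemmas Cc_I1 = Cc_I2[where f = f and g = f for f, simplified]

lemma Cc_zero [simp]: "(\<lambda>x. 0) \<in> Cc T" "0 \<in> Cc T"
  unfolding zero_fun_def by (rule Cc_I[where K = "{}"]; simp)+

lemma Cc_plus: "f \<in> Cc T \<Longrightarrow> g \<in> Cc T \<Longrightarrow> (\<lambda>x. f x + g x) \<in> Cc T"
  by (rule Cc_I2[of _ _ f g]) (auto intro: continuous_map_add Cc_cont)

lemma Cc_diff: "f \<in> Cc T \<Longrightarrow> g \<in> Cc T \<Longrightarrow> (\<lambda>x. f x - g x) \<in> Cc T"
  by (rule Cc_I2[of _ _ f g]) (auto intro: continuous_map_diff Cc_cont)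

lemma Cc_max: "f \<in> Cc T \<Longrightarrow> g \<in> Cc T \<Longrightarrow> (\<lambda>x. max (f x) (g x)) \<in> Cc T"
  by (rule Cc_I2[of _ _ f g]) (auto intro: continuous_map_real_max Cc_cont)

lemma Cc_min: "f \<in> Cc T \<Longrightarrow> g \<in> Cc T \<Longrightarrow> (\<lambda>x. min (f x) (g x)) \<in> Cc T"
  by (rule Cc_I2[of _ _ f g]) (auto intro: continuous_map_real_min Cc_cont)

lemma Cc_mult_cont:
  "f \<in> Cc T \<Longrightarrow> continuous_map T euclideanreal g \<Longrightarrow> (\<lambda>x. f x * g x) \<in> Cc T"
  by (rule Cc_I1[of _ _ f]) (auto intro: continuous_map_real_mult Cc_cont)

lemma Cc_scale: "f \<in> Cc T \<Longrightarrow> (\<lambda>x. c * f x) \<in> Cc T"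
  by (rule Cc_I1[of _ _ f]) (auto intro: continuous_map_real_mult Cc_cont)

lemma Cc_minus: "f \<in> Cc T \<Longrightarrow> (\<lambda>x. - f x) \<in> Cc T"
  by (rule Cc_I1[of _ _ f]) (auto intro: continuous_map_minus Cc_cont)

lemma Cc_abs: "f \<in> Cc T \<Longrightarrow> (\<lambda>x. \<bar>f x\<bar>) \<in> Cc T"
  by (rule Cc_I1[of _ _ f]) (auto intro: continuous_map_real_abs Cc_cont)

lemmas Cc_intros = Cc_zero Cc_plus Cc_diff Cc_max Cc_min Cc_scale Cc_minus Cc_abs

lemma Cc_closedin_superlevel: "f \<in> Cc T \<Longrightarrow> closedin T {x \<in> topspace T. a \<le> f x}"
  using closedin_continuous_map_preimage[OF Cc_cont, of f T "{a..}"] by (simp add: vimage_def)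

lemma Cc_compactin_superlevel:
  assumes "f \<in> Cc T" "a > 0"
  shows "compactin T {x \<in> topspace T. a \<le> f x}"
  using Cc_compactin[OF assms(1)] _ Cc_closedin_superlevel[OF assms(1)]
proof (rule closed_compactin)
  show "{x \<in> topspace T. a \<le> f x} \<subseteq> fsupp T f"
    using Cc_off_fsupp[OF assms(1)] assms(2) by force
qed

lemma openin_continuous_superlevel:
  "continuous_map T euclideanreal f \<Longrightarrow> openin T {x \<in> topspace T. a < f x}"
  using openin_continuous_map_preimage[of T euclideanreal f "{a<..}"] by (simp add: vimage_def)

section \<open>Urysohn functions on a locally compact Hausdorff space\<close>

locale lch =
  fixes T :: "'a topology"
  assumes hausdorff: "Hausdorff_space T" and loc_compact: "locally_compact_space T"
begin

lemma compactin_closedin: "compactin T K \<Longrightarrow> closedin T K"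
  using compactin_imp_closedin hausdorff by blast

lemma compact_nbhd:
  assumes C: "compactin T C" and V: "openin T V" "C \<subseteq> V"
  obtains W K where "openin T W" "compactin T K" "C \<subseteq> W" "W \<subseteq> K" "K \<subseteq> V"
proof -
  have nb: "neighbourhood_base_of (compactin T) T"
    using locally_compact_space_neighbourhood_base hausdorff loc_compact by blast
  have "\<exists>U K. openin T U \<and> compactin T K \<and> x \<in> U \<and> U \<subseteq> K \<and> K \<subseteq> V" if "x \<in> C" for x
    using nb V that unfolding neighbourhood_base_of by blast
  then obtain U K where UK: "\<And>x. x \<in> C \<Longrightarrow> openin T (U x) \<and> compactin T (K x) \<and> x \<in> U x \<and> U x \<subseteq> K x \<and> K x \<subseteq> V"
    by metis
  have "\<exists>F. finite F \<and> F \<subseteq> U ` C \<and> C \<subseteq> \<Union>F"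
    using UK by (intro compactinD[OF C]) auto
  then obtain D where D: "finite D" "D \<subseteq> C" "C \<subseteq> \<Union>(U ` D)"
    by (metis finite_subset_image)
  show thesis
  proof
    show "openin T (\<Union>(U ` D))" using UK D by blast
    show "compactin T (\<Union>(K ` D))" using UK D by (intro compactin_Union) auto
    show "C \<subseteq> \<Union>(U ` D)" by (fact D)
    show "\<Union>(U ` D) \<subseteq> \<Union>(K ` D)" "\<Union>(K ` D) \<subseteq> V" using UK D by blast+
  qed
qed

lemma urysohn:
  assumes C: "compactin T C" and V: "openin T V" "C \<subseteq> V"
  obtains h W where "h \<in> Cc T" "\<And>x. 0 \<le> h x" "\<And>x. h x \<le> 1" "fsupp T h \<subseteq> V"
    "openin T W" "C \<subseteq> W" "\<And>x. x \<in> W \<Longrightarrow> h x = 1"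
proof -
  obtain W K where WK: "openin T W" "compactin T K" "C \<subseteq> W" "W \<subseteq> K" "K \<subseteq> V"
    using compact_nbhd[OF C V] .
  have "completely_regular_space T"
    using hausdorff loc_compact locally_compact_regular_imp_completely_regular_space by blast
  moreover have "closedin T (topspace T - W)" using WK by blast
  moreover have "disjnt C (topspace T - W)" using WK by (auto simp: disjnt_def)
  \<comment> \<open>The value 2 on \<open>C\<close> leaves room for clipping at 1: the clipped
    function is 1 on the open set where \<open>f > 1\<close>, and not merely on
    \<open>C\<close>.\<close>
  ultimately obtain f where f: "continuous_map T euclideanreal f"
    "f ` C \<subseteq> {2}" "f ` (topspace T - W) \<subseteq> {0}"
    using Urysohn_completely_regular_compact_closed_alt[OF _ C] by metis
  define h where "h = (\<lambda>x. if x \<in> topspace T then max 0 (min 1 (f x)) else 0)"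
  have ch: "continuous_map T euclideanreal h"
    by (rule continuous_map_eq[of _ _ "\<lambda>x. max 0 (min 1 (f x))"])
      (auto simp: h_def intro!: continuous_map_real_max continuous_map_real_min f)
  have 0: "h x = 0" if "x \<notin> W" for x using that f by (auto simp: h_def)
  have K: "closedin T K" by (simp add: WK compactin_closedin)
  show thesis
  proof
    show "h \<in> Cc T" using WK 0 by (intro Cc_I[OF ch _ K]) auto
    show "fsupp T h \<subseteq> V" using fsupp_least[OF K, of h] 0 WK by blast
    show "openin T {x \<in> topspace T. 1 < f x}" using f(1) openin_continuous_superlevel by blast
    show "C \<subseteq> {x \<in> topspace T. 1 < f x}" using f(2) compactin_subset_topspace[OF C] by auto
  qed (auto simp: h_def)
qed

lemma cutoff:
  assumes "compactin T C"
  obtains h where "h \<in> Cc T" "\<And>x. 0 \<le> h x" "\<And>x. h x \<le> 1" "\<And>x. x \<in> C \<Longrightarrow> h x = 1"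
  using urysohn[OF assms openin_topspace compactin_subset_topspace[OF assms]] by (metis subsetD)

text \<open>A two-set partition of unity in product form: \<open>h\<close> is 1 on an open
  \<open>G\<close> around the part of the support of \<open>f\<close> outside \<open>W\<close>.
  Openness of \<open>G\<close> makes \<open>fsupp T f - G\<close> closed, hence a bound for the
  support of \<open>f * (1 - h)\<close> and not only for its nonzero set.\<close>

lemma Cc_split:
  assumes f: "f \<in> Cc T" and V: "openin T V" and W: "openin T W" and sub: "fsupp T f \<subseteq> V \<union> W"
  obtains h where "continuous_map T euclideanreal h" "\<And>x. 0 \<le> h x" "\<And>x. h x \<le> 1"
    "(\<lambda>x. f x * h x) \<in> Cc T" "fsupp T (\<lambda>x. f x * h x) \<subseteq> V"
    "(\<lambda>x. f x * (1 - h x)) \<in> Cc T" "fsupp T (\<lambda>x. f x * (1 - h x)) \<subseteq> W"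
proof -
  have "compactin T (fsupp T f - W)"
    using closed_compactin[OF Cc_compactin[OF f]] W by (metis Diff_subset closedin_diff fsupp_closedin)
  then obtain h G where h: "h \<in> Cc T" "\<And>x. 0 \<le> h x" "\<And>x. h x \<le> 1" "fsupp T h \<subseteq> V"
    "openin T G" "fsupp T f - W \<subseteq> G" "\<And>x. x \<in> G \<Longrightarrow> h x = 1"
    by (rule urysohn[where V = V]) (use V sub in auto)
  show thesis
  proof
    show "fsupp T (\<lambda>x. f x * h x) \<subseteq> V"
      using fsupp_least[OF fsupp_closedin, of T h "\<lambda>x. f x * h x"] Cc_off_fsupp[OF h(1)] h(4) by auto
    have "closedin T (fsupp T f - G)" using h(5) by auto
    then have "fsupp T (\<lambda>x. f x * (1 - h x)) \<subseteq> fsupp T f - G"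
      by (rule fsupp_least) (use h(7) Cc_off_fsupp[OF f] in auto)
    then show "fsupp T (\<lambda>x. f x * (1 - h x)) \<subseteq> W" using h(6) by auto
    show "(\<lambda>x. f x * h x) \<in> Cc T" "(\<lambda>x. f x * (1 - h x)) \<in> Cc T"
      using h(1) by (intro Cc_mult_cont[OF f] continuous_map_diff; simp add: Cc_cont)+
  qed (use h in \<open>auto intro: Cc_cont\<close>)
qed

end

section \<open>Extension of functions from a closed subspace\<close>

locale lch_closed = lch X for X :: "'a topology" +
  fixes Y :: "'a set"
  assumes closedY: "closedin X Y"
begin

abbreviation "XY \<equiv> subtopology X Y"

lemma Y_subset: "Y \<subseteq> topspace X" using closedY closedin_subset by blast

lemma topspace_Int_Y [simp]: "topspace X \<inter> Y = Y" using Y_subset by auto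

sublocale Y: lch XY
  by standard
    (auto simp: Hausdorff_space_subtopology hausdorff locally_compact_space_closed_subset loc_compact closedY)

text \<open>\<open>X\<close> may fail to be normal, so Tietze's theorem is applied on the compact
  set \<open>?K \<inter> Y\<close>, where \<open>?K\<close> is the support of a cutoff
  \<open>k\<close> that is 1 on the support of \<open>h\<close>. The product \<open>k * g\<close>
  restricts to \<open>h\<close>: at points of \<open>?K \<inter> Y\<close> off the support of
  \<open>h\<close> the factor \<open>g\<close> vanishes, and off \<open>?K\<close> both
  \<open>k\<close> and \<open>h\<close> vanish.\<close>

lemma Cc_extend_supp:
  assumes h: "h \<in> Cc XY" and V: "openin X V" "fsupp XY h \<subseteq> V"
  obtains H where "H \<in> Cc X" "fsupp X H \<subseteq> V" "zero_off Y H = h"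
proof -
  let ?S = "fsupp XY h"
  have cS: "compactin X ?S" using Cc_compactin[OF h] by (simp add: compactin_subtopology)
  obtain k where k: "k \<in> Cc X" "\<And>x. 0 \<le> k x" "fsupp X k \<subseteq> V" "\<And>x. x \<in> ?S \<Longrightarrow> k x = 1"
    using urysohn[OF cS V] by (metis subsetD)
  let ?K = "fsupp X k"
  have cK: "compactin X (?K \<inter> Y)"
    using closed_compactin[OF Cc_compactin[OF k(1)]] closedY by (metis closedin_Int fsupp_closedin inf_le1)
  have "continuous_map (subtopology X (?K \<inter> Y)) euclideanreal h"
    using continuous_map_from_subtopology[OF Cc_cont[OF h], of ?K] by (simp add: subtopology_subtopology Int_commute)
  moreover have "completely_regular_space X"
    using hausdorff loc_compact locally_compact_regular_imp_completely_regular_space by blast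
  ultimately obtain g where g: "continuous_map X euclideanreal g" "\<And>x. x \<in> ?K \<inter> Y \<Longrightarrow> g x = h x"
    using Tietze_extension_completely_regular[OF _ cK, of UNIV h] by auto
  show thesis
  proof
    show "(\<lambda>x. k x * g x) \<in> Cc X" using k g by (intro Cc_mult_cont)
    show "fsupp X (\<lambda>x. k x * g x) \<subseteq> V"
      using fsupp_least[OF fsupp_closedin, of X k "\<lambda>x. k x * g x"] Cc_off_fsupp[OF k(1)] k(3) by auto
    have "k x * g x = h x" if "x \<in> Y" for x
    proof (cases "x \<in> ?S")
      case True
      then have "k x = 1" using k by auto
      moreover then have "x \<in> ?K" using Cc_off_fsupp[OF k(1)] by fastforce
      ultimately show ?thesis using g that by simp
    next
      case False
      then show ?thesis using Cc_off_fsupp[OF h False] g(2)[of x] Cc_off_fsupp[OF k(1), of x] that by fastforce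
    qed
    moreover have "h x = 0" if "x \<notin> Y" for x using Cc_off[OF h] that by simp
    ultimately show "zero_off Y (\<lambda>x. k x * g x) = h" by (auto simp: zero_off_def)
  qed
qed

lemma Cc_extend:
  assumes "h \<in> Cc XY"
  obtains H where "H \<in> Cc X" "zero_off Y H = h"
proof -
  have "fsupp XY h \<subseteq> topspace X" using fsupp_subset_topspace[of XY h] Y_subset by simp
  then show thesis using Cc_extend_supp[OF assms openin_topspace] that by metis
qed

text \<open>Any extension is clipped into the band between \<open>F\<close> and \<open>G\<close>; on
  \<open>Y\<close> clipping changes nothing because \<open>h\<close> already lies in the
  band.\<close>

lemma Cc_extend_between:
  assumes h: "h \<in> Cc XY" and F: "F \<in> Cc X" and G: "G \<in> Cc X" "\<And>x. F x \<le> G x"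
    and le: "\<And>x. x \<in> Y \<Longrightarrow> F x \<le> h x" "\<And>x. x \<in> Y \<Longrightarrow> h x \<le> G x"
  obtains H where "H \<in> Cc X" "zero_off Y H = h" "\<And>x. F x \<le> H x" "\<And>x. H x \<le> G x"
proof -
  obtain H where H: "H \<in> Cc X" "zero_off Y H = h" using Cc_extend[OF h] .
  show thesis
  proof
    show "(\<lambda>x. max (F x) (min (G x) (H x))) \<in> Cc X" using H F G by (intro Cc_intros)
    have eq: "x \<in> Y \<Longrightarrow> H x = h x" "x \<notin> Y \<Longrightarrow> h x = 0" for x
      by (simp_all add: zero_off_def flip: H(2))
    show "zero_off Y (\<lambda>x. max (F x) (min (G x) (H x))) = h"
    proof
      fix x show "zero_off Y (\<lambda>x. max (F x) (min (G x) (H x))) x = h x"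
        using eq[of x] le[of x] by (cases "x \<in> Y") (auto simp: zero_off_def)
    qed
  qed (use G in auto)
qed

end

section \<open>The order dual as a vector lattice\<close>

lemma order_dual_add:
  "\<phi> \<in> order_dual T \<Longrightarrow> f \<in> Cc T \<Longrightarrow> g \<in> Cc T \<Longrightarrow> \<phi> (\<lambda>x. f x + g x) = \<phi> f + \<phi> g"
  by (auto simp: order_dual_def plus_fun_def)

lemma order_dual_scale:
  "\<phi> \<in> order_dual T \<Longrightarrow> f \<in> Cc T \<Longrightarrow> \<phi> (\<lambda>x. c * f x) = c * \<phi> f"
  by (auto simp: order_dual_def fscale_def)

lemma order_dual_off: "\<phi> \<in> order_dual T \<Longrightarrow> f \<notin> Cc T \<Longrightarrow> \<phi> f = 0"
  by (auto simp: order_dual_def)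

lemma order_dual_minus: "\<phi> \<in> order_dual T \<Longrightarrow> f \<in> Cc T \<Longrightarrow> \<phi> (\<lambda>x. - f x) = - \<phi> f"
  using order_dual_scale[of \<phi> T f "-1"] by simp

lemma order_dual_diff:
  "\<phi> \<in> order_dual T \<Longrightarrow> f \<in> Cc T \<Longrightarrow> g \<in> Cc T \<Longrightarrow> \<phi> (\<lambda>x. f x - g x) = \<phi> f - \<phi> g"
  using order_dual_add[of \<phi> T f "\<lambda>x. - g x"] order_dual_minus[of \<phi> T g] Cc_minus[of g T] by simp

lemma order_dual_zero: "\<phi> \<in> order_dual T \<Longrightarrow> \<phi> (\<lambda>x. 0) = 0"
  using order_dual_scale[of \<phi> T "\<lambda>x. 0" 0] by simp

lemma order_dual_bounded:
  assumes "\<phi> \<in> order_dual T" "k \<in> Cc T"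
  obtains C where "\<And>f. f \<in> Cc T \<Longrightarrow> (\<And>x. \<bar>f x\<bar> \<le> k x) \<Longrightarrow> \<bar>\<phi> f\<bar> \<le> C" "C \<ge> 0"
proof -
  let ?A = "order_interval (Cc T) (\<le>) (\<lambda>x. - k x) k"
  have "order_bounded (Cc T) (\<le>) ?A"
    using assms Cc_minus unfolding order_bounded_def by blast
  then have "order_bounded UNIV (\<le>) (\<phi> ` ?A)" using assms by (auto simp: order_dual_def)
  then obtain a b where ab: "\<phi> ` ?A \<subseteq> {a..b}"
    unfolding order_bounded_def order_interval_def by (auto simp: subset_iff)
  show thesis
  proof (rule that[of "\<bar>a\<bar> + \<bar>b\<bar>"])
    fix f assume f: "f \<in> Cc T" "\<And>x. \<bar>f x\<bar> \<le> k x"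
    have "f \<in> ?A" using f by (auto simp: order_interval_def le_fun_def abs_le_iff minus_le_iff)
    then have "\<phi> f \<in> {a..b}" using ab by blast
    then show "\<bar>\<phi> f\<bar> \<le> \<bar>a\<bar> + \<bar>b\<bar>" by auto
  qed auto
qed

text \<open>Symmetric intervals suffice for order boundedness: the interval from \<open>a\<close> to
  \<open>b\<close> lies between \<open>- k\<close> and \<open>k\<close> for
  \<open>k = max \<bar>a\<bar> \<bar>b\<bar>\<close>.\<close>

lemma order_dual_I:
  assumes add: "\<And>f g. f \<in> Cc T \<Longrightarrow> g \<in> Cc T \<Longrightarrow> \<phi> (\<lambda>x. f x + g x) = \<phi> f + \<phi> g"
    and scale: "\<And>c f. f \<in> Cc T \<Longrightarrow> \<phi> (\<lambda>x. c * f x) = c * \<phi> f"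
    and off: "\<And>f. f \<notin> Cc T \<Longrightarrow> \<phi> f = 0"
    and bdd: "\<And>k. k \<in> Cc T \<Longrightarrow> (\<And>x. 0 \<le> k x) \<Longrightarrow> \<exists>C. \<forall>f\<in>Cc T. (\<forall>x. \<bar>f x\<bar> \<le> k x) \<longrightarrow> \<bar>\<phi> f\<bar> \<le> C"
  shows "\<phi> \<in> order_dual T"
proof -
  have "order_bounded UNIV (\<le>) (\<phi> ` A)" if A: "order_bounded (Cc T) (\<le>) A" for A
  proof -
    obtain a b where ab: "a \<in> Cc T" "b \<in> Cc T" "\<And>f. f \<in> A \<Longrightarrow> f \<in> Cc T \<and> a \<le> f \<and> f \<le> b"
      using A unfolding order_bounded_def order_interval_def by blast
    have "(\<lambda>x. max \<bar>a x\<bar> \<bar>b x\<bar>) \<in> Cc T" using ab by (intro Cc_intros)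
    then obtain C where C: "\<And>f. f \<in> Cc T \<Longrightarrow> (\<And>x. \<bar>f x\<bar> \<le> max \<bar>a x\<bar> \<bar>b x\<bar>) \<Longrightarrow> \<bar>\<phi> f\<bar> \<le> C"
      using bdd[of "\<lambda>x. max \<bar>a x\<bar> \<bar>b x\<bar>"] by (auto simp: le_max_iff_disj)
    have "\<bar>\<phi> f\<bar> \<le> C" if "f \<in> A" for f
    proof (rule C)
      show "f \<in> Cc T" using ab that by blast
      show "\<bar>f x\<bar> \<le> max \<bar>a x\<bar> \<bar>b x\<bar>" for x
        using ab(3)[OF that] by (auto simp: le_fun_def dest!: spec[of _ x])
    qed
    then have "\<phi> ` A \<subseteq> {-C..C}" by (auto simp: abs_le_iff minus_le_iff)
    then show ?thesis unfolding order_bounded_def order_interval_def by (auto simp: subset_iff)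
  qed
  then show ?thesis using add scale off by (auto simp: order_dual_def plus_fun_def fscale_def)
qed

lemma dual_le_D: "dual_le T \<phi> \<psi> \<Longrightarrow> f \<in> Cc T \<Longrightarrow> (\<And>x. 0 \<le> f x) \<Longrightarrow> \<phi> f \<le> \<psi> f"
  by (auto simp: dual_le_def le_fun_def)

lemma dual_le_0_D: "dual_le T 0 \<phi> \<Longrightarrow> f \<in> Cc T \<Longrightarrow> (\<And>x. 0 \<le> f x) \<Longrightarrow> 0 \<le> \<phi> f"
  using dual_le_D[of T 0 \<phi> f] by simp

lemma dual_le_I: "(\<And>f. f \<in> Cc T \<Longrightarrow> (\<And>x. 0 \<le> f x) \<Longrightarrow> \<phi> f \<le> \<psi> f) \<Longrightarrow> dual_le T \<phi> \<psi>"
  by (auto simp: dual_le_def le_fun_def)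

lemma positive_mono:
  assumes "\<phi> \<in> order_dual T" "dual_le T 0 \<phi>" "f \<in> Cc T" "g \<in> Cc T" "\<And>x. f x \<le> g x"
  shows "\<phi> f \<le> \<phi> g"
proof -
  have "0 \<le> \<phi> (\<lambda>x. g x - f x)" using assms by (intro dual_le_0_D[of T \<phi>] Cc_diff) auto
  then show ?thesis using assms by (simp add: order_dual_diff)
qed

lemma order_dual_positive_I:
  assumes add: "\<And>f g. f \<in> Cc T \<Longrightarrow> g \<in> Cc T \<Longrightarrow> \<phi> (\<lambda>x. f x + g x) = \<phi> f + \<phi> g"
    and scale: "\<And>c f. f \<in> Cc T \<Longrightarrow> \<phi> (\<lambda>x. c * f x) = c * \<phi> f"
    and off: "\<And>f. f \<notin> Cc T \<Longrightarrow> \<phi> f = 0"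
    and pos: "\<And>f. f \<in> Cc T \<Longrightarrow> (\<And>x. 0 \<le> f x) \<Longrightarrow> 0 \<le> \<phi> f"
  shows "\<phi> \<in> order_dual T"
proof (rule order_dual_I[OF add scale off])
  fix k assume k: "k \<in> Cc T"
  have le: "\<phi> f \<le> \<phi> k" if f: "f \<in> Cc T" "\<And>x. f x \<le> k x" for f
  proof -
    have "0 \<le> \<phi> (\<lambda>x. k x + (-1) * f x)"
      using f k by (intro pos Cc_plus Cc_scale) auto
    also have "\<dots> = \<phi> k - \<phi> f" using add[OF k Cc_scale[OF f(1), of "-1"]] scale[OF f(1), of "-1"] by simp
    finally show ?thesis by simp
  qed
  have "\<bar>\<phi> f\<bar> \<le> \<phi> k" if f: "f \<in> Cc T" "\<forall>x. \<bar>f x\<bar> \<le> k x" for f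
  proof -
    have "\<phi> (\<lambda>x. (-1) * f x) \<le> \<phi> k"
      using f by (intro le Cc_scale) (auto simp: abs_le_iff)
    moreover have "\<phi> f \<le> \<phi> k" using f by (intro le) (auto simp: abs_le_iff)
    ultimately show ?thesis using scale[OF f(1), of "-1"] by simp
  qed
  then show "\<exists>C. \<forall>f\<in>Cc T. (\<forall>x. \<bar>f x\<bar> \<le> k x) \<longrightarrow> \<bar>\<phi> f\<bar> \<le> C" by blast
qed

lemma order_dual_subspace: "linear_subspace (order_dual T)"
  unfolding linear_subspace_def
proof (intro conjI ballI allI)
  show "0 \<in> order_dual T" by (rule order_dual_positive_I) auto
next
  fix \<phi> \<psi> assume p: "\<phi> \<in> order_dual T" "\<psi> \<in> order_dual T"
  show "\<phi> + \<psi> \<in> order_dual T"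
  proof (rule order_dual_I)
    fix k assume "k \<in> Cc T"
    then obtain C D where "\<And>f. f \<in> Cc T \<Longrightarrow> (\<And>x. \<bar>f x\<bar> \<le> k x) \<Longrightarrow> \<bar>\<phi> f\<bar> \<le> C"
      "\<And>f. f \<in> Cc T \<Longrightarrow> (\<And>x. \<bar>f x\<bar> \<le> k x) \<Longrightarrow> \<bar>\<psi> f\<bar> \<le> D"
      using order_dual_bounded[OF p(1)] order_dual_bounded[OF p(2)] by metis
    then show "\<exists>C. \<forall>f\<in>Cc T. (\<forall>x. \<bar>f x\<bar> \<le> k x) \<longrightarrow> \<bar>(\<phi> + \<psi>) f\<bar> \<le> C"
      by (intro exI[of _ "C + D"]) (auto simp: plus_fun_def intro!: order_trans[OF abs_triangle_ineq] add_mono)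
  qed (use p in \<open>simp_all add: plus_fun_def order_dual_add order_dual_scale order_dual_off algebra_simps\<close>)
next
  fix c and \<phi> assume p: "\<phi> \<in> order_dual T"
  show "fscale c \<phi> \<in> order_dual T"
  proof (rule order_dual_I)
    fix k assume "k \<in> Cc T"
    then obtain C where "\<And>f. f \<in> Cc T \<Longrightarrow> (\<And>x. \<bar>f x\<bar> \<le> k x) \<Longrightarrow> \<bar>\<phi> f\<bar> \<le> C"
      using order_dual_bounded[OF p(1)] by metis
    then show "\<exists>C. \<forall>f\<in>Cc T. (\<forall>x. \<bar>f x\<bar> \<le> k x) \<longrightarrow> \<bar>fscale c \<phi> f\<bar> \<le> C"
      by (intro exI[of _ "\<bar>c\<bar> * C"]) (auto simp: fscale_def abs_mult intro!: mult_left_mono)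
  qed (use p in \<open>simp_all add: fscale_def order_dual_add order_dual_scale order_dual_off algebra_simps\<close>)
qed

lemma order_dual_add_closed: "\<phi> \<in> order_dual T \<Longrightarrow> \<psi> \<in> order_dual T \<Longrightarrow> \<phi> + \<psi> \<in> order_dual T"
  using order_dual_subspace[of T] unfolding linear_subspace_def by blast

lemma order_dual_scale_closed: "\<phi> \<in> order_dual T \<Longrightarrow> fscale c \<phi> \<in> order_dual T"
  using order_dual_subspace[of T] unfolding linear_subspace_def by blast

lemma order_dual_uminus_closed: "\<phi> \<in> order_dual T \<Longrightarrow> - \<phi> \<in> order_dual T"
  using order_dual_scale_closed[of \<phi> T "-1"] by (simp add: fscale_def fun_Compl_def)

lemma order_dual_diff_closed: "\<phi> \<in> order_dual T \<Longrightarrow> \<psi> \<in> order_dual T \<Longrightarrow> \<phi> - \<psi> \<in> order_dual T"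
  using order_dual_add_closed[OF _ order_dual_uminus_closed[of \<psi>], of \<phi>] by simp

section \<open>Positive parts of functionals by the Riesz-Kantorovich formula\<close>

definition pos_sup :: "'a topology \<Rightarrow> (('a \<Rightarrow> real) \<Rightarrow> real) \<Rightarrow> ('a \<Rightarrow> real) \<Rightarrow> real" where
  "pos_sup T \<phi> f = (SUP g\<in>{g \<in> Cc T. \<forall>x. 0 \<le> g x \<and> g x \<le> f x}. \<phi> g)"

text \<open>The Riesz-Kantorovich supremum is additive on the non-negative cone; the difference of
  its values at the positive and negative parts of \<open>f\<close> is the linear extension to
  \<open>Cc T\<close>.\<close>

definition dual_pos :: "'a topology \<Rightarrow> (('a \<Rightarrow> real) \<Rightarrow> real) \<Rightarrow> ('a \<Rightarrow> real) \<Rightarrow> real" where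
  "dual_pos T \<phi> f =
    (if f \<in> Cc T then pos_sup T \<phi> (\<lambda>x. max (f x) 0) - pos_sup T \<phi> (\<lambda>x. max (- f x) 0) else 0)"

context
  fixes T :: "'a topology" and \<phi> :: "('a \<Rightarrow> real) \<Rightarrow> real"
  assumes \<phi>: "\<phi> \<in> order_dual T"
begin

lemma pos_sup_upper:
  assumes "f \<in> Cc T" "g \<in> Cc T" "\<And>x. 0 \<le> g x" "\<And>x. g x \<le> f x"
  shows "\<phi> g \<le> pos_sup T \<phi> f"
  unfolding pos_sup_def
proof (rule cSUP_upper)
  obtain C where C: "\<And>g. g \<in> Cc T \<Longrightarrow> (\<And>x. \<bar>g x\<bar> \<le> f x) \<Longrightarrow> \<bar>\<phi> g\<bar> \<le> C"
    using order_dual_bounded[OF \<phi> assms(1)] by metis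
  show "bdd_above (\<phi> ` {g \<in> Cc T. \<forall>x. 0 \<le> g x \<and> g x \<le> f x})"
  proof (rule bdd_aboveI2)
    fix g assume g: "g \<in> {g \<in> Cc T. \<forall>x. 0 \<le> g x \<and> g x \<le> f x}"
    then have "\<bar>\<phi> g\<bar> \<le> C" by (intro C) auto
    then show "\<phi> g \<le> C" by simp
  qed
qed (use assms in auto)

lemma pos_sup_least:
  assumes "\<And>x. 0 \<le> f x" "\<And>g. g \<in> Cc T \<Longrightarrow> (\<And>x. 0 \<le> g x) \<Longrightarrow> (\<And>x. g x \<le> f x) \<Longrightarrow> \<phi> g \<le> u"
  shows "pos_sup T \<phi> f \<le> u"
  unfolding pos_sup_def
proof (rule cSUP_least)
  have "(\<lambda>x. 0) \<in> {g \<in> Cc T. \<forall>x. 0 \<le> g x \<and> g x \<le> f x}" using assms(1) by auto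
  then show "{g \<in> Cc T. \<forall>x. 0 \<le> g x \<and> g x \<le> f x} \<noteq> {}" by blast
qed (use assms in auto)

lemma pos_sup_nonneg:
  assumes "f \<in> Cc T" "\<And>x. 0 \<le> f x"
  shows "0 \<le> pos_sup T \<phi> f"
  using pos_sup_upper[of f "\<lambda>x. 0"] assms order_dual_zero[OF \<phi>] by simp

lemma pos_sup_add:
  assumes f: "f \<in> Cc T" "\<And>x. 0 \<le> f x" and g: "g \<in> Cc T" "\<And>x. 0 \<le> g x"
  shows "pos_sup T \<phi> (\<lambda>x. f x + g x) = pos_sup T \<phi> f + pos_sup T \<phi> g"
proof (rule antisym)
  show "pos_sup T \<phi> (\<lambda>x. f x + g x) \<le> pos_sup T \<phi> f + pos_sup T \<phi> g"
  proof (rule pos_sup_least)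
    fix u assume u: "u \<in> Cc T" "\<And>x. 0 \<le> u x" "\<And>x. u x \<le> f x + g x"
    \<comment> \<open>Riesz decomposition: a function between 0 and \<open>f + g\<close> is the sum
      of one between 0 and \<open>f\<close> and one between 0 and \<open>g\<close>.\<close>
    let ?v = "\<lambda>x. min (u x) (f x)" and ?w = "\<lambda>x. u x - min (u x) (f x)"
    have vw: "?v \<in> Cc T" "?w \<in> Cc T" using u f by (auto intro!: Cc_intros)
    have "\<phi> u = \<phi> (\<lambda>x. ?v x + ?w x)" by simp
    also have "\<dots> = \<phi> ?v + \<phi> ?w" using vw by (rule order_dual_add[OF \<phi>])
    also have "\<phi> ?v \<le> pos_sup T \<phi> f" using vw u f by (intro pos_sup_upper) auto
    also have "\<phi> ?w \<le> pos_sup T \<phi> g"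
    proof (intro pos_sup_upper vw g(1))
      show "0 \<le> ?w x" for x by simp
      show "?w x \<le> g x" for x using u(3)[of x] g(2)[of x] by linarith
    qed
    finally show "\<phi> u \<le> pos_sup T \<phi> f + pos_sup T \<phi> g" by simp
  qed (use f g in auto)
  have "\<phi> u + \<phi> v \<le> pos_sup T \<phi> (\<lambda>x. f x + g x)"
    if "u \<in> Cc T" "\<And>x. 0 \<le> u x" "\<And>x. u x \<le> f x" "v \<in> Cc T" "\<And>x. 0 \<le> v x" "\<And>x. v x \<le> g x" for u v
    using pos_sup_upper[of "\<lambda>x. f x + g x" "\<lambda>x. u x + v x"] that f g
    by (simp add: Cc_plus order_dual_add[OF \<phi>] add_mono)
  then have *: "\<phi> u \<le> pos_sup T \<phi> (\<lambda>x. f x + g x) - \<phi> v"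
    if "u \<in> Cc T" "\<And>x. 0 \<le> u x" "\<And>x. u x \<le> f x" "v \<in> Cc T" "\<And>x. 0 \<le> v x" "\<And>x. v x \<le> g x" for u v
    using that by (simp add: le_diff_eq)
  \<comment> \<open>The two suprema are taken one after the other, with \<open>v\<close> fixed
    during the first.\<close>
  have "pos_sup T \<phi> f \<le> pos_sup T \<phi> (\<lambda>x. f x + g x) - \<phi> v"
    if "v \<in> Cc T" "\<And>x. 0 \<le> v x" "\<And>x. v x \<le> g x" for v
    by (rule pos_sup_least[OF f(2)]) (use that * in blast)
  then have **: "\<phi> v \<le> pos_sup T \<phi> (\<lambda>x. f x + g x) - pos_sup T \<phi> f"
    if "v \<in> Cc T" "\<And>x. 0 \<le> v x" "\<And>x. v x \<le> g x" for v
    using that by (simp add: le_diff_eq add.commute)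
  have "pos_sup T \<phi> g \<le> pos_sup T \<phi> (\<lambda>x. f x + g x) - pos_sup T \<phi> f"
    by (rule pos_sup_least[OF g(2)]) (use ** in blast)
  then show "pos_sup T \<phi> f + pos_sup T \<phi> g \<le> pos_sup T \<phi> (\<lambda>x. f x + g x)" by simp
qed

lemma pos_sup_scale:
  assumes f: "f \<in> Cc T" "\<And>x. 0 \<le> f x" and c: "c \<ge> 0"
  shows "pos_sup T \<phi> (\<lambda>x. c * f x) = c * pos_sup T \<phi> f"
proof -
  have le: "c * pos_sup T \<phi> f \<le> pos_sup T \<phi> (\<lambda>x. c * f x)" if f: "f \<in> Cc T" "\<And>x. 0 \<le> f x" and c: "c > 0" for c f
  proof -
    have "pos_sup T \<phi> f \<le> pos_sup T \<phi> (\<lambda>x. c * f x) / c"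
    proof (rule pos_sup_least[OF f(2)])
      fix g assume "g \<in> Cc T" "\<And>x. 0 \<le> g x" "\<And>x. g x \<le> f x"
      then show "\<phi> g \<le> pos_sup T \<phi> (\<lambda>x. c * f x) / c"
        using pos_sup_upper[of "\<lambda>x. c * f x" "\<lambda>x. c * g x"] f c
        by (simp add: Cc_scale order_dual_scale[OF \<phi>] field_simps)
    qed
    then show ?thesis using c by (simp add: field_simps)
  qed
  show ?thesis
  proof (cases "c = 0")
    case True
    have "pos_sup T \<phi> (\<lambda>x. 0) = 0"
      using pos_sup_add[of "\<lambda>x. 0" "\<lambda>x. 0"] by simp
    then show ?thesis using True by simp
  next
    case False
    then have "pos_sup T \<phi> (\<lambda>x. c * f x) \<le> c * pos_sup T \<phi> f"
      using le[of "\<lambda>x. c * f x" "1 / c"] f c by (simp add: Cc_scale field_simps)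
    then show ?thesis using le[OF f, of c] c False by simp
  qed
qed

lemma dual_pos_nonneg:
  assumes "f \<in> Cc T" "\<And>x. 0 \<le> f x"
  shows "dual_pos T \<phi> f = pos_sup T \<phi> f"
proof -
  have "(\<lambda>x. max (f x) 0) = f" "(\<lambda>x. max (- f x) 0) = (\<lambda>x. 0)" using assms(2) by (auto simp: max_def fun_eq_iff intro: antisym)
  moreover have "pos_sup T \<phi> (\<lambda>x. 0) = 0" using pos_sup_scale[of "\<lambda>x. 0" 0] by simp
  ultimately show ?thesis using assms(1) by (simp add: dual_pos_def)
qed

lemma dual_pos_in: "dual_pos T \<phi> \<in> order_dual T"
proof (rule order_dual_positive_I)
  fix f g assume f: "f \<in> Cc T" and g: "g \<in> Cc T"
  let ?S = "pos_sup T \<phi>" and ?p = "\<lambda>f x. max (f x) (0::real)" and ?n = "\<lambda>f x. max (- f x) (0::real)"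
  let ?h = "\<lambda>x. f x + g x"
  have cc: "?p u \<in> Cc T" "?n u \<in> Cc T" if "u \<in> Cc T" for u using that by (auto intro!: Cc_intros)
  have h: "?h \<in> Cc T" using f g by (rule Cc_plus)
  \<comment> \<open>The equation between \<open>f + g\<close> and the parts of \<open>f\<close> and
    \<open>g\<close> is rearranged so that both sides are sums of non-negative functions, where
    \<open>pos_sup\<close> is additive.\<close>
  have "(\<lambda>x. (?p ?h x + ?n f x) + ?n g x) = (\<lambda>x. (?n ?h x + ?p f x) + ?p g x)"
    by (auto simp: fun_eq_iff)
  then have "?S (\<lambda>x. (?p ?h x + ?n f x) + ?n g x) = ?S (\<lambda>x. (?n ?h x + ?p f x) + ?p g x)" by simp
  then have "?S (?p ?h) + ?S (?n f) + ?S (?n g) = ?S (?n ?h) + ?S (?p f) + ?S (?p g)"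
    using cc[OF f] cc[OF g] cc[OF h] by (simp add: pos_sup_add Cc_plus)
  then show "dual_pos T \<phi> ?h = dual_pos T \<phi> f + dual_pos T \<phi> g"
    using f g h by (simp add: dual_pos_def)
next
  fix c f assume f: "f \<in> Cc T"
  let ?p = "\<lambda>x. max (f x) 0" and ?n = "\<lambda>x. max (- f x) 0"
  have cc: "?p \<in> Cc T" "?n \<in> Cc T" using f by (auto intro!: Cc_intros)
  show "dual_pos T \<phi> (\<lambda>x. c * f x) = c * dual_pos T \<phi> f"
  proof (cases "c \<ge> 0")
    case True
    then have "(\<lambda>x. max (c * f x) 0) = (\<lambda>x. c * ?p x)" "(\<lambda>x. max (- (c * f x)) 0) = (\<lambda>x. c * ?n x)"
      by (auto simp: fun_eq_iff max_def mult_le_0_iff zero_le_mult_iff)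
    then show ?thesis using True f cc by (simp add: dual_pos_def Cc_scale pos_sup_scale algebra_simps)
  next
    case False
    then have "(\<lambda>x. max (c * f x) 0) = (\<lambda>x. (-c) * ?n x)" "(\<lambda>x. max (- (c * f x)) 0) = (\<lambda>x. (-c) * ?p x)"
      by (auto simp: fun_eq_iff max_def mult_le_0_iff zero_le_mult_iff)
    then show ?thesis
      using False f cc pos_sup_scale[OF cc(1), of "-c"] pos_sup_scale[OF cc(2), of "-c"]
      by (simp add: dual_pos_def Cc_scale algebra_simps)
  qed
next
  show "0 \<le> dual_pos T \<phi> f" if "f \<in> Cc T" "\<And>x. 0 \<le> f x" for f
    using that by (simp add: dual_pos_nonneg pos_sup_nonneg)
qed (simp add: dual_pos_def)

lemma dual_pos_upper: "dual_le T \<phi> (dual_pos T \<phi>)" "dual_le T 0 (dual_pos T \<phi>)"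
  by (auto intro!: dual_le_I pos_sup_upper pos_sup_nonneg simp: dual_pos_nonneg)

lemma dual_pos_least:
  assumes "u \<in> order_dual T" "dual_le T \<phi> u" "dual_le T 0 u"
  shows "dual_le T (dual_pos T \<phi>) u"
proof (rule dual_le_I)
  fix f assume f: "f \<in> Cc T" "\<And>x. 0 \<le> f x"
  have "\<phi> g \<le> u f" if "g \<in> Cc T" "\<And>x. 0 \<le> g x" "\<And>x. g x \<le> f x" for g
    using dual_le_D[OF assms(2) that(1,2)] positive_mono[OF assms(1,3) that(1) f(1) that(3)] by simp
  then show "dual_pos T \<phi> f \<le> u f" using f by (simp add: dual_pos_nonneg pos_sup_least)
qed

end

section \<open>Lattice operations of the order dual\<close>

lemma dual_le_antisym:
  assumes p: "\<phi> \<in> order_dual T" "\<psi> \<in> order_dual T" and le: "dual_le T \<phi> \<psi>" "dual_le T \<psi> \<phi>"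
  shows "\<phi> = \<psi>"
proof
  fix f
  show "\<phi> f = \<psi> f"
  proof (cases "f \<in> Cc T")
    case True
    then have cc: "(\<lambda>x. max (f x) 0) \<in> Cc T" "(\<lambda>x. max (- f x) 0) \<in> Cc T" by (auto intro!: Cc_intros)
    have eq: "\<phi> g = \<psi> g" if "g \<in> Cc T" "\<And>x. 0 \<le> g x" for g
      using le[THEN dual_le_D] that by (meson antisym)
    have "f = (\<lambda>x. max (f x) 0 - max (- f x) 0)" by auto
    then show ?thesis using eq[OF cc(1)] eq[OF cc(2)] using order_dual_diff[OF p(1) cc] order_dual_diff[OF p(2) cc] by simp
  qed (use p order_dual_off in metis)
qed

text \<open>Translation by \<open>\<psi>\<close> reduces the supremum of two elements to a supremum
  with 0, which is the positive part of the difference.\<close>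

lemma dual_is_sup:
  assumes "\<phi> \<in> order_dual T" "\<psi> \<in> order_dual T"
  shows "is_sup (order_dual T) (dual_le T) {\<phi>, \<psi>} (dual_pos T (\<phi> - \<psi>) + \<psi>)"
proof -
  let ?d = "\<phi> - \<psi>"
  have d: "?d \<in> order_dual T" using assms by (rule order_dual_diff_closed)
  have "dual_le T (dual_pos T ?d + \<psi>) u" if u: "u \<in> order_dual T" "dual_le T \<phi> u" "dual_le T \<psi> u" for u
  proof -
    have "dual_le T ?d (u - \<psi>)" "dual_le T 0 (u - \<psi>)" using u by (auto simp: dual_le_def)
    then have "dual_le T (dual_pos T ?d) (u - \<psi>)"
      using dual_pos_least[OF d] order_dual_diff_closed assms u by blast
    then show ?thesis by (auto simp: dual_le_def algebra_simps)
  qed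
  moreover have "dual_le T \<phi> (dual_pos T ?d + \<psi>)" "dual_le T \<psi> (dual_pos T ?d + \<psi>)"
    using dual_pos_upper[OF d] by (auto simp: dual_le_def algebra_simps)
  moreover have "dual_pos T ?d + \<psi> \<in> order_dual T" using dual_pos_in[OF d] assms order_dual_add_closed by blast
  ultimately show ?thesis by (auto simp: is_sup_def)
qed

lemma dual_is_inf:
  assumes "\<phi> \<in> order_dual T" "\<psi> \<in> order_dual T"
  shows "is_inf (order_dual T) (dual_le T) {\<phi>, \<psi>} (\<phi> - dual_pos T (\<phi> - \<psi>))"
proof -
  let ?d = "\<phi> - \<psi>"
  have d: "?d \<in> order_dual T" using assms by (rule order_dual_diff_closed)
  have "dual_le T u (\<phi> - dual_pos T ?d)" if u: "u \<in> order_dual T" "dual_le T u \<phi>" "dual_le T u \<psi>" for u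
  proof -
    have "dual_le T ?d (\<phi> - u)" "dual_le T 0 (\<phi> - u)" using u by (auto simp: dual_le_def)
    then have "dual_le T (dual_pos T ?d) (\<phi> - u)"
      using dual_pos_least[OF d] order_dual_diff_closed assms u by blast
    then show ?thesis by (auto simp: dual_le_def algebra_simps)
  qed
  moreover have "dual_le T (\<phi> - dual_pos T ?d) \<phi>" "dual_le T (\<phi> - dual_pos T ?d) \<psi>"
    using dual_pos_upper[OF d] by (auto simp: dual_le_def algebra_simps)
  moreover have "\<phi> - dual_pos T ?d \<in> order_dual T" using dual_pos_in[OF d] assms order_dual_diff_closed by blast
  ultimately show ?thesis by (auto simp: is_inf_def)
qed

lemma vector_lattice_order_dual: "vector_lattice (order_dual T) (dual_le T)"
  unfolding vector_lattice_def
proof (intro conjI ballI allI impI)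
  show "linear_subspace (order_dual T)" by (rule order_dual_subspace)
  show "\<exists>s. is_sup (order_dual T) (dual_le T) {\<phi>, \<psi>} s"
    "\<exists>s. is_inf (order_dual T) (dual_le T) {\<phi>, \<psi>} s"
    if "\<phi> \<in> order_dual T" "\<psi> \<in> order_dual T" for \<phi> \<psi>
    using dual_is_sup[OF that] dual_is_inf[OF that] by blast+
  show "\<phi> = \<psi>" if "\<phi> \<in> order_dual T" "\<psi> \<in> order_dual T" "dual_le T \<phi> \<psi>" "dual_le T \<psi> \<phi>" for \<phi> \<psi>
    using dual_le_antisym that .
qed (auto simp: dual_le_def fscale_def intro: order_trans mult_left_mono)

lemma lat_sup_order_dual:
  assumes "\<phi> \<in> order_dual T" "\<psi> \<in> order_dual T"
  shows "lat_sup (order_dual T) (dual_le T) \<phi> \<psi> = dual_pos T (\<phi> - \<psi>) + \<psi>"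
  unfolding lat_sup_def
proof (rule the_equality)
  show "s = dual_pos T (\<phi> - \<psi>) + \<psi>" if "is_sup (order_dual T) (dual_le T) {\<phi>, \<psi>} s" for s
    using that dual_is_sup[OF assms] by (intro dual_le_antisym[of _ T]) (auto simp: is_sup_def)
qed (rule dual_is_sup[OF assms])

lemma lat_inf_order_dual:
  assumes "\<phi> \<in> order_dual T" "\<psi> \<in> order_dual T"
  shows "lat_inf (order_dual T) (dual_le T) \<phi> \<psi> = \<phi> - dual_pos T (\<phi> - \<psi>)"
  unfolding lat_inf_def
proof (rule the_equality)
  show "s = \<phi> - dual_pos T (\<phi> - \<psi>)" if "is_inf (order_dual T) (dual_le T) {\<phi>, \<psi>} s" for s
    using that dual_is_inf[OF assms] by (intro dual_le_antisym[of _ T]) (auto simp: is_inf_def)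
qed (rule dual_is_inf[OF assms])

text \<open>The second claim, for functions of any sign, is the form of domination that
  \<open>R_image_solid\<close> consumes.\<close>

lemma lat_abs_order_dual:
  assumes "\<phi> \<in> order_dual T"
  shows "lat_abs (order_dual T) (dual_le T) \<phi> \<in> order_dual T"
    and "f \<in> Cc T \<Longrightarrow> \<bar>\<phi> f\<bar> \<le> lat_abs (order_dual T) (dual_le T) \<phi> (\<lambda>x. \<bar>f x\<bar>)"
proof -
  let ?A = "lat_abs (order_dual T) (dual_le T) \<phi>"
  have m: "- \<phi> \<in> order_dual T" using assms by (rule order_dual_uminus_closed)
  have "is_sup (order_dual T) (dual_le T) {\<phi>, - \<phi>} ?A"
    unfolding lat_abs_def lat_sup_order_dual[OF assms m] using dual_is_sup[OF assms m] .
  then have A: "?A \<in> order_dual T" "dual_le T \<phi> ?A" "dual_le T (- \<phi>) ?A" by (auto simp: is_sup_def)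
  then show "?A \<in> order_dual T" by simp
  have le: "\<bar>\<phi> g\<bar> \<le> ?A g" if "g \<in> Cc T" "\<And>x. 0 \<le> g x" for g
    using dual_le_D[OF A(2) that] dual_le_D[OF A(3) that] by simp
  show "\<bar>\<phi> f\<bar> \<le> ?A (\<lambda>x. \<bar>f x\<bar>)" if f: "f \<in> Cc T"
  proof -
    let ?p = "\<lambda>x. max (f x) 0" and ?n = "\<lambda>x. max (- f x) 0"
    have cc: "?p \<in> Cc T" "?n \<in> Cc T" using f by (auto intro!: Cc_intros)
    have "f = (\<lambda>x. ?p x - ?n x)" by auto
    then have "\<phi> f = \<phi> ?p - \<phi> ?n" using order_dual_diff[OF assms cc] by simp
    moreover have "(\<lambda>x. \<bar>f x\<bar>) = (\<lambda>x. ?p x + ?n x)" by auto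
    then have "?A (\<lambda>x. \<bar>f x\<bar>) = ?A ?p + ?A ?n" using order_dual_add[OF A(1) cc] by simp
    ultimately show ?thesis using le[OF cc(1)] le[OF cc(2)] by simp
  qed
qed

section \<open>The adjoint of the restriction map\<close>

context lch_closed
begin

definition R :: "(('a \<Rightarrow> real) \<Rightarrow> real) \<Rightarrow> ('a \<Rightarrow> real) \<Rightarrow> real" where
  "R = order_adjoint X (zero_off Y)"

lemma zero_off_in: "f \<in> Cc X \<Longrightarrow> zero_off Y f \<in> Cc XY"
  using closedY by (rule zero_off_Cc)

lemma R_apply: "f \<in> Cc X \<Longrightarrow> R \<phi> f = \<phi> (zero_off Y f)"
  by (simp add: R_def order_adjoint_def)

lemma R_off: "f \<notin> Cc X \<Longrightarrow> R \<phi> f = 0"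
  by (simp add: R_def order_adjoint_def)

lemma R_plus: "R (\<phi> + \<psi>) = R \<phi> + R \<psi>"
  and R_diff: "R (\<phi> - \<psi>) = R \<phi> - R \<psi>"
  and R_fscale: "R (fscale c \<phi>) = fscale c (R \<phi>)"
  and R_zero: "R 0 = 0"
  and R_uminus: "R (- \<phi>) = - R \<phi>"
  by (auto simp: R_def order_adjoint_def fscale_def fun_eq_iff)

lemma zero_off_add: "zero_off Y (\<lambda>x. f x + g x) = (\<lambda>x. zero_off Y f x + zero_off Y g x)"
  and zero_off_scale: "zero_off Y (\<lambda>x. c * f x) = (\<lambda>x. c * zero_off Y f x)"
  by (auto simp: zero_off_def)

lemma R_in:
  assumes p: "\<phi> \<in> order_dual XY"
  shows "R \<phi> \<in> order_dual X"
proof (rule order_dual_I)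
  fix k assume k: "k \<in> Cc X"
  obtain C where C: "\<And>f. f \<in> Cc XY \<Longrightarrow> (\<And>x. \<bar>f x\<bar> \<le> zero_off Y k x) \<Longrightarrow> \<bar>\<phi> f\<bar> \<le> C"
    using order_dual_bounded[OF p zero_off_in[OF k]] by metis
  have "\<bar>R \<phi> f\<bar> \<le> C" if "f \<in> Cc X" "\<forall>x. \<bar>f x\<bar> \<le> k x" for f
    unfolding R_apply[OF that(1)] by (intro C zero_off_in that) (use that in \<open>simp add: zero_off_def\<close>)
  then show "\<exists>C. \<forall>f\<in>Cc X. (\<forall>x. \<bar>f x\<bar> \<le> k x) \<longrightarrow> \<bar>R \<phi> f\<bar> \<le> C" by blast
qed (use p in \<open>simp_all add: R_apply R_off Cc_plus Cc_scale zero_off_add zero_off_scale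
      order_dual_add order_dual_scale zero_off_in\<close>)

text \<open>A non-negative function on \<open>Y\<close> has a non-negative extension, namely the
  absolute value of any extension, so \<open>R\<close> reflects the order as well as preserving it.
  Injectivity is then antisymmetry of the order.\<close>

lemma R_le_iff: "dual_le X (R \<phi>) (R \<psi>) \<longleftrightarrow> dual_le XY \<phi> \<psi>"
proof
  assume le: "dual_le X (R \<phi>) (R \<psi>)"
  show "dual_le XY \<phi> \<psi>"
  proof (rule dual_le_I)
    fix h assume h: "h \<in> Cc XY" "\<And>x. 0 \<le> h x"
    obtain H where "H \<in> Cc X" "zero_off Y H = h" using Cc_extend[OF h(1)] .
    then have H: "(\<lambda>x. \<bar>H x\<bar>) \<in> Cc X" "zero_off Y (\<lambda>x. \<bar>H x\<bar>) = h"
      using h(2) by (auto intro!: Cc_abs simp: zero_off_def fun_eq_iff) (smt (verit))+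
    then show "\<phi> h \<le> \<psi> h" using dual_le_D[OF le H(1)] by (simp add: R_apply)
  qed
next
  assume le: "dual_le XY \<phi> \<psi>"
  show "dual_le X (R \<phi>) (R \<psi>)"
  proof (rule dual_le_I)
    fix f assume f: "f \<in> Cc X" "\<And>x. 0 \<le> f x"
    show "R \<phi> f \<le> R \<psi> f"
      unfolding R_apply[OF f(1)] using f by (intro dual_le_D[OF le] zero_off_in) (auto simp: zero_off_def)
  qed
qed

lemma R_inj: "inj_on R (order_dual XY)"
proof (rule inj_onI)
  fix \<phi> \<psi> assume p: "\<phi> \<in> order_dual XY" "\<psi> \<in> order_dual XY" and eq: "R \<phi> = R \<psi>"
  have "dual_le X (R \<phi>) (R \<psi>)" "dual_le X (R \<psi>) (R \<phi>)"
    using eq by (auto simp: dual_le_def)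
  then show "\<phi> = \<psi>" using p unfolding R_le_iff by (intro dual_le_antisym[of _ XY])
qed

text \<open>Restriction identifies \<open>Cc XY\<close> with the quotient of \<open>Cc X\<close> by
  the functions vanishing on \<open>Y\<close>, and \<open>\<Phi>\<close> descends to it: all
  extensions of \<open>h\<close> give the same value. What remains is order boundedness, which rests
  on extensions within bounds.\<close>

lemma R_factor:
  assumes P: "\<Phi> \<in> order_dual X" and 0: "\<And>f. f \<in> Cc X \<Longrightarrow> (\<And>x. x \<in> Y \<Longrightarrow> f x = 0) \<Longrightarrow> \<Phi> f = 0"
  shows "\<Phi> \<in> R ` order_dual XY"
proof -
  define E where "E h = (SOME H. H \<in> Cc X \<and> zero_off Y H = h)" for h
  have E: "E h \<in> Cc X" "zero_off Y (E h) = h" if h: "h \<in> Cc XY" for h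
  proof -
    have "\<exists>H. H \<in> Cc X \<and> zero_off Y H = h" using Cc_extend[OF h] by metis
    then show "E h \<in> Cc X" "zero_off Y (E h) = h" unfolding E_def by (metis (mono_tags, lifting) someI_ex)+
  qed
  define \<psi> where "\<psi> h = (if h \<in> Cc XY then \<Phi> (E h) else 0)" for h
  have \<psi>: "\<psi> h = \<Phi> H" if H: "H \<in> Cc X" "zero_off Y H = h" for h H
  proof -
    have h: "h \<in> Cc XY" using zero_off_in[OF H(1)] H(2) by simp
    have "\<Phi> (\<lambda>x. E h x - H x) = 0"
    proof (rule 0)
      show "(\<lambda>x. E h x - H x) \<in> Cc X" using E[OF h] H by (intro Cc_diff)
      have "zero_off Y (E h) = zero_off Y H" using E[OF h] H by simp
      then show "E h x - H x = 0" if "x \<in> Y" for x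
        using that by (auto simp: zero_off_def fun_eq_iff dest: spec[of _ x])
    qed
    then show ?thesis using order_dual_diff[OF P E(1)[OF h] H(1)] h by (simp add: \<psi>_def)
  qed
  have "\<psi> \<in> order_dual XY"
  proof (rule order_dual_I)
    fix f g assume f: "f \<in> Cc XY" and g: "g \<in> Cc XY"
    then have "\<psi> (\<lambda>x. f x + g x) = \<Phi> (\<lambda>x. E f x + E g x)"
      by (intro \<psi>) (simp_all add: Cc_plus zero_off_add E)
    then show "\<psi> (\<lambda>x. f x + g x) = \<psi> f + \<psi> g" using f g by (simp add: \<psi>_def order_dual_add[OF P] E)
  next
    fix c f assume f: "f \<in> Cc XY"
    then have "\<psi> (\<lambda>x. c * f x) = \<Phi> (\<lambda>x. c * E f x)"
      by (intro \<psi>) (simp_all add: Cc_scale zero_off_scale E)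
    then show "\<psi> (\<lambda>x. c * f x) = c * \<psi> f" using f by (simp add: \<psi>_def order_dual_scale[OF P] E)
  next
    fix k assume k: "k \<in> Cc XY" "\<And>x. 0 \<le> k x"
    define K where "K = (\<lambda>x. \<bar>E k x\<bar>)"
    have K: "K \<in> Cc X" "\<And>x. 0 \<le> K x" unfolding K_def using E[OF k(1)] by (auto intro: Cc_abs)
    have Kk: "K x = k x" if "x \<in> Y" for x
    proof -
      have "zero_off Y (E k) x = k x" using E(2)[OF k(1)] by simp
      then show ?thesis using that k(2)[of x] by (simp add: zero_off_def K_def)
    qed
    obtain C where C: "\<And>f. f \<in> Cc X \<Longrightarrow> (\<And>x. \<bar>f x\<bar> \<le> K x) \<Longrightarrow> \<bar>\<Phi> f\<bar> \<le> C"
      using order_dual_bounded[OF P K(1)] by metis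
    have "\<bar>\<psi> f\<bar> \<le> C" if f: "f \<in> Cc XY" "\<forall>x. \<bar>f x\<bar> \<le> k x" for f
    proof -
      have "- K x \<le> f x" "f x \<le> K x" if "x \<in> Y" for x
        using f(2) Kk[OF that] by (auto simp: abs_le_iff minus_le_iff dest: spec[of _ x])
      moreover have "- K x \<le> K x" for x using K(2)[of x] by simp
      \<comment> \<open>Every \<open>f\<close> bounded by \<open>k\<close> extends to a function
        bounded by the one function \<open>K\<close>, so a single bound of \<open>\<Phi>\<close>
        serves all of them.\<close>
      ultimately obtain H where H: "H \<in> Cc X" "zero_off Y H = f" "\<And>x. - K x \<le> H x" "\<And>x. H x \<le> K x"
        using Cc_extend_between[OF f(1) Cc_minus[OF K(1)] K(1)] by blast
      have "\<bar>\<Phi> H\<bar> \<le> C" using H by (intro C) (auto simp: abs_le_iff minus_le_iff)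
      then show ?thesis using \<psi>[OF H(1,2)] by simp
    qed
    then show "\<exists>C. \<forall>f\<in>Cc XY. (\<forall>x. \<bar>f x\<bar> \<le> k x) \<longrightarrow> \<bar>\<psi> f\<bar> \<le> C" by blast
  qed (simp add: \<psi>_def)
  moreover have "R \<psi> = \<Phi>"
  proof
    fix f show "R \<psi> f = \<Phi> f"
      using \<psi>[of f "zero_off Y f"] by (cases "f \<in> Cc X") (simp_all add: R_apply R_off order_dual_off[OF P])
  qed
  ultimately show ?thesis by blast
qed

text \<open>Both Riesz-Kantorovich suprema run over the same set of numbers, since the functions
  between 0 and \<open>zero_off Y f\<close> are exactly the restrictions of those between 0 and
  \<open>f\<close>.\<close>

lemma R_dual_pos:
  assumes p: "\<phi> \<in> order_dual XY"
  shows "R (dual_pos XY \<phi>) = dual_pos X (R \<phi>)"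
proof -
  have eq: "pos_sup XY \<phi> (zero_off Y f) = pos_sup X (R \<phi>) f" if f: "f \<in> Cc X" "\<And>x. 0 \<le> f x" for f
  proof -
    let ?A = "{g \<in> Cc XY. \<forall>x. 0 \<le> g x \<and> g x \<le> zero_off Y f x}" and ?B = "{g \<in> Cc X. \<forall>x. 0 \<le> g x \<and> g x \<le> f x}"
    have "\<phi> g \<in> R \<phi> ` ?B" if g: "g \<in> ?A" for g
    proof -
      have "g x \<le> f x" if "x \<in> Y" for x
        using g that by (auto simp: zero_off_def dest: spec[of _ x])
      then obtain G where "G \<in> Cc X" "zero_off Y G = g" "\<And>x. 0 \<le> G x" "\<And>x. G x \<le> f x"
        using Cc_extend_between[OF _ Cc_zero(1) f, of g] g by auto
      then show ?thesis by (intro image_eqI[of _ _ G]) (auto simp: R_apply)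
    qed
    moreover have "R \<phi> g \<in> \<phi> ` ?A" if g: "g \<in> ?B" for g
    proof -
      have "zero_off Y g \<in> ?A" using g zero_off_in[of g] by (simp add: zero_off_def)
      then show ?thesis using g by (simp add: R_apply)
    qed
    ultimately have "\<phi> ` ?A = R \<phi> ` ?B" by blast
    then show ?thesis by (simp add: pos_sup_def)
  qed
  show ?thesis
  proof
    fix f
    show "R (dual_pos XY \<phi>) f = dual_pos X (R \<phi>) f"
    proof (cases "f \<in> Cc X")
      case True
      have z: "(\<lambda>x. max (zero_off Y f x) 0) = zero_off Y (\<lambda>x. max (f x) 0)"
        "(\<lambda>x. max (- zero_off Y f x) 0) = zero_off Y (\<lambda>x. max (- f x) 0)"
        by (auto simp: zero_off_def)
      have "(\<lambda>x. max (f x) 0) \<in> Cc X" "(\<lambda>x. max (- f x) 0) \<in> Cc X" using True by (auto intro!: Cc_intros)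
      then show ?thesis using True by (simp add: R_apply dual_pos_def zero_off_in z eq)
    qed (simp add: R_off dual_pos_def)
  qed
qed

lemma R_linear_map: "linear_map (order_dual XY) (order_dual X) R"
  by (auto simp: linear_map_def R_in R_plus R_fscale)

lemma R_lattice_homomorphism:
  "lattice_homomorphism (order_dual XY) (dual_le XY) (order_dual X) (dual_le X) R"
  unfolding lattice_homomorphism_def
proof (intro conjI vector_lattice_order_dual R_linear_map ballI)
  fix \<phi> assume p: "\<phi> \<in> order_dual XY"
  have m: "- \<phi> \<in> order_dual XY" using p by (rule order_dual_uminus_closed)
  show "lat_abs (order_dual X) (dual_le X) (R \<phi>) = R (lat_abs (order_dual XY) (dual_le XY) \<phi>)"
    unfolding lat_abs_def R_uminus[symmetric] lat_sup_order_dual[OF R_in[OF p] R_in[OF m]]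
      lat_sup_order_dual[OF p m] R_diff[symmetric] R_dual_pos[OF order_dual_diff_closed[OF p m]] R_plus by (rule refl)
qed

lemma R_null:
  assumes p: "\<phi> \<in> order_dual XY" and f: "f \<in> Cc X" "\<And>x. x \<in> Y \<Longrightarrow> f x = 0"
  shows "R \<phi> f = 0"
proof -
  have "zero_off Y f = (\<lambda>x. 0)" using f by (auto simp: zero_off_def)
  then show ?thesis using f order_dual_zero[OF p] by (simp add: R_apply)
qed

lemma R_image_solid:
  assumes P: "\<Phi> \<in> order_dual X" and p: "\<phi> \<in> order_dual XY"
    and le: "\<And>f. f \<in> Cc X \<Longrightarrow> \<bar>\<Phi> f\<bar> \<le> R \<phi> (\<lambda>x. \<bar>f x\<bar>)"
  shows "\<Phi> \<in> R ` order_dual XY"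
proof (rule R_factor[OF P])
  fix f assume f: "f \<in> Cc X" "\<And>x. x \<in> Y \<Longrightarrow> f x = 0"
  have "R \<phi> (\<lambda>x. \<bar>f x\<bar>) = 0" using f by (intro R_null[OF p] Cc_abs) auto
  then show "\<Phi> f = 0" using le[OF f(1)] by simp
qed

lemma R_interval_preserving:
  "interval_preserving (order_dual XY) (dual_le XY) (order_dual X) (dual_le X) R"
  unfolding interval_preserving_def
proof (intro conjI vector_lattice_order_dual R_linear_map ballI impI)
  fix \<phi> assume p: "\<phi> \<in> order_dual XY" and pos: "dual_le XY 0 \<phi>"
  show "dual_le X 0 (R \<phi>)" using pos R_le_iff[of 0 \<phi>] by (simp add: R_zero)
  show "R ` order_interval (order_dual XY) (dual_le XY) 0 \<phi> = order_interval (order_dual X) (dual_le X) 0 (R \<phi>)"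
  proof (intro equalityI subsetI)
    fix \<Phi> assume "\<Phi> \<in> R ` order_interval (order_dual XY) (dual_le XY) 0 \<phi>"
    then show "\<Phi> \<in> order_interval (order_dual X) (dual_le X) 0 (R \<phi>)"
      using R_le_iff[of 0] by (auto simp: order_interval_def R_in R_le_iff R_zero)
  next
    fix \<Phi> assume "\<Phi> \<in> order_interval (order_dual X) (dual_le X) 0 (R \<phi>)"
    then have P: "\<Phi> \<in> order_dual X" "dual_le X 0 \<Phi>" "dual_le X \<Phi> (R \<phi>)" by (auto simp: order_interval_def)
    have "\<bar>\<Phi> f\<bar> \<le> R \<phi> (\<lambda>x. \<bar>f x\<bar>)" if f: "f \<in> Cc X" for f
    proof -
      have "\<Phi> f \<le> \<Phi> (\<lambda>x. \<bar>f x\<bar>)" "\<Phi> (\<lambda>x. - f x) \<le> \<Phi> (\<lambda>x. \<bar>f x\<bar>)"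
        using f by (auto intro!: positive_mono[OF P(1,2)] Cc_abs Cc_minus)
      then have "\<bar>\<Phi> f\<bar> \<le> \<Phi> (\<lambda>x. \<bar>f x\<bar>)" using order_dual_minus[OF P(1) f] by simp
      also have "\<dots> \<le> R \<phi> (\<lambda>x. \<bar>f x\<bar>)" by (rule dual_le_D[OF P(3)]) (use f Cc_abs in auto)
      finally show ?thesis .
    qed
    then obtain \<psi> where "\<psi> \<in> order_dual XY" "\<Phi> = R \<psi>" using R_image_solid[OF P(1) p] by blast
    moreover from this P have "dual_le XY 0 \<psi>" "dual_le XY \<psi> \<phi>" using R_le_iff[of 0 \<psi>] by (auto simp: R_le_iff R_zero)
    ultimately show "\<Phi> \<in> R ` order_interval (order_dual XY) (dual_le XY) 0 \<phi>"
      by (auto simp: order_interval_def)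
  qed
qed

lemma R_order_ideal: "order_ideal (order_dual X) (dual_le X) (R ` order_dual XY)"
  unfolding order_ideal_def vector_sublattice_def
proof (intro conjI vector_lattice_order_dual ballI impI)
  show "R ` order_dual XY \<subseteq> order_dual X" using R_in by blast
  show "linear_subspace (R ` order_dual XY)"
    using order_dual_subspace[of XY] unfolding linear_subspace_def
    by (auto simp flip: R_plus R_fscale intro!: image_eqI[where f = R, OF R_zero[symmetric]])
next
  fix \<Phi> \<Psi> assume "\<Phi> \<in> R ` order_dual XY" "\<Psi> \<in> R ` order_dual XY"
  then obtain \<phi> \<psi> where p: "\<phi> \<in> order_dual XY" "\<psi> \<in> order_dual XY" "\<Phi> = R \<phi>" "\<Psi> = R \<psi>" by blast
  have d: "dual_pos XY (\<phi> - \<psi>) \<in> order_dual XY" using p by (intro dual_pos_in order_dual_diff_closed)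
  have "lat_sup (order_dual X) (dual_le X) \<Phi> \<Psi> = R (dual_pos XY (\<phi> - \<psi>) + \<psi>)"
    "lat_inf (order_dual X) (dual_le X) \<Phi> \<Psi> = R (\<phi> - dual_pos XY (\<phi> - \<psi>))"
    using p by (simp_all add: lat_sup_order_dual lat_inf_order_dual R_in R_plus R_diff R_dual_pos order_dual_diff_closed)
  then show "lat_sup (order_dual X) (dual_le X) \<Phi> \<Psi> \<in> R ` order_dual XY"
    "lat_inf (order_dual X) (dual_le X) \<Phi> \<Psi> \<in> R ` order_dual XY"
    using order_dual_add_closed[OF d p(2)] order_dual_diff_closed[OF p(1) d] by simp_all
next
  fix \<Phi> \<Psi> assume P: "\<Phi> \<in> order_dual X" and "\<Psi> \<in> R ` order_dual XY"
    and le: "dual_le X (lat_abs (order_dual X) (dual_le X) \<Phi>) (lat_abs (order_dual X) (dual_le X) \<Psi>)"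
  then obtain \<psi> where p: "\<psi> \<in> order_dual XY" "\<Psi> = R \<psi>" by blast
  show "\<Phi> \<in> R ` order_dual XY"
  proof (rule R_image_solid[OF P lat_abs_order_dual(1)[OF p(1)]])
    fix f assume f: "f \<in> Cc X"
    have "lat_abs (order_dual X) (dual_le X) \<Psi> = R (lat_abs (order_dual XY) (dual_le XY) \<psi>)"
      using R_lattice_homomorphism p by (simp add: lattice_homomorphism_def)
    then show "\<bar>\<Phi> f\<bar> \<le> R (lat_abs (order_dual XY) (dual_le XY) \<psi>) (\<lambda>x. \<bar>f x\<bar>)"
      using lat_abs_order_dual(2)[OF P f] dual_le_D[OF le Cc_abs[OF f]] by simp
  qed
qed

text \<open>Evaluating \<open>R \<phi>\<close> at \<open>f\<close> is evaluating
  \<open>\<phi>\<close> at the restriction of \<open>f\<close>, which is one of the coordinates that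
  define the topology of the source.\<close>

lemma R_weak_star: "continuous_map (weak_star XY) (weak_star X) R"
  unfolding weak_star_def
proof (rule continuous_map_pullback')
  let ?P = "pullback_topology (order_dual XY) (\<lambda>\<phi>. restrict \<phi> (Cc XY)) (powertop_real (Cc XY))"
  have id: "continuous_map ?P (powertop_real (Cc XY)) (\<lambda>\<phi>. restrict \<phi> (Cc XY))"
    using continuous_map_pullback[OF continuous_map_id] unfolding id_comp .
  have "continuous_map ?P euclideanreal (\<lambda>\<phi>. R \<phi> f)" if f: "f \<in> Cc X" for f
  proof -
    have "continuous_map ?P euclideanreal (\<lambda>\<phi>. restrict \<phi> (Cc XY) (zero_off Y f))"
      using id zero_off_in[OF f] unfolding continuous_map_componentwise by blast
    then show ?thesis using f by (simp add: R_apply zero_off_in)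
  qed
  then show "continuous_map ?P (powertop_real (Cc X)) ((\<lambda>\<phi>. restrict \<phi> (Cc X)) \<circ> R)"
    by (auto simp: continuous_map_componentwise comp_def)
  show "topspace ?P \<subseteq> R -` order_dual X"
    by (auto simp: topspace_pullback_topology R_in)
qed

text \<open>From right to left, a function on \<open>Y\<close> has to be extended with its support
  still inside \<open>V\<close>; this is what the support control in \<open>Cc_extend_supp\<close>
  is for.\<close>

lemma vanishes_XY_iff:
  assumes p: "\<phi> \<in> order_dual XY" and V: "openin X V"
  shows "vanishes_on XY \<phi> (V \<inter> Y) \<longleftrightarrow> vanishes_on X (R \<phi>) V"
  unfolding vanishes_on_def
proof (intro iffI ballI impI)
  fix f assume *: "\<forall>f\<in>Cc XY. fsupp XY f \<subseteq> V \<inter> Y \<longrightarrow> \<phi> f = 0" and f: "f \<in> Cc X" "fsupp X f \<subseteq> V"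
  have "closedin XY (fsupp X f \<inter> Y)" by (metis closedin_subtopology fsupp_closedin)
  then have "fsupp XY (zero_off Y f) \<subseteq> fsupp X f \<inter> Y"
    by (rule fsupp_least) (auto simp: zero_off_def Cc_off_fsupp[OF f(1)])
  then show "R \<phi> f = 0" using * f by (auto simp: R_apply zero_off_in)
next
  fix h assume *: "\<forall>f\<in>Cc X. fsupp X f \<subseteq> V \<longrightarrow> R \<phi> f = 0" and h: "h \<in> Cc XY" "fsupp XY h \<subseteq> V \<inter> Y"
  then obtain H where "H \<in> Cc X" "fsupp X H \<subseteq> V" "zero_off Y H = h"
    using Cc_extend_supp[OF h(1) V] by blast
  then show "\<phi> h = 0" using * by (auto simp: R_apply)
qed

text \<open>On \<open>Y\<close> the supports are compared pointwise, open sets of \<open>Y\<close>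
  being traces of open sets of \<open>X\<close>. Points off \<open>Y\<close> lie in neither support,
  because \<open>R \<phi>\<close> vanishes on the open complement of \<open>Y\<close>.\<close>

lemma R_supp:
  assumes p: "\<phi> \<in> order_dual XY"
  shows "dual_supp XY \<phi> = dual_supp X (R \<phi>)"
proof -
  have "vanishes_on X (R \<phi>) (topspace X - Y)"
  proof (subst vanishes_XY_iff[OF p, symmetric])
    show "vanishes_on XY \<phi> ((topspace X - Y) \<inter> Y)"
      unfolding vanishes_on_def
    proof (intro ballI impI)
      fix h assume "h \<in> Cc XY" "fsupp XY h \<subseteq> (topspace X - Y) \<inter> Y"
      then have "h = (\<lambda>x. 0)" using Cc_off_fsupp[of h XY] by auto
      then show "\<phi> h = 0" using order_dual_zero[OF p] by simp
    qed
  qed (use closedY in auto)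
  then have "dual_supp X (R \<phi>) \<subseteq> Y" using closedY by (auto simp: dual_supp_def)
  moreover have "x \<in> dual_supp XY \<phi> \<longleftrightarrow> x \<in> dual_supp X (R \<phi>)" if x: "x \<in> Y" for x
  proof -
    have "(\<exists>U. openin XY U \<and> vanishes_on XY \<phi> U \<and> x \<in> U) \<longleftrightarrow> (\<exists>V. openin X V \<and> vanishes_on X (R \<phi>) V \<and> x \<in> V)"
      using x vanishes_XY_iff[OF p] by (auto simp: openin_subtopology)
    then show ?thesis using x Y_subset by (auto simp: dual_supp_def)
  qed
  moreover have "dual_supp XY \<phi> \<subseteq> Y" by (auto simp: dual_supp_def)
  ultimately show ?thesis by blast
qed

end

text \<open>Finitely many of the sets cover the compact support of \<open>f\<close>, and
  \<open>Cc_split\<close>, applied one set at a time, writes \<open>f\<close> as a sum of functions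
  that \<open>\<phi>\<close> kills. In particular a functional vanishes on the complement of its
  support.\<close>

lemma (in lch) vanishes_on_Union:
  assumes p: "\<phi> \<in> order_dual T" and U: "\<And>U. U \<in> \<U> \<Longrightarrow> openin T U \<and> vanishes_on T \<phi> U"
  shows "vanishes_on T \<phi> (\<Union>\<U>)"
proof -
  have fin: "\<phi> f = 0" if "finite \<F>" "\<F> \<subseteq> \<U>" "f \<in> Cc T" "fsupp T f \<subseteq> \<Union>\<F>" for \<F> f
    using that
  proof (induction arbitrary: f)
    case empty
    then have "f = (\<lambda>x. 0)" using Cc_off_fsupp[of f T] by auto
    then show ?case using order_dual_zero[OF p] by simp
  next
    case (insert V \<F>)
    have "openin T V" "openin T (\<Union>\<F>)" "fsupp T f \<subseteq> V \<union> \<Union>\<F>" using insert.prems U by auto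
    then obtain h where h: "(\<lambda>x. f x * h x) \<in> Cc T" "fsupp T (\<lambda>x. f x * h x) \<subseteq> V"
      "(\<lambda>x. f x * (1 - h x)) \<in> Cc T" "fsupp T (\<lambda>x. f x * (1 - h x)) \<subseteq> \<Union>\<F>"
      by (rule Cc_split[OF insert.prems(2)])
    have "\<phi> f = \<phi> (\<lambda>x. f x * h x + f x * (1 - h x))" by (simp add: algebra_simps)
    also have "\<dots> = \<phi> (\<lambda>x. f x * h x) + \<phi> (\<lambda>x. f x * (1 - h x))" using h by (intro order_dual_add[OF p])
    also have "\<phi> (\<lambda>x. f x * h x) = 0" using h U insert.prems by (auto simp: vanishes_on_def)
    also have "\<phi> (\<lambda>x. f x * (1 - h x)) = 0" using insert h by auto
    finally show ?case by simp
  qed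
  show ?thesis
    unfolding vanishes_on_def
  proof (intro ballI impI)
    fix f assume f: "f \<in> Cc T" "fsupp T f \<subseteq> \<Union>\<U>"
    have "\<exists>\<F>. finite \<F> \<and> \<F> \<subseteq> \<U> \<and> fsupp T f \<subseteq> \<Union>\<F>"
      using U f by (intro compactinD[OF Cc_compactin[OF f(1)]]) auto
    then show "\<phi> f = 0" using fin f by blast
  qed
qed

lemma (in lch_closed) R_image: "R ` order_dual XY = {\<Phi> \<in> order_dual X. dual_supp X \<Phi> \<subseteq> Y}"
proof (intro equalityI subsetI)
  fix \<Phi> assume "\<Phi> \<in> R ` order_dual XY"
  then obtain \<phi> where p: "\<phi> \<in> order_dual XY" "\<Phi> = R \<phi>" by blast
  have "dual_supp XY \<phi> \<subseteq> Y" by (auto simp: dual_supp_def)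
  then show "\<Phi> \<in> {\<Phi> \<in> order_dual X. dual_supp X \<Phi> \<subseteq> Y}" using p R_in R_supp by simp
next
  fix \<Phi> assume "\<Phi> \<in> {\<Phi> \<in> order_dual X. dual_supp X \<Phi> \<subseteq> Y}"
  then have P: "\<Phi> \<in> order_dual X" and s: "dual_supp X \<Phi> \<subseteq> Y" by auto
  show "\<Phi> \<in> R ` order_dual XY"
  proof (rule R_factor[OF P])
    fix f assume f: "f \<in> Cc X" "\<And>x. x \<in> Y \<Longrightarrow> f x = 0"
    have van: "vanishes_on X \<Phi> (\<Union>{U. openin X U \<and> vanishes_on X \<Phi> U})"
      using P by (rule vanishes_on_Union) auto
    obtain k where k: "k \<in> Cc X" "\<And>x. 0 \<le> k x" "\<And>x. x \<in> fsupp X f \<Longrightarrow> k x = 1"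
      using cutoff[OF Cc_compactin[OF f(1)]] by metis
    obtain C where C: "\<And>f. f \<in> Cc X \<Longrightarrow> (\<And>x. \<bar>f x\<bar> \<le> k x) \<Longrightarrow> \<bar>\<Phi> f\<bar> \<le> C" "C \<ge> 0"
      using order_dual_bounded[OF P k(1)] by metis
    have bound: "\<bar>\<Phi> f\<bar> \<le> e * C" if e: "e > 0" for e
    proof -
      \<comment> \<open>Truncation at height \<open>e\<close>. The excess \<open>?v\<close> is
        supported where \<open>\<bar>f\<bar> \<ge> e\<close>, hence off \<open>Y\<close>, and is
        killed. The truncated part satisfies \<open>\<bar>?u\<bar> \<le> e * k\<close> with the same
        \<open>k\<close> for all \<open>e\<close>, so the bound \<open>C\<close> of
        \<open>\<Phi>\<close> under \<open>k\<close> is independent of \<open>e\<close>.\<close>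
      let ?u = "\<lambda>x. max (- e) (min e (f x))" and ?v = "\<lambda>x. f x - max (- e) (min e (f x))"
      have c: "continuous_map X euclideanreal ?u" "continuous_map X euclideanreal ?v"
        by (intro continuous_map_diff continuous_map_real_max continuous_map_real_min Cc_cont[OF f(1)]; simp)+
      have uv: "?u \<in> Cc X" "?v \<in> Cc X" using e f(1) by (auto intro!: Cc_I1[of _ _ f] c)
      have "fsupp X ?v \<subseteq> {x \<in> topspace X. e \<le> \<bar>f x\<bar>}"
        by (rule fsupp_least[OF Cc_closedin_superlevel[OF Cc_abs[OF f(1)]]]) auto
      also have "\<dots> \<subseteq> topspace X - Y" using f(2) e by auto
      also have "\<dots> \<subseteq> \<Union>{U. openin X U \<and> vanishes_on X \<Phi> U}" using s by (auto simp: dual_supp_def)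
      finally have v0: "\<Phi> ?v = 0" using van uv by (auto simp: vanishes_on_def)
      have "\<bar>\<Phi> (\<lambda>x. (1 / e) * ?u x)\<bar> \<le> C"
      proof (rule C)
        show "(\<lambda>x. (1 / e) * ?u x) \<in> Cc X" using uv(1) by (rule Cc_scale)
        show "\<bar>(1 / e) * ?u x\<bar> \<le> k x" for x
        proof (cases "x \<in> fsupp X f")
          case True
          then show ?thesis using e k(3) by (auto simp: abs_le_iff field_simps)
        next
          case False
          then show ?thesis using Cc_off_fsupp[OF f(1) False] e k(2)[of x] by simp
        qed
      qed
      then have "\<bar>(1 / e) * \<Phi> ?u\<bar> \<le> C"
        unfolding order_dual_scale[OF P uv(1)] .
      then have "\<bar>\<Phi> ?u\<bar> \<le> e * C" using e by (simp add: abs_mult field_simps)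
      moreover have "\<Phi> f = \<Phi> (\<lambda>x. ?u x + ?v x)" by simp
      ultimately show ?thesis using v0 order_dual_add[OF P uv] by simp
    qed
    have "\<bar>\<Phi> f\<bar> \<le> 0"
    proof (rule field_le_epsilon)
      fix e :: real assume e: "e > 0"
      \<comment> \<open>Dividing by \<open>C + 1\<close> instead of \<open>C\<close> covers the case
        \<open>C = 0\<close>.\<close>
      have "\<bar>\<Phi> f\<bar> \<le> e / (C + 1) * C" using e C(2) by (intro bound) auto
      also have "\<dots> \<le> e" using e C(2) by (simp add: field_simps)
      finally show "\<bar>\<Phi> f\<bar> \<le> 0 + e" by simp
    qed
    then show "\<Phi> f = 0" by simp
  qed
qed

section \<open>Regular Borel measures and the Riesz representation theorem\<close>

lemma sets_borel_of: "sets (borel_of T) = sigma_sets (topspace T) {U. openin T U}"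
  and space_borel_of [simp]: "space (borel_of T) = topspace T"
proof -
  have "{U. openin T U} \<subseteq> Pow (topspace T)" using openin_subset by auto
  then show "sets (borel_of T) = sigma_sets (topspace T) {U. openin T U}" "space (borel_of T) = topspace T"
    by (simp_all add: borel_of_def sets_measure_of_conv space_measure_of_conv)
qed

lemma openin_borel: "openin T U \<Longrightarrow> U \<in> sets (borel_of T)"
  by (simp add: sets_borel_of sigma_sets.Basic)

lemma closedin_borel:
  assumes "closedin T C" shows "C \<in> sets (borel_of T)"
proof -
  have "topspace T - (topspace T - C) \<in> sets (borel_of T)"
    using assms openin_borel by (metis closedin_def sets.compl_sets space_borel_of)
  then show ?thesis using closedin_subset[OF assms] by (simp add: double_diff)
qed

lemma continuous_map_borel_measurable:
  assumes "continuous_map T euclideanreal f"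
  shows "f \<in> borel_measurable (borel_of T)"
proof (rule borel_measurableI)
  fix S :: "real set" assume "open S"
  then have "openin T {x \<in> topspace T. f x \<in> S}" using openin_continuous_map_preimage[OF assms] by simp
  then show "f -` S \<inter> space (borel_of T) \<in> sets (borel_of T)"
    using openin_borel by (simp add: vimage_def Int_def conj_commute)
qed

lemma Cc_bounded:
  assumes "f \<in> Cc T"
  obtains B where "B > 0" "\<And>x. \<bar>f x\<bar> \<le> B"
proof -
  have "compactin euclideanreal (f ` fsupp T f)"
    using image_compactin Cc_compactin[OF assms] Cc_cont[OF assms] by blast
  then have "bounded (f ` fsupp T f)" by (simp add: compact_imp_bounded)
  then obtain B where B: "B > 0" "\<And>x. x \<in> fsupp T f \<Longrightarrow> \<bar>f x\<bar> \<le> B"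
    by (auto simp: bounded_pos)
  then have "\<bar>f x\<bar> \<le> B" for x using Cc_off_fsupp[OF assms] by (cases "x \<in> fsupp T f") auto
  with B that show thesis by blast
qed

section \<open>Integration against regular Borel measures, and their uniqueness\<close>

locale regular_measure = lch +
  fixes M
  assumes regular: "regular_borel_measure T M"
begin

lemma space_M: "space M = topspace T" and sets_M: "sets M = sets (borel_of T)"
  and compact_finite: "compactin T K \<Longrightarrow> emeasure M K < \<infinity>"
  and outer_regular: "A \<in> sets M \<Longrightarrow> emeasure M A = (INF V\<in>{V. openin T V \<and> A \<subseteq> V}. emeasure M V)"
  and inner_regular: "openin T V \<Longrightarrow> emeasure M V = (SUP K\<in>{K. compactin T K \<and> K \<subseteq> V}. emeasure M K)"
  using regular by (auto simp: regular_borel_measure_def)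

lemma sets_open: "openin T U \<Longrightarrow> U \<in> sets M" and sets_closed: "closedin T U \<Longrightarrow> U \<in> sets M"
  and sets_compact: "compactin T U \<Longrightarrow> U \<in> sets M"
  by (simp_all add: sets_M openin_borel closedin_borel compactin_closedin)

lemma Cc_measurable: "f \<in> Cc T \<Longrightarrow> f \<in> borel_measurable M"
  using continuous_map_borel_measurable[OF Cc_cont] measurable_cong_sets[OF sets_M refl] by blast

lemma bounded_integrable:
  fixes f :: "_ \<Rightarrow> real"
  assumes "f \<in> borel_measurable M" "\<And>x. \<bar>f x\<bar> \<le> B" "compactin T K" "\<And>x. x \<notin> K \<Longrightarrow> f x = 0"
  shows "integrable M f"
  by (rule integrableI_bounded_set[of K _ _ B]) (use assms sets_compact compact_finite in auto)

lemma Cc_integrable: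
  assumes "f \<in> Cc T" shows "integrable M f"
proof -
  obtain B where "\<And>x. \<bar>f x\<bar> \<le> B" using Cc_bounded[OF assms] by metis
  then show ?thesis
    using Cc_measurable[OF assms] Cc_compactin[OF assms] Cc_off_fsupp[OF assms] by (intro bounded_integrable)
qed

lemma Cc_nn_integral:
  assumes "f \<in> Cc T" "\<And>x. 0 \<le> f x"
  shows "(\<integral>\<^sup>+x. ennreal (f x) \<partial>M) = ennreal (\<integral>x. f x \<partial>M)"
  using assms by (intro nn_integral_eq_integral Cc_integrable) auto

lemma integral_ge_measure:
  assumes "f \<in> Cc T" "\<And>x. 0 \<le> f x" "A \<in> sets M" "\<And>x. x \<in> A \<Longrightarrow> 1 \<le> f x"
  shows "emeasure M A \<le> ennreal (\<integral>x. f x \<partial>M)"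
proof -
  have "emeasure M A = (\<integral>\<^sup>+x. indicator A x \<partial>M)" using assms by simp
  also have "\<dots> \<le> (\<integral>\<^sup>+x. ennreal (f x) \<partial>M)"
    using assms by (intro nn_integral_mono) (auto simp: indicator_def ennreal_le_iff2 simp flip: ennreal_1)
  finally show ?thesis using Cc_nn_integral[OF assms(1,2)] by simp
qed

lemma integral_le_measure:
  assumes "f \<in> Cc T" "\<And>x. 0 \<le> f x" "\<And>x. f x \<le> 1" "A \<in> sets M" "\<And>x. x \<notin> A \<Longrightarrow> f x = 0"
  shows "ennreal (\<integral>x. f x \<partial>M) \<le> emeasure M A"
proof -
  have "(\<integral>\<^sup>+x. ennreal (f x) \<partial>M) \<le> (\<integral>\<^sup>+x. indicator A x \<partial>M)"
    using assms by (intro nn_integral_mono) (auto simp: indicator_def)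
  also have "\<dots> = emeasure M A" using assms by simp
  finally show ?thesis using Cc_nn_integral[OF assms(1,2)] by simp
qed

end

text \<open>Urysohn functions between a compact set and its open neighbourhoods, together with outer
  regularity, fix the measure of compact sets. Inner regularity passes this on to open sets, and
  outer regularity from there to all Borel sets.\<close>

lemma (in lch) regular_unique:
  assumes M: "regular_borel_measure T M" and N: "regular_borel_measure T N"
    and eq: "\<And>f. f \<in> Cc T \<Longrightarrow> (\<integral>x. f x \<partial>M) = (\<integral>x. f x \<partial>N)"
  shows "M = N"
proof -
  have le: "emeasure M K \<le> emeasure N K"
    if K: "compactin T K" and M: "regular_borel_measure T M" and N: "regular_borel_measure T N"
      and eq: "\<And>f. f \<in> Cc T \<Longrightarrow> (\<integral>x. f x \<partial>M) = (\<integral>x. f x \<partial>N)" for M N K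
  proof -
    interpret M: regular_measure T M by standard (fact M)
    interpret N: regular_measure T N by standard (fact N)
    have "emeasure M K \<le> emeasure N V" if V: "openin T V" "K \<subseteq> V" for V
    proof -
      obtain h where h: "h \<in> Cc T" "\<And>x. 0 \<le> h x" "\<And>x. h x \<le> 1" "fsupp T h \<subseteq> V" "\<And>x. x \<in> K \<Longrightarrow> h x = 1"
        using urysohn[OF K V] by (metis subsetD)
      have "emeasure M K \<le> ennreal (\<integral>x. h x \<partial>M)"
        using h K by (intro M.integral_ge_measure M.sets_compact) auto
      also have "\<dots> = ennreal (\<integral>x. h x \<partial>N)" using eq h by simp
      also have "\<dots> \<le> emeasure N V"
        using h V by (intro N.integral_le_measure N.sets_open) (auto intro: Cc_off_fsupp)
      finally show ?thesis .
    qed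
    then show ?thesis unfolding N.outer_regular[OF N.sets_compact[OF K]] by (intro INF_greatest) auto
  qed
  interpret M: regular_measure T M by standard (fact M)
  interpret N: regular_measure T N by standard (fact N)
  have K: "emeasure M K = emeasure N K" if "compactin T K" for K
    using le[OF that M N eq] le[OF that N M eq[symmetric]] by (rule antisym)
  have V: "emeasure M V = emeasure N V" if "openin T V" for V
    unfolding M.inner_regular[OF that] N.inner_regular[OF that] using K by (intro SUP_cong) auto
  show ?thesis
  proof (rule measure_eqI)
    show "sets M = sets N" by (simp add: M.sets_M N.sets_M)
    show "emeasure M A = emeasure N A" if "A \<in> sets M" for A
      using that unfolding M.outer_regular[OF that] by (subst N.outer_regular) (auto simp: M.sets_M N.sets_M V intro!: INF_cong)
  qed
qed

section \<open>Construction of the representing measure of a positive functional\<close>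

locale positive_functional = lch +
  fixes p :: "('a \<Rightarrow> real) \<Rightarrow> real"
  assumes p: "p \<in> order_dual T" and p0: "dual_le T 0 p"
begin

lemma p_nonneg: "f \<in> Cc T \<Longrightarrow> (\<And>x. 0 \<le> f x) \<Longrightarrow> 0 \<le> p f"
  using dual_le_0_D[OF p0] .

text \<open>\<open>f \<in> sub V\<close> is the classical relation \<open>f \<prec> V\<close>;
  \<open>content\<close> and \<open>outer\<close> are the usual set functions of the Riesz
  construction, on open sets and on arbitrary sets.\<close>

definition sub :: "'a set \<Rightarrow> ('a \<Rightarrow> real) set" where
  "sub V = {f \<in> Cc T. (\<forall>x. 0 \<le> f x \<and> f x \<le> 1) \<and> fsupp T f \<subseteq> V}"

definition content :: "'a set \<Rightarrow> ennreal" where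
  "content V = (SUP f\<in>sub V. ennreal (p f))"

definition outer :: "'a set \<Rightarrow> ennreal" where
  "outer A = (INF V\<in>{V. openin T V \<and> A \<subseteq> V}. content V)"

lemma sub_zero: "(\<lambda>x. 0) \<in> sub V"
  by (simp add: sub_def fsupp_def)

lemma content_upper: "f \<in> sub V \<Longrightarrow> ennreal (p f) \<le> content V"
  unfolding content_def by (rule SUP_upper)

lemma content_mono: "V \<subseteq> W \<Longrightarrow> content V \<le> content W"
  unfolding content_def by (rule SUP_subset_mono) (auto simp: sub_def)

lemma content_empty: "content {} = 0"
proof -
  have "p f = 0" if "f \<in> sub {}" for f
  proof -
    have "f = (\<lambda>x. 0)" using that Cc_off_fsupp[of f T] by (auto simp: sub_def)
    then show ?thesis using order_dual_zero[OF p] by simp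
  qed
  then show ?thesis using sub_zero by (auto simp: content_def intro!: SUP_eqI)
qed

lemma outer_open: "openin T V \<Longrightarrow> outer V = content V"
  unfolding outer_def by (intro antisym INF_lower INF_greatest) (auto intro: content_mono)

lemma outer_mono: "A \<subseteq> B \<Longrightarrow> outer A \<le> outer B"
  unfolding outer_def by (rule INF_superset_mono) auto

lemma outer_le: "openin T V \<Longrightarrow> A \<subseteq> V \<Longrightarrow> outer A \<le> content V"
  unfolding outer_def by (rule INF_lower) auto

lemma content_Un:
  assumes V: "openin T V" and W: "openin T W"
  shows "content (V \<union> W) \<le> content V + content W"
  unfolding content_def[of "V \<union> W"]
proof (rule SUP_least)
  fix f assume f: "f \<in> sub (V \<union> W)"
  then have "f \<in> Cc T" "fsupp T f \<subseteq> V \<union> W" and f1: "\<And>x. 0 \<le> f x" "\<And>x. f x \<le> 1" by (auto simp: sub_def)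
  from this(1,2) obtain h where "continuous_map T euclideanreal h"
    and h: "\<And>x. 0 \<le> h x" "\<And>x. h x \<le> 1" "(\<lambda>x. f x * h x) \<in> Cc T" "fsupp T (\<lambda>x. f x * h x) \<subseteq> V"
    "(\<lambda>x. f x * (1 - h x)) \<in> Cc T" "fsupp T (\<lambda>x. f x * (1 - h x)) \<subseteq> W"
    by (rule Cc_split[OF _ V W]) blast
  have s: "(\<lambda>x. f x * h x) \<in> sub V" "(\<lambda>x. f x * (1 - h x)) \<in> sub W"
    using h f1 by (auto simp: sub_def intro!: mult_le_one mult_nonneg_nonneg)
  have "p f = p (\<lambda>x. f x * h x + f x * (1 - h x))" by (simp add: algebra_simps)
  also have "\<dots> = p (\<lambda>x. f x * h x) + p (\<lambda>x. f x * (1 - h x))" using h by (intro order_dual_add[OF p])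
  finally have "ennreal (p f) = ennreal (p (\<lambda>x. f x * h x)) + ennreal (p (\<lambda>x. f x * (1 - h x)))"
    using s by (simp add: ennreal_plus p_nonneg sub_def)
  also have "\<dots> \<le> content V + content W" using s by (intro add_mono content_upper)
  finally show "ennreal (p f) \<le> content V + content W" .
qed

lemma content_UN_finite:
  assumes "finite D" "\<And>i. i \<in> D \<Longrightarrow> openin T (V i)"
  shows "content (\<Union>i\<in>D. V i) \<le> (\<Sum>i\<in>D. content (V i))"
  using assms
proof induction
  case (insert i D)
  have "content (\<Union>i\<in>insert i D. V i) \<le> content (V i) + content (\<Union>i\<in>D. V i)"
    unfolding UN_insert using insert by (intro content_Un) auto
  also have "\<dots> \<le> content (V i) + (\<Sum>i\<in>D. content (V i))"
    using insert by (intro add_left_mono) auto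
  finally show ?case using insert by simp
qed (simp add: content_empty)

text \<open>The compact support of a competitor \<open>f\<close> lies in finitely many of the
  \<open>V i\<close>, which reduces the countable case to the finite one.\<close>

lemma content_UN:
  assumes V: "\<And>i::nat. openin T (V i)"
  shows "content (\<Union>i. V i) \<le> (\<Sum>i. content (V i))"
  unfolding content_def[of "\<Union>i. V i"]
proof (rule SUP_least)
  fix f assume f: "f \<in> sub (\<Union>i. V i)"
  have "\<exists>\<F>. finite \<F> \<and> \<F> \<subseteq> range V \<and> fsupp T f \<subseteq> \<Union>\<F>"
    using f V by (intro compactinD[OF Cc_compactin]) (auto simp: sub_def)
  then obtain D where D: "finite D" "fsupp T f \<subseteq> (\<Union>i\<in>D. V i)"
    by (metis finite_subset_image)
  then have "f \<in> sub (\<Union>i\<in>D. V i)" using f by (auto simp: sub_def)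
  then have "ennreal (p f) \<le> content (\<Union>i\<in>D. V i)" by (rule content_upper)
  also have "\<dots> \<le> (\<Sum>i\<in>D. content (V i))" using D V by (intro content_UN_finite)
  also have "\<dots> \<le> (\<Sum>i. content (V i))" by (intro sum_le_suminf D) auto
  finally show "ennreal (p f) \<le> (\<Sum>i. content (V i))" .
qed

lemma outer_countably_subadditive: "countably_subadditive (Pow (topspace T)) outer"
  unfolding countably_subadditive_def
proof (intro allI impI)
  fix A :: "nat \<Rightarrow> 'a set"
  show "outer (\<Union>i. A i) \<le> (\<Sum>i. outer (A i))"
  proof (rule ennreal_le_epsilon)
    fix e :: real assume fin: "(\<Sum>i. outer (A i)) < top" and e: "0 < e"
    \<comment> \<open>The excesses form a geometric series with sum \<open>e\<close>. Finiteness of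
      the series of outer values makes each \<open>outer (A i)\<close> finite, so that an open set
      with so small an excess exists.\<close>
    have "\<exists>V. openin T V \<and> A i \<subseteq> V \<and> content V \<le> outer (A i) + ennreal (e * (1/2) ^ Suc i)" for i
    proof -
      have "outer (A i) \<noteq> \<infinity>"
        using fin ennreal_suminf_lessD[of "\<lambda>i. outer (A i)" top i] by auto
      then show ?thesis
        using INF_approx_ennreal[of "e * (1/2) ^ Suc i", OF _ outer_def[of "A i"]] e by (auto intro: less_imp_le)
    qed
    then obtain V where V: "\<And>i. openin T (V i)" "\<And>i. A i \<subseteq> V i"
      "\<And>i. content (V i) \<le> outer (A i) + ennreal (e * (1/2) ^ Suc i)" by metis
    have "outer (\<Union>i. A i) \<le> content (\<Union>i. V i)" using V by (intro outer_le) auto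
    also have "\<dots> \<le> (\<Sum>i. content (V i))" using V by (intro content_UN)
    also have "\<dots> \<le> (\<Sum>i. outer (A i) + ennreal (e * (1/2) ^ Suc i))"
      using V by (intro suminf_le) auto
    also have "\<dots> = (\<Sum>i. outer (A i)) + (\<Sum>i. ennreal (e * (1/2) ^ Suc i))"
      by (intro suminf_add[symmetric]) auto
    also have "(\<Sum>i. ennreal (e * (1/2) ^ Suc i)) = ennreal e"
      using sums_mult[OF power_half_series, of e] e by (intro suminf_ennreal_eq) auto
    finally show "outer (\<Union>i. A i) \<le> (\<Sum>i. outer (A i)) + ennreal e" .
  qed
qed

lemma outer_measure_space: "outer_measure_space (Pow (topspace T)) outer"
  unfolding outer_measure_space_def positive_def increasing_def
  using outer_countably_subadditive outer_mono outer_open[of "{}"] by (auto simp: content_empty)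

text \<open>Caratheodory's condition is tested against an open \<open>W\<close> containing
  \<open>E\<close>. To \<open>f \<prec> W \<inter> V\<close> one adjoins
  \<open>g \<prec> W - fsupp T f\<close>, where \<open>W - fsupp T f\<close> is an open set
  containing \<open>W - V\<close>. The supports are disjoint, so \<open>f + g \<prec> W\<close>;
  suprema over \<open>g\<close> and then over \<open>f\<close> give the estimate.\<close>

lemma open_lambda_system:
  assumes V: "openin T V"
  shows "V \<in> lambda_system (topspace T) (Pow (topspace T)) outer"
proof -
  interpret sigma_algebra "topspace T" "Pow (topspace T)" by (rule sigma_algebra_Pow)
  have "outer (E \<inter> V) + outer (E - V) = outer E" if E: "E \<subseteq> topspace T" for E
  proof (rule antisym)
    have "subadditive (Pow (topspace T)) outer"
      using outer_measure_space by (intro countably_subadditive_subadditive) (auto simp: outer_measure_space_def)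
    moreover have "E \<inter> V \<in> Pow (topspace T)" "E - V \<in> Pow (topspace T)" "(E \<inter> V) \<inter> (E - V) = {}"
      using E by auto
    ultimately have "outer ((E \<inter> V) \<union> (E - V)) \<le> outer (E \<inter> V) + outer (E - V)"
      unfolding subadditive_def by metis
    then show "outer E \<le> outer (E \<inter> V) + outer (E - V)" by (simp add: Int_Diff_Un)
    show "outer (E \<inter> V) + outer (E - V) \<le> outer E"
      unfolding outer_def[of E]
    proof (rule INF_greatest)
      fix W assume "W \<in> {V. openin T V \<and> E \<subseteq> V}"
      then have W: "openin T W" "E \<subseteq> W" by auto
      have "ennreal (p f) + outer (W - V) \<le> content W" if f: "f \<in> sub (W \<inter> V)" for f
      proof -
        have ff: "f \<in> Cc T" "fsupp T f \<subseteq> W \<inter> V" "\<And>x. 0 \<le> f x" "\<And>x. f x \<le> 1" using f by (auto simp: sub_def)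
        have "outer (W - V) \<le> content (W - fsupp T f)" using W ff by (intro outer_le) auto
        then have "ennreal (p f) + outer (W - V) \<le> ennreal (p f) + (SUP g\<in>sub (W - fsupp T f). ennreal (p g))"
          by (intro add_left_mono) (simp add: content_def)
        also have "\<dots> = (SUP g\<in>sub (W - fsupp T f). ennreal (p f) + ennreal (p g))"
          using sub_zero by (intro ennreal_SUP_add_right) blast
        also have "\<dots> \<le> content W"
        proof (rule SUP_least)
          fix g assume "g \<in> sub (W - fsupp T f)"
          then have g: "g \<in> Cc T" "fsupp T g \<subseteq> W - fsupp T f" "\<And>x. 0 \<le> g x" "\<And>x. g x \<le> 1" by (auto simp: sub_def)
          let ?h = "\<lambda>x. f x + g x"
          have "?h x \<le> 1" for x
          proof (cases "x \<in> fsupp T f")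
            case True
            then have "g x = 0" using g(2) by (intro Cc_off_fsupp[OF g(1)]) auto
            then show ?thesis using ff(4) by simp
          next
            case False
            then have "f x = 0" by (rule Cc_off_fsupp[OF ff(1)])
            then show ?thesis using g(4) by simp
          qed
          moreover have "fsupp T ?h \<subseteq> fsupp T f \<union> fsupp T g"
            by (rule fsupp_least) (auto simp: closedin_Un Cc_off_fsupp[OF ff(1)] Cc_off_fsupp[OF g(1)])
          ultimately have "?h \<in> sub W" using ff g by (auto simp: sub_def Cc_plus)
          then have "ennreal (p ?h) \<le> content W" by (rule content_upper)
          then show "ennreal (p f) + ennreal (p g) \<le> content W"
            using ff g by (simp add: order_dual_add[OF p] ennreal_plus p_nonneg)
        qed
        finally show ?thesis .
      qed
      then have "(SUP f\<in>sub (W \<inter> V). ennreal (p f) + outer (W - V)) \<le> content W" by (intro SUP_least)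
      moreover have "(SUP f\<in>sub (W \<inter> V). ennreal (p f) + outer (W - V)) = content (W \<inter> V) + outer (W - V)"
        unfolding content_def using sub_zero by (intro ennreal_SUP_add_left) blast
      moreover have "outer (E \<inter> V) + outer (E - V) \<le> content (W \<inter> V) + outer (W - V)"
        using V W by (intro add_mono outer_le outer_mono) auto
      ultimately show "outer (E \<inter> V) + outer (E - V) \<le> content W" by simp
    qed
  qed
  then show ?thesis using openin_subset[OF V] by (auto simp: lambda_system_eq)
qed

definition riesz :: "'a measure" where
  "riesz = measure_of (topspace T) (sets (borel_of T)) outer"

lemma sets_riesz [simp]: "sets riesz = sets (borel_of T)"
  and space_riesz [simp]: "space riesz = topspace T"
  using sets.space_closed[of "borel_of T"] sets.sigma_sets_eq[of "borel_of T"]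
  by (simp_all add: riesz_def sets_measure_of_conv space_measure_of_conv)

text \<open>By Caratheodory, \<open>outer\<close> is countably additive on its lambda system, a
  sigma-algebra that contains the open sets and hence all Borel sets.\<close>

lemma emeasure_riesz:
  assumes "A \<in> sets (borel_of T)"
  shows "emeasure riesz A = outer A"
  unfolding riesz_def
proof (rule emeasure_measure_of_sigma)
  let ?L = "lambda_system (topspace T) (Pow (topspace T)) outer"
  interpret P: sigma_algebra "topspace T" "Pow (topspace T)" by (rule sigma_algebra_Pow)
  have ms: "measure_space (topspace T) ?L outer"
    using outer_measure_space by (rule P.caratheodory_lemma)
  then interpret L: sigma_algebra "topspace T" ?L by (simp add: measure_space_def)
  have sub: "sets (borel_of T) \<subseteq> ?L"
    unfolding sets_borel_of using open_lambda_system by (intro L.sigma_sets_subset) auto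
  show "positive (sets (borel_of T)) outer" using ms by (simp add: measure_space_def positive_def)
  show "countably_additive (sets (borel_of T)) outer"
    using ms sub unfolding measure_space_def countably_additive_def by blast
  show "sigma_algebra (topspace T) (sets (borel_of T))"
    using sets.sigma_algebra_axioms[of "borel_of T"] by simp
qed (fact assms)

lemma p_le_outer:
  assumes "f \<in> Cc T" "\<And>x. 0 \<le> f x" "\<And>x. f x \<le> 1" "fsupp T f \<subseteq> K"
  shows "ennreal (p f) \<le> outer K"
  unfolding outer_def using assms by (intro INF_greatest content_upper) (auto simp: sub_def)

text \<open>For \<open>r < 1\<close> the set where \<open>h > r\<close> is an open set containing
  \<open>K\<close>, and any \<open>f \<prec> {h > r}\<close> satisfies \<open>r * f \<le> h\<close>.
  Hence \<open>outer K \<le> p h / r\<close>, and \<open>r\<close> tends to 1.\<close>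

lemma outer_le_p:
  assumes h: "h \<in> Cc T" "\<And>x. 0 \<le> h x" and K: "K \<subseteq> topspace T" "\<And>x. x \<in> K \<Longrightarrow> 1 \<le> h x"
  shows "outer K \<le> ennreal (p h)"
proof (rule ennreal_approx_unit)
  fix a :: ennreal assume a: "0 < a" "a < 1"
  then obtain r where r: "a = ennreal r" "0 < r" "r < 1"
    by (cases a rule: ennreal_cases) (auto simp: ennreal_less_iff simp flip: ennreal_1)
  let ?V = "{x \<in> topspace T. r < h x}"
  have "K \<subseteq> ?V" using K r by force
  then have "outer K \<le> content ?V"
    using openin_continuous_superlevel[OF Cc_cont[OF h(1)]] by (intro outer_le)
  also have "\<dots> \<le> ennreal (p h / r)"
    unfolding content_def
  proof (rule SUP_least)
    fix f assume "f \<in> sub ?V"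
    then have f: "f \<in> Cc T" "\<And>x. f x \<le> 1" "fsupp T f \<subseteq> ?V" by (auto simp: sub_def)
    have "p (\<lambda>x. r * f x) \<le> p h"
    proof (rule positive_mono[OF p p0 Cc_scale[OF f(1)] h(1)])
      show "r * f x \<le> h x" for x
      proof (cases "x \<in> fsupp T f")
        case True
        then have "r < h x" using f(3) by auto
        moreover have "r * f x \<le> r * 1" using f(2) r by (intro mult_left_mono) auto
        ultimately show ?thesis by linarith
      qed (use Cc_off_fsupp[OF f(1)] h(2) in simp)
    qed
    then show "ennreal (p f) \<le> ennreal (p h / r)"
      using r by (intro ennreal_leI) (simp add: order_dual_scale[OF p f(1)] field_simps)
  qed
  finally have "a * outer K \<le> ennreal r * ennreal (p h / r)" unfolding r(1) by (rule mult_left_mono) simp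
  also have "\<dots> = ennreal (p h)" using r h by (simp add: p_nonneg flip: ennreal_mult)
  finally show "a * outer K \<le> ennreal (p h)" .
qed

text \<open>Outer regularity is built into \<open>outer\<close>. For inner regularity on an open
  \<open>V\<close>, a competitor \<open>f \<prec> V\<close> has compact support inside
  \<open>V\<close>, and this support already has measure at least \<open>p f\<close>.\<close>

lemma riesz_regular: "regular_borel_measure T riesz"
  unfolding regular_borel_measure_def
proof (intro conjI allI impI ballI)
  fix K assume K: "compactin T K"
  obtain h where h: "h \<in> Cc T" "\<And>x. 0 \<le> h x" "\<And>x. x \<in> K \<Longrightarrow> h x = 1" using cutoff[OF K] by metis
  have "emeasure riesz K \<le> ennreal (p h)"
    using h K compactin_subset_topspace[OF K]
    by (subst emeasure_riesz) (auto intro!: outer_le_p closedin_borel compactin_closedin)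
  then show "emeasure riesz K < \<infinity>" using le_less_trans by fastforce
next
  fix A assume "A \<in> sets riesz"
  then show "emeasure riesz A = (INF V\<in>{V. openin T V \<and> A \<subseteq> V}. emeasure riesz V)"
    by (simp add: emeasure_riesz outer_def[of A] openin_borel outer_open cong: INF_cong_simp)
next
  fix V assume V: "openin T V"
  show "emeasure riesz V = (SUP K\<in>{K. compactin T K \<and> K \<subseteq> V}. emeasure riesz K)"
  proof (rule antisym)
    have "emeasure riesz V = content V" using V by (simp add: emeasure_riesz openin_borel outer_open)
    also have "\<dots> \<le> (SUP K\<in>{K. compactin T K \<and> K \<subseteq> V}. emeasure riesz K)"
      unfolding content_def
    proof (rule SUP_least)
      fix f assume f: "f \<in> sub V"
      then have "ennreal (p f) \<le> emeasure riesz (fsupp T f)"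
        by (subst emeasure_riesz) (auto intro!: p_le_outer closedin_borel simp: sub_def)
      also have "\<dots> \<le> (SUP K\<in>{K. compactin T K \<and> K \<subseteq> V}. emeasure riesz K)"
        using f by (intro SUP_upper) (auto simp: sub_def Cc_compactin)
      finally show "ennreal (p f) \<le> \<dots>" .
    qed
    finally show "emeasure riesz V \<le> \<dots>" .
    show "(SUP K\<in>{K. compactin T K \<and> K \<subseteq> V}. emeasure riesz K) \<le> emeasure riesz V"
      using V by (intro SUP_least emeasure_mono) (auto simp: openin_borel)
  qed
qed simp_all

sublocale riesz: regular_measure T riesz
  by standard (rule riesz_regular)

lemma p_sum:
  assumes "\<And>i. i < n \<Longrightarrow> g i \<in> Cc T"
  shows "(\<lambda>x. \<Sum>i<n::nat. g i x) \<in> Cc T \<and> p (\<lambda>x. \<Sum>i<n. g i x) = (\<Sum>i<n. p (g i))"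
  using assms
proof (induction n)
  case (Suc n)
  then show ?case using Cc_plus[of "\<lambda>x. \<Sum>i<n. g i x" T "g n"] order_dual_add[OF p, of "\<lambda>x. \<Sum>i<n. g i x" "g n"] by simp
qed (simp add: order_dual_zero[OF p])

text \<open>Cut \<open>f\<close> into \<open>N\<close> slices of height \<open>e = B / N\<close>. With \<open>K i\<close> the set where \<open>f \<ge> i * e\<close>, both
  \<open>p\<close> and the integral map the \<open>i\<close>-th slice between \<open>e * m (i + 1)\<close> and \<open>e * m i\<close>,
  where \<open>m i\<close> is the measure of \<open>K i\<close>; the differences telescope to at most \<open>e * m 0\<close>.\<close>

lemma riesz_representation_nonneg:
  assumes f: "f \<in> Cc T" and f0: "\<And>x. 0 \<le> f x"
  shows "p f = (\<integral>x. f x \<partial>riesz)"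
proof -
  obtain B where B: "B > 0" "\<And>x. \<bar>f x\<bar> \<le> B" using Cc_bounded[OF f] by metis
  define m0 where "m0 = measure riesz (fsupp T f)"
  have bound: "\<bar>p f - (\<integral>x. f x \<partial>riesz)\<bar> \<le> B / N * m0" if N: "N > 0" for N :: nat
  proof -
    define e where "e = B / N"
    have e: "e > 0" and Ne: "N * e = B" using B N by (auto simp: e_def)
    \<comment> \<open>\<open>K 0\<close> is the support, because the set where
      \<open>f \<ge> 0\<close> is the whole space, which may fail to be compact.\<close>
    define K where "K i = (if i = 0 then fsupp T f else {x \<in> topspace T. i * e \<le> f x})" for i :: nat
    define m where "m i = measure riesz (K i)" for i
    define g where "g i x = min (max (f x - i * e) 0) e" for i :: nat and x
    have compK: "compactin T (K i)" for i
      using Cc_compactin[OF f] Cc_compactin_superlevel[OF f] e by (simp add: K_def)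
    have finK: "emeasure riesz (K i) = ennreal (m i)" for i
      unfolding m_def using riesz.compact_finite[OF compK[of i]] by (intro emeasure_eq_ennreal_measure) auto
    have m0: "0 \<le> m i" for i by (simp add: m_def)
    have g_cont: "continuous_map T euclideanreal (g i)" for i
      unfolding g_def by (intro continuous_map_diff continuous_map_real_max continuous_map_real_min Cc_cont[OF f]; simp)
    have g_Cc: "g i \<in> Cc T" for i
      by (rule Cc_I1[of _ _ f]) (use f e g_cont in \<open>auto simp: g_def\<close>)
    have g0: "0 \<le> g i x" "g i x \<le> e" for i x using e by (auto simp: g_def)
    have gK: "g i x = 0" if "x \<notin> K i" for i x
      using that Cc_off_fsupp[OF f, of x] Cc_off[OF f, of x] e by (auto simp: g_def K_def split: if_splits)
    have gsK: "fsupp T (g i) \<subseteq> K i" for i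
      using gK compactin_closedin[OF compK] by (intro fsupp_least) auto
    have gK1: "g i x = e" if "x \<in> K (Suc i)" for i x
      using that by (auto simp: g_def K_def algebra_simps)
    let ?s = "\<lambda>i x. (1 / e) * g i x"
    have s: "?s i \<in> Cc T" "\<And>x. 0 \<le> ?s i x" "\<And>x. ?s i x \<le> 1" "\<And>x. x \<notin> K i \<Longrightarrow> ?s i x = 0"
      "\<And>x. x \<in> K (Suc i) \<Longrightarrow> 1 \<le> ?s i x" "fsupp T (?s i) \<subseteq> K i" for i
    proof -
      show "?s i \<in> Cc T" using g_Cc by (rule Cc_scale)
      show "fsupp T (?s i) \<subseteq> K i" using gK compactin_closedin[OF compK] by (intro fsupp_least) auto
    qed (use e g0 gK gK1 in \<open>auto simp: field_simps\<close>)
    have Kb: "K i \<in> sets (borel_of T)" for i using compactin_closedin[OF compK] by (rule closedin_borel)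
    have KT: "K i \<subseteq> topspace T" for i using compactin_subset_topspace[OF compK] .
    have pg: "e * m (Suc i) \<le> p (g i)" "p (g i) \<le> e * m i" for i
    proof -
      have "ennreal (m (Suc i)) \<le> ennreal (p (?s i))"
        using outer_le_p[OF s(1,2) KT s(5)] by (simp add: emeasure_riesz Kb flip: finK)
      moreover have "ennreal (p (?s i)) \<le> ennreal (m i)"
        using p_le_outer[OF s(1,2,3,6)] by (simp add: emeasure_riesz Kb flip: finK)
      ultimately have "m (Suc i) \<le> p (?s i)" "p (?s i) \<le> m i" using p_nonneg[OF s(1,2)] m0 by (simp_all add: ennreal_le_iff)
      then show "e * m (Suc i) \<le> p (g i)" "p (g i) \<le> e * m i"
        unfolding order_dual_scale[OF p g_Cc] using e by (simp_all add: field_simps)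
    qed
    have ig: "e * m (Suc i) \<le> (\<integral>x. g i x \<partial>riesz)" "(\<integral>x. g i x \<partial>riesz) \<le> e * m i" for i
    proof -
      have "ennreal (m (Suc i)) \<le> ennreal (\<integral>x. ?s i x \<partial>riesz)"
        using riesz.integral_ge_measure[OF s(1,2) _ s(5)] Kb by (simp flip: finK)
      moreover have "ennreal (\<integral>x. ?s i x \<partial>riesz) \<le> ennreal (m i)"
        using riesz.integral_le_measure[OF s(1,2,3) _ s(4)] Kb by (simp flip: finK)
      moreover have "0 \<le> (\<integral>x. ?s i x \<partial>riesz)" by (intro Bochner_Integration.integral_nonneg s)
      ultimately have "m (Suc i) \<le> (\<integral>x. ?s i x \<partial>riesz)" "(\<integral>x. ?s i x \<partial>riesz) \<le> m i"
        using m0 by (simp_all only: ennreal_le_iff)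
      then show "e * m (Suc i) \<le> (\<integral>x. g i x \<partial>riesz)" "(\<integral>x. g i x \<partial>riesz) \<le> e * m i"
        using e by (simp_all add: field_simps)
    qed
    have sum_g: "(\<Sum>i<n. g i x) = min (f x) (n * e)" for n x
    proof (induction n)
      case 0 then show ?case using f0[of x] by simp
    next
      case (Suc n) then show ?case using e by (auto simp: g_def algebra_simps min_def max_def)
    qed
    have "f x = (\<Sum>i<N. g i x)" for x using sum_g[where n = N and x = x] B(2)[of x] Ne by simp
    then have fs: "f = (\<lambda>x. \<Sum>i<N. g i x)" by blast
    have pf: "p f = (\<Sum>i<N. p (g i))" unfolding fs using p_sum g_Cc by blast
    have "integral\<^sup>L riesz f = (\<Sum>i<N. \<integral>x. g i x \<partial>riesz)"
      unfolding fs using riesz.Cc_integrable[OF g_Cc] by (intro Bochner_Integration.integral_sum)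
    then have "p f - integral\<^sup>L riesz f = (\<Sum>i<N. p (g i) - (\<integral>x. g i x \<partial>riesz))"
      unfolding pf by (simp add: sum_subtractf)
    also have "\<bar>\<dots>\<bar> \<le> (\<Sum>i<N. \<bar>p (g i) - (\<integral>x. g i x \<partial>riesz)\<bar>)" by (rule sum_abs)
    also have "\<dots> \<le> (\<Sum>i<N. e * m i - e * m (Suc i))"
    proof (rule sum_mono)
      show "\<bar>p (g i) - (\<integral>x. g i x \<partial>riesz)\<bar> \<le> e * m i - e * m (Suc i)" for i
        using pg[of i] ig[of i] by linarith
    qed
    also have "\<dots> = e * m 0 - e * m N" by (rule sum_lessThan_telescope')
    also have "\<dots> \<le> e * m 0" using e m0 by simp
    finally show ?thesis by (simp add: e_def m_def K_def m0_def)
  qed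
  have "\<bar>p f - (\<integral>x. f x \<partial>riesz)\<bar> \<le> 0"
  proof (rule LIMSEQ_le_const)
    have "(\<lambda>N. B / real N * m0) \<longlonglongrightarrow> 0 * m0"
      by (intro tendsto_mult lim_const_over_n tendsto_const)
    then show "(\<lambda>N. B / real N * m0) \<longlonglongrightarrow> 0" by simp
    show "\<exists>n. \<forall>N\<ge>n. \<bar>p f - (\<integral>x. f x \<partial>riesz)\<bar> \<le> B / real N * m0"
      using bound by (intro exI[of _ 1]) auto
  qed
  then show ?thesis by simp
qed

lemma riesz_representation:
  assumes f: "f \<in> Cc T"
  shows "p f = (\<integral>x. f x \<partial>riesz)"
proof -
  let ?p = "\<lambda>x. max (f x) 0" and ?n = "\<lambda>x. max (- f x) 0"
  have cc: "?p \<in> Cc T" "?n \<in> Cc T" using f by (auto intro!: Cc_intros)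
  have eq: "f = (\<lambda>x. ?p x - ?n x)" by auto
  have "p f = p ?p - p ?n" using order_dual_diff[OF p cc] eq by simp
  also have "\<dots> = (\<integral>x. ?p x - ?n x \<partial>riesz)"
    using cc riesz.Cc_integrable by (simp add: riesz_representation_nonneg)
  finally show ?thesis using eq by simp
qed

end

section \<open>Signed measures\<close>

text \<open>Equalities between differences of positive measures are stated with this sum; each side
  is then again a positive measure, to which uniqueness and integration apply.\<close>

definition plus_measure :: "'a measure \<Rightarrow> 'a measure \<Rightarrow> 'a measure" where
  "plus_measure M N = measure_of (space M) (sets M) (\<lambda>A. emeasure M A + emeasure N A)"

lemma sets_plus_measure [simp]: "sets (plus_measure M N) = sets M"
  and space_plus_measure [simp]: "space (plus_measure M N) = space M"
  by (simp_all add: plus_measure_def)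

lemma emeasure_plus_measure:
  assumes N: "sets N = sets M" and A: "A \<in> sets M"
  shows "emeasure (plus_measure M N) A = emeasure M A + emeasure N A"
  unfolding plus_measure_def
proof (rule emeasure_measure_of_sigma[OF sets.sigma_algebra_axioms _ _ A])
  show "positive (sets M) (\<lambda>A. emeasure M A + emeasure N A)" by (simp add: positive_def)
  show "countably_additive (sets M) (\<lambda>A. emeasure M A + emeasure N A)"
    unfolding countably_additive_def
  proof (intro allI impI)
    fix A :: "nat \<Rightarrow> 'a set" assume A: "range A \<subseteq> sets M" "disjoint_family A"
    have "(\<Sum>i. emeasure M (A i) + emeasure N (A i)) = (\<Sum>i. emeasure M (A i)) + (\<Sum>i. emeasure N (A i))"
      by (intro suminf_add[symmetric]) auto
    then show "(\<Sum>i. emeasure M (A i) + emeasure N (A i)) = emeasure M (\<Union>i. A i) + emeasure N (\<Union>i. A i)"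
      using A by (simp add: suminf_emeasure N)
  qed
qed

lemma nn_integral_plus_measure:
  assumes N: "sets N = sets M" and f: "f \<in> borel_measurable M"
  shows "(\<integral>\<^sup>+x. f x \<partial>plus_measure M N) = (\<integral>\<^sup>+x. f x \<partial>M) + (\<integral>\<^sup>+x. f x \<partial>N)"
proof -
  have sp: "space N = space M" using N by (rule sets_eq_imp_space_eq)
  have mb: "g \<in> borel_measurable N" "g \<in> borel_measurable (plus_measure M N)"
    if "g \<in> borel_measurable M" for g :: "'a \<Rightarrow> ennreal"
    using that measurable_cong_sets[OF N refl] measurable_cong_sets[OF sets_plus_measure refl] by blast+
  from f show ?thesis
  proof (induction rule: borel_measurable_induct)
    case (cong f g)
    from cong(3) have "(\<integral>\<^sup>+x. f x \<partial>plus_measure M N) = (\<integral>\<^sup>+x. g x \<partial>plus_measure M N)"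
      "(\<integral>\<^sup>+x. f x \<partial>M) = (\<integral>\<^sup>+x. g x \<partial>M)" "(\<integral>\<^sup>+x. f x \<partial>N) = (\<integral>\<^sup>+x. g x \<partial>N)"
      using sp by (auto intro!: nn_integral_cong)
    then show ?case using cong(4) by (simp only:)
  next
    case (set A)
    then show ?case by (simp add: emeasure_plus_measure N)
  next
    case (mult u c)
    then show ?case by (simp add: nn_integral_cmult mb distrib_left)
  next
    case (add u v)
    then show ?case by (simp add: nn_integral_add mb ac_simps)
  next
    case (seq U)
    have inc: "incseq (\<lambda>i. \<integral>\<^sup>+x. U i x \<partial>K)" for K
      using seq by (auto simp: incseq_def le_fun_def intro!: nn_integral_mono)
    have "(\<integral>\<^sup>+x. (SUP i. U i x) \<partial>plus_measure M N) = (SUP i. (\<integral>\<^sup>+x. U i x \<partial>M) + (\<integral>\<^sup>+x. U i x \<partial>N))"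
      using seq by (subst nn_integral_monotone_convergence_SUP) (auto intro: mb)
    also have "\<dots> = (SUP i. \<integral>\<^sup>+x. U i x \<partial>M) + (SUP i. \<integral>\<^sup>+x. U i x \<partial>N)"
      by (intro ennreal_SUP_add inc)
    also have "\<dots> = (\<integral>\<^sup>+x. (SUP i. U i x) \<partial>M) + (\<integral>\<^sup>+x. (SUP i. U i x) \<partial>N)"
      using seq by (subst (1 2) nn_integral_monotone_convergence_SUP) (auto intro: mb)
    finally show ?case by (simp add: image_comp)
  qed
qed

lemma integral_plus_measure:
  fixes f :: "'a \<Rightarrow> real"
  assumes N: "sets N = sets M" and f: "integrable M f" "integrable N f"
  shows "(\<integral>x. f x \<partial>plus_measure M N) = (\<integral>x. f x \<partial>M) + (\<integral>x. f x \<partial>N)"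
proof -
  have fm: "f \<in> borel_measurable M" using f by auto
  have fin: "(\<integral>\<^sup>+x. ennreal (norm (f x)) \<partial>M) < \<infinity>" "(\<integral>\<^sup>+x. ennreal (norm (f x)) \<partial>N) < \<infinity>"
    using f by (auto simp: integrable_iff_bounded)
  then have fP: "integrable (plus_measure M N) f"
    using fm by (auto simp: integrable_iff_bounded nn_integral_plus_measure N measurable_cong_sets[OF sets_plus_measure refl])
  have "(\<integral>\<^sup>+x. ennreal (f x) \<partial>K) \<le> (\<integral>\<^sup>+x. ennreal (norm (f x)) \<partial>K)"
    "(\<integral>\<^sup>+x. ennreal (- f x) \<partial>K) \<le> (\<integral>\<^sup>+x. ennreal (norm (f x)) \<partial>K)" for K
    by (auto intro!: nn_integral_mono ennreal_leI)
  then have "(\<integral>\<^sup>+x. ennreal (f x) \<partial>M) < top" "(\<integral>\<^sup>+x. ennreal (- f x) \<partial>M) < top"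
    "(\<integral>\<^sup>+x. ennreal (f x) \<partial>N) < top" "(\<integral>\<^sup>+x. ennreal (- f x) \<partial>N) < top"
    using fin le_less_trans by (metis infinity_ennreal_def)+
  then show ?thesis
    using fm by (simp add: real_lebesgue_integral_def f fP nn_integral_plus_measure N enn2real_plus)
qed

section \<open>Regularity of finite measures by approximation up to epsilon\<close>

context lch
begin

lemma finite_regularI:
  assumes sets: "sets N = sets (borel_of T)" and fin: "emeasure N (space N) < \<infinity>"
    and outer: "\<And>A e. A \<in> sets N \<Longrightarrow> e > 0 \<Longrightarrow> \<exists>V. openin T V \<and> A \<subseteq> V \<and> emeasure N V \<le> emeasure N A + ennreal e"
    and inner: "\<And>V e. openin T V \<Longrightarrow> e > 0 \<Longrightarrow> \<exists>K. compactin T K \<and> K \<subseteq> V \<and> emeasure N V \<le> emeasure N K + ennreal e"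
  shows "regular_borel_measure T N"
  unfolding regular_borel_measure_def
proof (intro conjI allI impI ballI)
  show "space N = topspace T" using sets_eq_imp_space_eq[OF sets] by simp
  show "emeasure N K < \<infinity>" for K using emeasure_space[of N K] fin by (rule le_less_trans)
  show "emeasure N A = (INF V\<in>{V. openin T V \<and> A \<subseteq> V}. emeasure N V)" if "A \<in> sets N" for A
    using outer[OF that] by (intro ennreal_approx_INF) (auto intro!: emeasure_mono simp: sets openin_borel Bex_def)
  show "emeasure N V = (SUP K\<in>{K. compactin T K \<and> K \<subseteq> V}. emeasure N K)" if "openin T V" for V
    using inner[OF that] that by (intro ennreal_approx_SUP) (auto intro!: emeasure_mono simp: sets openin_borel Bex_def)
qed (rule sets)

lemma finite_regularD:
  assumes reg: "regular_borel_measure T N" and fin: "emeasure N (space N) < \<infinity>" and e: "(e::real) > 0"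
  shows "A \<in> sets N \<Longrightarrow> \<exists>V. openin T V \<and> A \<subseteq> V \<and> emeasure N V \<le> emeasure N A + ennreal e"
    and "openin T V \<Longrightarrow> \<exists>K. compactin T K \<and> K \<subseteq> V \<and> emeasure N V \<le> emeasure N K + ennreal e"
proof -
  have fin: "emeasure N A \<noteq> \<infinity>" for A
    using fin emeasure_space[of N A] by (auto simp: top_unique)
  show "\<exists>V. openin T V \<and> A \<subseteq> V \<and> emeasure N V \<le> emeasure N A + ennreal e" if "A \<in> sets N"
  proof -
    have "emeasure N A = (INF V\<in>{V. openin T V \<and> A \<subseteq> V}. emeasure N V)"
      using reg that by (auto simp: regular_borel_measure_def)
    from INF_approx_ennreal[OF e this fin] show ?thesis by (auto intro: less_imp_le)
  qed
  show "\<exists>K. compactin T K \<and> K \<subseteq> V \<and> emeasure N V \<le> emeasure N K + ennreal e" if "openin T V"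
  proof -
    have eq: "emeasure N V = (SUP K\<in>{K. compactin T K \<and> K \<subseteq> V}. emeasure N K)"
      using reg that by (auto simp: regular_borel_measure_def)
    have "{K. compactin T K \<and> K \<subseteq> V} \<noteq> {}" by auto
    from SUP_approx_ennreal[OF e this eq fin] show ?thesis by (auto intro: less_imp_le)
  qed
qed

text \<open>Outer approximations are intersected and inner ones united, each of accuracy
  \<open>e / 2\<close>, so that one set serves both measures.\<close>

lemma regular_plus_measure:
  assumes M: "regular_borel_measure T M" "emeasure M (space M) < \<infinity>"
    and N: "regular_borel_measure T N" "emeasure N (space N) < \<infinity>"
  shows "regular_borel_measure T (plus_measure M N)"
proof -
  have sets: "sets N = sets M" "sets M = sets (borel_of T)" and sp: "space M = topspace T" "space N = topspace T"
    using M N by (auto simp: regular_borel_measure_def)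
  have P: "emeasure (plus_measure M N) A = emeasure M A + emeasure N A" if "A \<in> sets M" for A
    using emeasure_plus_measure[OF sets(1) that] .
  have op: "openin T V \<Longrightarrow> V \<in> sets M" and cp: "compactin T V \<Longrightarrow> V \<in> sets M" for V
    by (simp_all add: sets openin_borel closedin_borel compactin_closedin)
  have half: "(a + ennreal (e/2)) + (b + ennreal (e/2)) = a + b + ennreal e" if "e > 0" for a b and e :: real
  proof -
    have "ennreal e = ennreal (e/2) + ennreal (e/2)" using that by (simp flip: ennreal_plus)
    then show ?thesis by (simp only: ac_simps)
  qed
  show ?thesis
  proof (rule finite_regularI)
    show "sets (plus_measure M N) = sets (borel_of T)" using sets by simp
    show "emeasure (plus_measure M N) (space (plus_measure M N)) < \<infinity>"
      using M N sp P[OF sets.top] by simp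
  next
    fix A and e :: real assume "A \<in> sets (plus_measure M N)" and e: "e > 0"
    then have A: "A \<in> sets M" "A \<in> sets N" using sets by auto
    have e2: "e / 2 > 0" using e by simp
    obtain V W where V: "openin T V" "A \<subseteq> V" "emeasure M V \<le> emeasure M A + ennreal (e/2)"
      and W: "openin T W" "A \<subseteq> W" "emeasure N W \<le> emeasure N A + ennreal (e/2)"
      using finite_regularD(1)[OF M e2 A(1)] finite_regularD(1)[OF N e2 A(2)] by blast
    have "emeasure (plus_measure M N) (V \<inter> W) = emeasure M (V \<inter> W) + emeasure N (V \<inter> W)"
      using V W by (intro P op) auto
    also have "\<dots> \<le> emeasure M V + emeasure N W"
      using V W op sets by (intro add_mono emeasure_mono) auto
    also have "\<dots> \<le> (emeasure M A + ennreal (e/2)) + (emeasure N A + ennreal (e/2))"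
      using V W by (intro add_mono)
    finally show "\<exists>V. openin T V \<and> A \<subseteq> V \<and> emeasure (plus_measure M N) V \<le> emeasure (plus_measure M N) A + ennreal e"
      unfolding half[OF e] using V W P[OF A(1)] by (intro exI[of _ "V \<inter> W"]) auto
  next
    fix V and e :: real assume V: "openin T V" and e: "e > 0"
    have e2: "e / 2 > 0" using e by simp
    obtain K L where K: "compactin T K" "K \<subseteq> V" "emeasure M V \<le> emeasure M K + ennreal (e/2)"
      and L: "compactin T L" "L \<subseteq> V" "emeasure N V \<le> emeasure N L + ennreal (e/2)"
      using finite_regularD(2)[OF M e2 V] finite_regularD(2)[OF N e2 V] by blast
    have KL: "compactin T (K \<union> L)" using K L by (simp add: compactin_Un)
    have "emeasure (plus_measure M N) V = emeasure M V + emeasure N V" using V by (intro P op)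
    also have "\<dots> \<le> (emeasure M K + ennreal (e/2)) + (emeasure N L + ennreal (e/2))"
      using K L by (intro add_mono)
    also have "\<dots> = emeasure M K + emeasure N L + ennreal e" by (rule half[OF e])
    also have "\<dots> \<le> emeasure M (K \<union> L) + emeasure N (K \<union> L) + ennreal e"
      using cp[OF KL] sets by (intro add_mono emeasure_mono) auto
    also have "\<dots> = emeasure (plus_measure M N) (K \<union> L) + ennreal e" using P[OF cp[OF KL]] by simp
    finally show "\<exists>K. compactin T K \<and> K \<subseteq> V \<and> emeasure (plus_measure M N) V \<le> emeasure (plus_measure M N) K + ennreal e"
      using K L KL by (intro exI[of _ "K \<union> L"]) auto
  qed
qed

text \<open>If \<open>A \<subseteq> B\<close> and the \<open>M\<close>-measures differ by at most
  \<open>e\<close>, then \<open>B - A\<close> has \<open>M\<close>-measure at most \<open>e\<close>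
  by finiteness, and domination gives the same bound for \<open>N\<close>. This is how the
  variations of a signed measure inherit regularity.\<close>

lemma regular_dominated:
  assumes M: "regular_borel_measure T M" "emeasure M (space M) < \<infinity>"
    and N: "sets N = sets M" "\<And>A. A \<in> sets M \<Longrightarrow> emeasure N A \<le> emeasure M A"
  shows "regular_borel_measure T N"
proof -
  have sets: "sets M = sets (borel_of T)" using M by (auto simp: regular_borel_measure_def)
  have op: "openin T V \<Longrightarrow> V \<in> sets M" and cp: "compactin T V \<Longrightarrow> V \<in> sets M" for V
    by (simp_all add: sets openin_borel closedin_borel compactin_closedin)
  have sp: "space N = space M" using N(1) by (rule sets_eq_imp_space_eq)
  have fin: "emeasure M A \<noteq> \<infinity>" for A
    using M(2) emeasure_space[of M A] by (auto simp: top_unique)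
  have main: "emeasure N B \<le> emeasure N A + ennreal e"
    if AB: "A \<in> sets M" "B \<in> sets M" "A \<subseteq> B" and le: "emeasure M B \<le> emeasure M A + ennreal e" for A B e
  proof -
    have "emeasure M A + emeasure M (B - A) = emeasure M B" using AB by (subst plus_emeasure) (auto intro: arg_cong)
    then have "emeasure M (B - A) \<le> ennreal e" using le fin[of A] by (metis ennreal_add_left_cancel_le infinity_ennreal_def)
    then have "emeasure N (B - A) \<le> ennreal e" using N(2)[of "B - A"] AB by (auto intro: order_trans)
    moreover have "emeasure N A + emeasure N (B - A) = emeasure N B"
      using AB N(1) by (subst plus_emeasure) (auto intro: arg_cong)
    ultimately show ?thesis by (metis add_left_mono)
  qed
  show ?thesis
  proof (rule finite_regularI)
    show "sets N = sets (borel_of T)" using N sets by simp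
    show "emeasure N (space N) < \<infinity>" using N(2)[of "space M"] M(2) sp by (metis le_less_trans sets.top)
  next
    fix A and e :: real assume "A \<in> sets N" and e: "e > 0"
    then have A: "A \<in> sets M" using N by simp
    then show "\<exists>V. openin T V \<and> A \<subseteq> V \<and> emeasure N V \<le> emeasure N A + ennreal e"
      using finite_regularD(1)[OF M e A] main[OF A] op by blast
  next
    fix V and e :: real assume V: "openin T V" and e: "e > 0"
    show "\<exists>K. compactin T K \<and> K \<subseteq> V \<and> emeasure N V \<le> emeasure N K + ennreal e"
      using finite_regularD(2)[OF M e V] main[OF cp op[OF V]] by blast
  qed
qed

end

section \<open>Variations of a finite signed measure and the Jordan decomposition\<close>

context
  fixes M :: "'a measure" and \<mu> :: "'a set \<Rightarrow> real"
  assumes \<mu>: "finite_signed_measure M \<mu>"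
begin

lemma signed_empty: "\<mu> {} = 0"
  using \<mu> by (simp add: finite_signed_measure_def)

lemma signed_sums:
  "range A \<subseteq> sets M \<Longrightarrow> disjoint_family (A :: nat \<Rightarrow> 'a set) \<Longrightarrow> (\<lambda>n. \<mu> (A n)) sums \<mu> (\<Union>n. A n)"
  using \<mu> by (simp add: finite_signed_measure_def)

lemma signed_Un:
  assumes "A \<in> sets M" "B \<in> sets M" "A \<inter> B = {}"
  shows "\<mu> (A \<union> B) = \<mu> A + \<mu> B"
proof -
  have "disjoint_family (binaryset A B)"
    using assms by (simp add: disjoint_family_on_def binaryset_def Int_commute)
  then have "(\<lambda>n. \<mu> (binaryset A B n)) sums \<mu> (A \<union> B)"
    using signed_sums[of "binaryset A B"] assms by (simp add: range_binaryset_eq UN_binaryset_eq)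
  then show ?thesis using binaryset_sums[where f = \<mu> and A = A and B = B, OF signed_empty] sums_unique2 by blast
qed

lemma signed_Diff:
  assumes "A \<in> sets M" "B \<in> sets M" "B \<subseteq> A"
  shows "\<mu> (A - B) = \<mu> A - \<mu> B"
  using signed_Un[of B "A - B"] assms by (simp add: Un_absorb1)

lemma finite_signed_uminus: "finite_signed_measure M (- \<mu>)"
  using \<mu> by (auto simp: finite_signed_measure_def intro: sums_minus)

lemma sets_pos_variation [simp]: "sets (pos_variation M \<mu>) = sets M"
  and space_pos_variation [simp]: "space (pos_variation M \<mu>) = space M"
  by (simp_all add: pos_variation_def)

text \<open>\<open>measure_of\<close> yields the supremum only if that is countably additive, and
  the null measure otherwise. The supremum is superadditive because subsets of disjoint sets can be
  joined, and countably subadditive because \<open>\<mu> B\<close> is the sum of the values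
  \<open>\<mu> (B \<inter> A i)\<close>.\<close>

lemma emeasure_pos_variation:
  assumes A: "A \<in> sets M"
  shows "emeasure (pos_variation M \<mu>) A = (SUP B\<in>{B \<in> sets M. B \<subseteq> A}. ennreal (\<mu> B))"
  unfolding pos_variation_def
proof (rule emeasure_measure_of_sigma[OF sets.sigma_algebra_axioms _ _ A])
  define v where "v A = (SUP B\<in>{B \<in> sets M. B \<subseteq> A}. ennreal (\<mu> B))" for A
  have up: "ennreal (\<mu> B) \<le> v A" if "B \<in> sets M" "B \<subseteq> A" for A B
    unfolding v_def using that by (intro SUP_upper) auto
  have v_mono: "v A \<le> v B" if "A \<subseteq> B" for A B
    unfolding v_def using that by (intro SUP_subset_mono) auto
  have add: "v A + v B \<le> v (A \<union> B)" if AB: "A \<inter> B = {}" for A B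
  proof -
    have ne: "{C \<in> sets M. C \<subseteq> A} \<noteq> {}" for A by auto
    have *: "ennreal (\<mu> C) + ennreal (\<mu> D) \<le> v (A \<union> B)"
      if C: "C \<in> sets M" "C \<subseteq> A" and D: "D \<in> sets M" "D \<subseteq> B" for C D
    proof -
      have "C \<inter> D = {}" using C D AB by blast
      then have "\<mu> (C \<union> D) = \<mu> C + \<mu> D" using C D by (intro signed_Un)
      moreover have "ennreal (\<mu> (C \<union> D)) \<le> v (A \<union> B)" "ennreal (\<mu> C) \<le> v (A \<union> B)" "ennreal (\<mu> D) \<le> v (A \<union> B)"
        using C D by (intro up; auto)+
      \<comment> \<open>\<open>ennreal\<close> sends negative values to 0, so when one of the two
        values is negative the other alone is compared with the supremum.\<close>
      ultimately show ?thesis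
        by (cases "\<mu> C \<ge> 0"; cases "\<mu> D \<ge> 0") (auto simp: ennreal_neg)
    qed
    have "v A + v B = (SUP C\<in>{C \<in> sets M. C \<subseteq> A}. ennreal (\<mu> C) + v B)"
      unfolding v_def[of A] by (rule ennreal_SUP_add_left[OF ne, symmetric])
    also have "\<dots> \<le> v (A \<union> B)"
    proof (rule SUP_least)
      fix C assume C: "C \<in> {C \<in> sets M. C \<subseteq> A}"
      have "ennreal (\<mu> C) + v B = (SUP D\<in>{D \<in> sets M. D \<subseteq> B}. ennreal (\<mu> C) + ennreal (\<mu> D))"
        unfolding v_def by (rule ennreal_SUP_add_right[OF ne])
      also have "\<dots> \<le> v (A \<union> B)" using C * by (intro SUP_least) auto
      finally show "ennreal (\<mu> C) + v B \<le> v (A \<union> B)" .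
    qed
    finally show ?thesis .
  qed
  have v0: "v {} = 0" by (auto simp: v_def signed_empty intro!: SUP_eqI)
  then show "positive (sets M) (\<lambda>A. SUP B\<in>{B \<in> sets M. B \<subseteq> A}. ennreal (\<mu> B))"
    by (simp add: positive_def v_def)
  have "countably_additive (sets M) v"
    unfolding countably_additive_def
  proof (intro allI impI antisym)
    fix A :: "nat \<Rightarrow> 'a set" assume A: "range A \<subseteq> sets M" "disjoint_family A"
    have fin: "(\<Sum>i<n. v (A i)) \<le> v (\<Union>i<n. A i)" for n
    proof (induction n)
      case (Suc n)
      have "A i \<inter> A n = {}" if "i < n" for i using A(2) that by (auto simp: disjoint_family_on_def)
      then have "(\<Union>i<n. A i) \<inter> A n = {}" by blast
      then have "v (\<Union>i<n. A i) + v (A n) \<le> v ((\<Union>i<n. A i) \<union> A n)" by (rule add)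
      moreover have "(\<Union>i<n. A i) \<union> A n = (\<Union>i<Suc n. A i)" by (auto simp: lessThan_Suc)
      ultimately show ?case using Suc by (auto intro: order_trans add_right_mono)
    qed (simp add: v0)
    show "(\<Sum>i. v (A i)) \<le> v (\<Union>i. A i)"
      unfolding suminf_eq_SUP by (intro SUP_least order_trans[OF fin] v_mono) auto
    show "v (\<Union>i. A i) \<le> (\<Sum>i. v (A i))"
      unfolding v_def[of "\<Union>i. A i"]
    proof (rule SUP_least)
      fix B assume "B \<in> {B \<in> sets M. B \<subseteq> (\<Union>i. A i)}"
      then have B: "B \<in> sets M" "B \<subseteq> (\<Union>i. A i)" by auto
      have "(\<lambda>n. \<mu> (B \<inter> A n)) sums \<mu> (\<Union>n. B \<inter> A n)"
        using A B by (intro signed_sums) (auto simp: disjoint_family_on_def)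
      moreover have "(\<Union>n. B \<inter> A n) = B" using B by auto
      ultimately have "(\<lambda>n. \<Sum>i<n. \<mu> (B \<inter> A i)) \<longlonglongrightarrow> \<mu> B" by (simp add: sums_def)
      then have lim: "(\<lambda>n. ennreal (\<Sum>i<n. \<mu> (B \<inter> A i))) \<longlonglongrightarrow> ennreal (\<mu> B)" by (rule tendsto_ennrealI)
      have "ennreal (\<Sum>i<n. \<mu> (B \<inter> A i)) \<le> (\<Sum>i. v (A i))" for n
      proof -
        \<comment> \<open>Negative summands are replaced by 0 first, since \<open>ennreal\<close>
          commutes with sums of non-negative numbers only.\<close>
        have "ennreal (\<Sum>i<n. \<mu> (B \<inter> A i)) \<le> ennreal (\<Sum>i<n. max 0 (\<mu> (B \<inter> A i)))"
          by (intro ennreal_leI sum_mono) auto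
        also have "\<dots> = (\<Sum>i<n. ennreal (max 0 (\<mu> (B \<inter> A i))))" by (simp add: sum_ennreal)
        also have "\<dots> \<le> (\<Sum>i<n. v (A i))"
        proof (rule sum_mono)
          fix i
          have "ennreal (\<mu> (B \<inter> A i)) \<le> v (A i)" using A B by (intro up) auto
          then show "ennreal (max 0 (\<mu> (B \<inter> A i))) \<le> v (A i)" by (auto simp: max_def)
        qed
        also have "\<dots> \<le> (\<Sum>i. v (A i))" by (intro sum_le_suminf) auto
        finally show ?thesis .
      qed
      then show "ennreal (\<mu> B) \<le> (\<Sum>i. v (A i))" by (intro LIMSEQ_le_const2[OF lim]) auto
    qed
  qed
  then show "countably_additive (sets M) (\<lambda>A. SUP B\<in>{B \<in> sets M. B \<subseteq> A}. ennreal (\<mu> B))"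
    unfolding v_def[abs_def] .
qed

lemma pos_variation_upper:
  "A \<in> sets M \<Longrightarrow> B \<in> sets M \<Longrightarrow> B \<subseteq> A \<Longrightarrow> ennreal (\<mu> B) \<le> emeasure (pos_variation M \<mu>) A"
  by (auto simp: emeasure_pos_variation intro: SUP_upper)

text \<open>If the variation were infinite, one could split off, again and again, a piece on which
  \<open>\<bar>\<mu>\<bar> \<ge> 1\<close> from a set of infinite variation; the values on these disjoint pieces would not be
  summable.\<close>

lemma pos_variation_finite: "emeasure (pos_variation M \<mu>) (space M) < \<infinity>"
proof (rule ccontr)
  let ?v = "emeasure (pos_variation M \<mu>)"
  assume "\<not> ?v (space M) < \<infinity>"
  then have top: "?v (space M) = \<infinity>" by (simp add: less_top[symmetric])
  have "\<exists>B\<in>sets M. B \<subseteq> A \<and> ?v B = \<infinity> \<and> \<bar>\<mu> (A - B)\<bar> \<ge> 1" if A: "A \<in> sets M" "?v A = \<infinity>" for A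
  proof -
    \<comment> \<open>This margin makes \<open>\<bar>\<mu>\<bar>\<close> at least 1 on
      \<open>B\<close> and on \<open>A - B\<close> alike, so whichever of the two has infinite
      variation can be kept and the other split off.\<close>
    have "ennreal (\<bar>\<mu> A\<bar> + 1) < ?v A" using A by simp
    then obtain B where B: "B \<in> sets M" "B \<subseteq> A" "ennreal (\<bar>\<mu> A\<bar> + 1) < ennreal (\<mu> B)"
      unfolding emeasure_pos_variation[OF A(1)] less_SUP_iff by blast
    have "\<bar>\<mu> A\<bar> + 1 < \<mu> B" using B(3) by (subst (asm) ennreal_less_iff) auto
    then have big: "\<bar>\<mu> B\<bar> \<ge> 1" "\<bar>\<mu> (A - B)\<bar> \<ge> 1" using signed_Diff[OF A(1) B(1,2)] by auto
    have "?v B + ?v (A - B) = ?v A" using A B by (subst plus_emeasure) (auto simp: Un_absorb1)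
    then consider "?v B = \<infinity>" | "?v (A - B) = \<infinity>" using A by (auto simp: top_add)
    then show ?thesis
    proof cases
      case 1
      then show ?thesis using A B big by auto
    next
      case 2
      moreover have "A - (A - B) = B" using B by auto
      ultimately show ?thesis using A B big by (intro bexI[of _ "A - B"]) auto
    qed
  qed
  then obtain b where b: "\<And>A. A \<in> sets M \<Longrightarrow> ?v A = \<infinity> \<Longrightarrow> b A \<in> sets M \<and> b A \<subseteq> A \<and> ?v (b A) = \<infinity> \<and> \<bar>\<mu> (A - b A)\<bar> \<ge> 1"
    by metis
  define E where "E n = (b ^^ n) (space M)" for n
  have E: "E n \<in> sets M \<and> ?v (E n) = \<infinity>" for n
    by (induction n) (use b top in \<open>auto simp: E_def\<close>)
  have ES: "E (Suc n) \<subseteq> E n" "\<bar>\<mu> (E n - E (Suc n))\<bar> \<ge> 1" for n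
    using b[of "E n"] E[of n] by (auto simp: E_def)
  \<comment> \<open>Rewritten with the complements, which increase, so that
    \<open>disjoint_family_Suc\<close> applies.\<close>
  have "E n - E (Suc n) = (space M - E (Suc n)) - (space M - E n)" for n
    using E[of n] sets.sets_into_space[of "E n" M] by auto
  moreover have "disjoint_family (\<lambda>n. (space M - E (Suc n)) - (space M - E n))"
    using ES by (intro disjoint_family_Suc) auto
  ultimately have "disjoint_family (\<lambda>n. E n - E (Suc n))" by simp
  then have "summable (\<lambda>n. \<mu> (E n - E (Suc n)))"
    using E by (intro sums_summable[OF signed_sums]) auto
  then have "(\<lambda>n. \<mu> (E n - E (Suc n))) \<longlonglongrightarrow> 0" by (rule summable_LIMSEQ_zero)
  then have "\<forall>\<^sub>F n in sequentially. \<bar>\<mu> (E n - E (Suc n))\<bar> < 1"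
    using tendstoD[of _ 0 sequentially 1] by fastforce
  then obtain n where "\<bar>\<mu> (E n - E (Suc n))\<bar> < 1" by (auto simp: eventually_sequentially)
  then show False using ES(2)[of n] by simp
qed

lemma finite_measure_pos_variation: "finite_measure (pos_variation M \<mu>)"
  using pos_variation_finite by (intro finite_measureI) simp

end

lemma neg_variation_finite:
  assumes "finite_signed_measure M \<mu>"
  shows "finite_measure (neg_variation M \<mu>)" "sets (neg_variation M \<mu>) = sets M" "space (neg_variation M \<mu>) = space M"
  unfolding neg_variation_def
  using finite_signed_uminus[OF assms] finite_measure_pos_variation sets_pos_variation space_pos_variation by blast+

text \<open>A Hahn decomposition is bypassed: for \<open>B \<subseteq> A\<close> the value
  \<open>- \<nu> B\<close> equals \<open>\<nu> (A - B) - \<nu> A\<close>, so the negative variation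
  is at most the positive one minus \<open>\<nu> A\<close>. The same inequality for
  \<open>- \<nu>\<close> is the converse.\<close>

lemma jordan_decomposition:
  assumes \<mu>: "finite_signed_measure M \<mu>" and A: "A \<in> sets M"
  shows "\<mu> A = measure (pos_variation M \<mu>) A - measure (neg_variation M \<mu>) A"
proof -
  have le: "measure (pos_variation M (- \<nu>)) A \<le> measure (pos_variation M \<nu>) A - \<nu> A"
    if \<nu>: "finite_signed_measure M \<nu>" for \<nu>
  proof -
    interpret P: finite_measure "pos_variation M \<nu>" using \<nu> by (rule finite_measure_pos_variation)
    interpret N: finite_measure "pos_variation M (- \<nu>)"
      using finite_signed_uminus[OF \<nu>] by (rule finite_measure_pos_variation)
    have up: "\<nu> B \<le> measure (pos_variation M \<nu>) A" if "B \<in> sets M" "B \<subseteq> A" for B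
      using pos_variation_upper[OF \<nu> A that] by (simp add: P.emeasure_eq_measure)
    have "emeasure (pos_variation M (- \<nu>)) A \<le> ennreal (measure (pos_variation M \<nu>) A - \<nu> A)"
      unfolding emeasure_pos_variation[OF finite_signed_uminus[OF \<nu>] A]
    proof (rule SUP_least)
      fix B assume "B \<in> {B \<in> sets M. B \<subseteq> A}"
      then have B: "B \<in> sets M" "B \<subseteq> A" by auto
      then have "\<nu> (A - B) \<le> measure (pos_variation M \<nu>) A" using A by (intro up) auto
      then have "- \<nu> B \<le> measure (pos_variation M \<nu>) A - \<nu> A" using signed_Diff[OF \<nu> A B] by simp
      then show "ennreal ((- \<nu>) B) \<le> ennreal (measure (pos_variation M \<nu>) A - \<nu> A)" by (simp add: ennreal_leI)
    qed
    then show ?thesis using up[OF A] by (simp add: N.emeasure_eq_measure)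
  qed
  show ?thesis
    using le[OF \<mu>] le[OF finite_signed_uminus[OF \<mu>]] by (simp add: neg_variation_def)
qed

section \<open>Signed measures given as differences of finite measures\<close>

context
  fixes M P Q :: "'a measure" and \<mu> :: "'a set \<Rightarrow> real"
  assumes P: "finite_measure P" "sets P = sets M" and Q: "finite_measure Q" "sets Q = sets M"
    and \<mu>: "\<And>A. A \<in> sets M \<Longrightarrow> \<mu> A = measure P A - measure Q A" "\<And>A. A \<notin> sets M \<Longrightarrow> \<mu> A = 0"
begin

lemma finite_signed_difference: "finite_signed_measure M \<mu>"
  unfolding finite_signed_measure_def
proof (intro conjI allI impI)
  interpret P: finite_measure P by fact
  interpret Q: finite_measure Q by fact
  fix A :: "nat \<Rightarrow> 'a set" assume A: "range A \<subseteq> sets M" "disjoint_family A"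
  have "(\<lambda>n. measure P (A n) - measure Q (A n)) sums (measure P (\<Union>n. A n) - measure Q (\<Union>n. A n))"
    using A P Q by (intro sums_diff P.finite_measure_UNION Q.finite_measure_UNION) auto
  moreover have "\<mu> (A n) = measure P (A n) - measure Q (A n)" for n using A \<mu>(1) by blast
  moreover have "\<mu> (\<Union>n. A n) = measure P (\<Union>n. A n) - measure Q (\<Union>n. A n)" using A by (intro \<mu>(1)) auto
  ultimately show "(\<lambda>n. \<mu> (A n)) sums \<mu> (\<Union>n. A n)" by simp
qed (use \<mu> in auto)

lemma pos_variation_le:
  assumes A: "A \<in> sets M"
  shows "emeasure (pos_variation M \<mu>) A \<le> emeasure P A"
  unfolding emeasure_pos_variation[OF finite_signed_difference A]
proof (rule SUP_least)
  interpret P: finite_measure P by fact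
  fix B assume B: "B \<in> {B \<in> sets M. B \<subseteq> A}"
  have "\<mu> B \<le> measure P B" using B \<mu>(1) by simp
  also have "\<dots> \<le> measure P A" using A B P by (intro P.finite_measure_mono) auto
  finally show "ennreal (\<mu> B) \<le> emeasure P A" by (simp add: P.emeasure_eq_measure ennreal_leI)
qed

text \<open>Any decomposition computes the integral: by the Jordan decomposition the positive
  variation plus \<open>Q\<close> equals \<open>P\<close> plus the negative variation, and
  \<open>h\<close>, being bounded, is integrable for all four.\<close>

lemma signed_integral_difference:
  fixes h :: "'a \<Rightarrow> real"
  assumes h: "h \<in> borel_measurable M" "\<And>x. x \<in> space M \<Longrightarrow> \<bar>h x\<bar> \<le> B"
  shows "signed_integral M \<mu> h = integral\<^sup>L P h - integral\<^sup>L Q h"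
proof -
  let ?p = "pos_variation M \<mu>" and ?n = "neg_variation M \<mu>"
  note fs = finite_signed_difference
  note n = neg_variation_finite[OF fs]
  have int: "integrable N h" if "finite_measure N" "sets N = sets M" for N
  proof -
    have "h \<in> borel_measurable N" "space N = space M"
      using h(1) that(2) measurable_cong_sets[OF that(2) refl] sets_eq_imp_space_eq by blast+
    then show ?thesis using that(1) h(2) by (intro finite_measure.integrable_const_bound[of N _ B]) auto
  qed
  interpret P: finite_measure P by fact
  interpret Q: finite_measure Q by fact
  interpret p: finite_measure ?p using fs by (rule finite_measure_pos_variation)
  interpret n: finite_measure ?n by (rule n)
  have "plus_measure ?p Q = plus_measure P ?n"
  proof (rule measure_eqI)
    fix A assume "A \<in> sets (plus_measure ?p Q)"
    then have A: "A \<in> sets M" by (simp add: sets_pos_variation[OF fs])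
    have "measure ?p A + measure Q A = measure P A + measure ?n A"
      using jordan_decomposition[OF fs A] \<mu>(1)[OF A] by simp
    then show "emeasure (plus_measure ?p Q) A = emeasure (plus_measure P ?n) A"
      using A P Q n sets_pos_variation[OF fs]
      by (simp add: emeasure_plus_measure p.emeasure_eq_measure Q.emeasure_eq_measure P.emeasure_eq_measure
          n.emeasure_eq_measure flip: ennreal_plus)
  qed (simp add: sets_pos_variation[OF fs] P)
  then have "integral\<^sup>L ?p h + integral\<^sup>L Q h = integral\<^sup>L P h + integral\<^sup>L ?n h"
    using int P Q n sets_pos_variation[OF fs] p.finite_measure_axioms integral_plus_measure[of Q ?p h] integral_plus_measure[of ?n P h]
    by simp
  then show ?thesis by (simp add: signed_integral_def)
qed

end

context lch
begin

text \<open>Moving the negative variations to the other side gives two sums of finite regular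
  measures with equal integrals. \<open>regular_unique\<close> identifies the sums, and the Jordan
  decomposition leads back to \<open>\<mu>\<close> and \<open>\<nu>\<close>.\<close>

lemma signed_regular_unique:
  assumes \<mu>: "finite_signed_regular_borel T \<mu>" and \<nu>: "finite_signed_regular_borel T \<nu>"
    and eq: "\<And>h. h \<in> Cc T \<Longrightarrow> signed_integral (borel_of T) \<mu> h = signed_integral (borel_of T) \<nu> h"
  shows "\<mu> = \<nu>"
proof -
  let ?M = "borel_of T"
  let ?p = "pos_variation ?M" and ?n = "neg_variation ?M"
  have fs: "finite_signed_measure ?M \<mu>" "finite_signed_measure ?M \<nu>"
    and reg: "regular_borel_measure T (?p \<mu>)" "regular_borel_measure T (?n \<mu>)"
      "regular_borel_measure T (?p \<nu>)" "regular_borel_measure T (?n \<nu>)"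
    using \<mu> \<nu> by (auto simp: finite_signed_regular_borel_def)
  note n = neg_variation_finite[OF fs(1)] neg_variation_finite[OF fs(2)]
  interpret p1: finite_measure "?p \<mu>" using fs(1) by (rule finite_measure_pos_variation)
  interpret p2: finite_measure "?p \<nu>" using fs(2) by (rule finite_measure_pos_variation)
  interpret n1: finite_measure "?n \<mu>" by (rule n)
  interpret n2: finite_measure "?n \<nu>" by (rule n)
  have int: "integrable N h" if "regular_borel_measure T N" "h \<in> Cc T" for N h
  proof -
    interpret regular_measure T N by standard (fact that)
    show ?thesis using that(2) by (rule Cc_integrable)
  qed
  have sets: "sets (?p \<mu>) = sets ?M" "sets (?p \<nu>) = sets ?M" "sets (?n \<mu>) = sets ?M" "sets (?n \<nu>) = sets ?M"
    using fs n by (auto simp: sets_pos_variation)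
  have fin: "emeasure (?p \<mu>) A < \<infinity>" "emeasure (?p \<nu>) A < \<infinity>" "emeasure (?n \<mu>) A < \<infinity>" "emeasure (?n \<nu>) A < \<infinity>" for A
    by (auto simp: less_top[symmetric])
  have "plus_measure (?p \<mu>) (?n \<nu>) = plus_measure (?p \<nu>) (?n \<mu>)"
  proof (rule regular_unique)
    show "regular_borel_measure T (plus_measure (?p \<mu>) (?n \<nu>))" "regular_borel_measure T (plus_measure (?p \<nu>) (?n \<mu>))"
      by (intro regular_plus_measure reg fin)+
    show "(\<integral>x. f x \<partial>plus_measure (?p \<mu>) (?n \<nu>)) = (\<integral>x. f x \<partial>plus_measure (?p \<nu>) (?n \<mu>))" if f: "f \<in> Cc T" for f
      using eq[OF f] int[OF reg(1) f] int[OF reg(2) f] int[OF reg(3) f] int[OF reg(4) f] sets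
      by (simp add: integral_plus_measure signed_integral_def)
  qed
  then have e: "emeasure (?p \<mu>) A + emeasure (?n \<nu>) A = emeasure (?p \<nu>) A + emeasure (?n \<mu>) A" if "A \<in> sets ?M" for A
    using that sets by (metis emeasure_plus_measure)
  show ?thesis
  proof
    fix A
    show "\<mu> A = \<nu> A"
    proof (cases "A \<in> sets ?M")
      case True
      then have "measure (?p \<mu>) A + measure (?n \<nu>) A = measure (?p \<nu>) A + measure (?n \<mu>) A"
        using e[OF True] by (simp add: p1.emeasure_eq_measure p2.emeasure_eq_measure n1.emeasure_eq_measure
            n2.emeasure_eq_measure flip: ennreal_plus)
      then show ?thesis using jordan_decomposition[OF fs(1) True] jordan_decomposition[OF fs(2) True] by simp
    next
      case False
      then show ?thesis using fs by (simp add: finite_signed_measure_def)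
    qed
  qed
qed

end

section \<open>Products with bounded Borel functions\<close>

lemma sets_borel_of_subtopology:
  assumes S: "S \<in> sets (borel_of T)"
  shows "sets (borel_of (subtopology T S)) = (\<inter>) S ` sets (borel_of T)"
proof -
  have "S \<subseteq> topspace T" using sets.sets_into_space[OF S] by simp
  then have "topspace (subtopology T S) = S" "{U. openin (subtopology T S) U} = (\<inter>) S ` {U. openin T U}"
    by (auto simp: openin_subtopology)
  then show ?thesis
    unfolding sets_borel_of using sigma_sets_Int[of S "topspace T" "{U. openin T U}"] S \<open>S \<subseteq> topspace T\<close>
    by (simp add: sets_borel_of)
qed

lemma sets_borel_of_subtopology_subset:
  assumes "S \<in> sets (borel_of T)" "A \<in> sets (borel_of (subtopology T S))"
  shows "A \<in> sets (borel_of T)"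
  using assms by (auto simp: sets_borel_of_subtopology)

lemma borel_measurable_subtopology:
  assumes S: "S \<in> sets (borel_of T)" and f: "f \<in> borel_measurable (borel_of T)"
  shows "f \<in> borel_measurable (borel_of (subtopology T S))"
proof -
  have "S \<subseteq> topspace T" using sets.sets_into_space[OF S] by simp
  then have "sets (borel_of (subtopology T S)) = sets (restrict_space (borel_of T) S)"
    by (simp add: sets_borel_of_subtopology[OF S] sets_restrict_space)
  then show ?thesis using measurable_restrict_space1[OF f] measurable_cong_sets by blast
qed

lemma borel_measurable_zero_off:
  assumes Y: "Y \<in> sets (borel_of T)" and g: "g \<in> borel_measurable (borel_of (subtopology T Y))"
  shows "zero_off Y g \<in> borel_measurable (borel_of T)"
proof (rule borel_measurableI)
  fix S :: "real set" assume "open S"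
  have YT: "Y \<subseteq> topspace T" using sets.sets_into_space[OF Y] by simp
  have "g -` S \<inter> space (borel_of (subtopology T Y)) \<in> sets (borel_of (subtopology T Y))"
    using g \<open>open S\<close> by (intro measurable_sets[OF g]) auto
  then have "g -` S \<inter> Y \<in> sets (borel_of T)"
    using Y YT sets_borel_of_subtopology_subset by (simp add: Int_absorb1)
  moreover have "(if 0 \<in> S then topspace T - Y else {}) \<in> sets (borel_of T)"
    using Y sets.compl_sets[of Y "borel_of T"] by simp
  moreover have "zero_off Y g -` S \<inter> space (borel_of T) = (g -` S \<inter> Y) \<union> (if 0 \<in> S then topspace T - Y else {})"
    using YT by (auto simp: zero_off_def split: if_splits)
  ultimately show "zero_off Y g -` S \<inter> space (borel_of T) \<in> sets (borel_of T)" by simp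
qed

section \<open>Local measures as restrictions of global ones\<close>

context lch
begin

text \<open>Continuity is checked on two open sets covering the space, \<open>U\<close> and the
  complement of the support, which is open because compact sets are closed. The lemma links the test
  functions on \<open>U\<close>, which decide uniqueness there, with the functions on
  \<open>T\<close> supported in \<open>U\<close> that occur in \<open>local_measure\<close>.\<close>

lemma Cc_open_subspace:
  assumes U: "openin T U" and h: "h \<in> Cc (subtopology T U)"
  shows "h \<in> Cc T" "fsupp T h \<subseteq> U"
proof -
  let ?K = "fsupp (subtopology T U) h"
  have UT: "U \<subseteq> topspace T" using U by (rule openin_subset)
  have K: "compactin T ?K" "?K \<subseteq> U" using Cc_compactin[OF h] by (auto simp: compactin_subtopology)
  have clK: "closedin T ?K" using K compactin_closedin by blast
  have 0: "h x = 0" if "x \<notin> ?K" for x using Cc_off_fsupp[OF h that] .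
  have "continuous_map T euclideanreal h"
  proof (rule pasting_lemma[where I = "{True, False}" and T = "\<lambda>b. if b then U else topspace T - ?K"
        and f = "\<lambda>b. if b then h else (\<lambda>x. 0)"])
    show "openin T (if b then U else topspace T - ?K)" for b using U clK by auto
    show "continuous_map (subtopology T (if b then U else topspace T - ?K)) euclideanreal (if b then h else (\<lambda>x. 0))" for b
      using Cc_cont[OF h] by auto
    show "\<exists>j. j \<in> {True, False} \<and> x \<in> (if j then U else topspace T - ?K) \<and> h x = (if j then h else (\<lambda>x. 0)) x"
      if "x \<in> topspace T" for x
      using that K 0 by (cases "x \<in> U") auto
  qed (use 0 in \<open>auto split: if_splits\<close>)
  then show "h \<in> Cc T" using K clK 0 by (intro Cc_I[of T h ?K])
  show "fsupp T h \<subseteq> U" using fsupp_least[OF clK, of h] 0 K by blast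
qed

text \<open>As \<open>U\<close> is open, outer approximations may be cut down to \<open>U\<close>
  and stay open; compactness of a subset of \<open>U\<close> is the same in \<open>U\<close> and in
  \<open>T\<close>.\<close>

lemma regular_restrict_space:
  assumes M: "regular_borel_measure T M" and U: "openin T U"
  shows "regular_borel_measure (subtopology T U) (restrict_space M U)"
proof -
  interpret regular_measure T M by standard (fact M)
  have UT: "U \<subseteq> topspace T" using U by (rule openin_subset)
  have Us: "U \<inter> space M \<in> sets M" using U UT by (simp add: space_M Int_absorb2 sets_open)
  have Ub: "U \<in> sets (borel_of T)" using U by (rule openin_borel)
  have em: "emeasure (restrict_space M U) A = emeasure M A" if "A \<subseteq> U" for A
    using Us that by (rule emeasure_restrict_space)
  have sets: "sets (restrict_space M U) = sets (borel_of (subtopology T U))"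
    by (simp add: sets_restrict_space sets_M sets_borel_of_subtopology[OF Ub])
  have op: "openin (subtopology T U) V \<longleftrightarrow> openin T V \<and> V \<subseteq> U" for V
    using openin_open_subtopology[OF U] .
  show ?thesis
    unfolding regular_borel_measure_def
  proof (intro conjI allI impI ballI)
    show "space (restrict_space M U) = topspace (subtopology T U)"
      using UT by (auto simp: space_restrict_space space_M)
  next
    fix K assume "compactin (subtopology T U) K"
    then show "emeasure (restrict_space M U) K < \<infinity>" using compact_finite em by (auto simp: compactin_subtopology)
  next
    fix A assume "A \<in> sets (restrict_space M U)"
    then have "A \<in> sets (borel_of (subtopology T U))" unfolding sets .
    then have A: "A \<in> sets M" "A \<subseteq> U"
      using sets_borel_of_subtopology_subset[OF Ub] sets.sets_into_space[of A "borel_of (subtopology T U)"]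
      unfolding sets_M by auto
    have "emeasure M A = (INF V\<in>{V. openin (subtopology T U) V \<and> A \<subseteq> V}. emeasure M V)"
    proof (rule antisym)
      show "emeasure M A \<le> (INF V\<in>{V. openin (subtopology T U) V \<and> A \<subseteq> V}. emeasure M V)"
        by (intro INF_greatest emeasure_mono) (auto simp: op sets_open)
      show "(INF V\<in>{V. openin (subtopology T U) V \<and> A \<subseteq> V}. emeasure M V) \<le> emeasure M A"
        unfolding outer_regular[OF A(1)]
      proof (rule INF_greatest)
        fix V assume "V \<in> {V. openin T V \<and> A \<subseteq> V}"
        then have V: "openin T V" "A \<subseteq> V" by auto
        then have "(INF V\<in>{V. openin (subtopology T U) V \<and> A \<subseteq> V}. emeasure M V) \<le> emeasure M (V \<inter> U)"
          using U A by (intro INF_lower) (auto simp: op)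
        also have "\<dots> \<le> emeasure M V" using V by (intro emeasure_mono sets_open) auto
        finally show "(INF V\<in>{V. openin (subtopology T U) V \<and> A \<subseteq> V}. emeasure M V) \<le> emeasure M V" .
      qed
    qed
    also have "\<dots> = (INF V\<in>{V. openin (subtopology T U) V \<and> A \<subseteq> V}. emeasure (restrict_space M U) V)"
      by (intro INF_cong) (auto simp: op em)
    finally show "emeasure (restrict_space M U) A = \<dots>" using em[OF A(2)] by simp
  next
    fix V assume "openin (subtopology T U) V"
    then have V: "openin T V" "V \<subseteq> U" by (auto simp: op)
    have "emeasure M V = (SUP K\<in>{K. compactin (subtopology T U) K \<and> K \<subseteq> V}. emeasure (restrict_space M U) K)"
      unfolding inner_regular[OF V(1)] using V by (intro SUP_cong) (auto simp: compactin_subtopology em)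
    then show "emeasure (restrict_space M U) V = \<dots>" using em[OF V(2)] by simp
  qed (rule sets)
qed

abbreviation riesz :: "(('a \<Rightarrow> real) \<Rightarrow> real) \<Rightarrow> 'a measure" where
  "riesz \<equiv> positive_functional.riesz T"

context
  fixes p q U
  assumes p: "positive_functional T p" and q: "positive_functional T q"
    and U: "openin T U" "compactin T (T closure_of U)"
begin

interpretation p: positive_functional T p by (rule p)
interpretation q: positive_functional T q by (rule q)

lemma finite_riesz_restrict:
  assumes M: "regular_borel_measure T M"
  shows "finite_measure (restrict_space M U)" "sets (restrict_space M U) = sets (borel_of (subtopology T U))"
    "regular_borel_measure (subtopology T U) (restrict_space M U)"
    "emeasure (restrict_space M U) (space (restrict_space M U)) < \<infinity>"
proof -
  interpret regular_measure T M by standard (fact M)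
  show reg: "regular_borel_measure (subtopology T U) (restrict_space M U)"
    using M U(1) by (rule regular_restrict_space)
  then show "sets (restrict_space M U) = sets (borel_of (subtopology T U))" by (simp add: regular_borel_measure_def)
  have UT: "U \<subseteq> topspace T" using U(1) by (rule openin_subset)
  have "emeasure (restrict_space M U) (space (restrict_space M U)) = emeasure M U"
    using UT U(1) by (simp add: space_restrict_space space_M Int_absorb2 emeasure_restrict_space sets_open)
  also have "\<dots> \<le> emeasure M (T closure_of U)"
    using UT by (intro emeasure_mono closure_of_subset sets_closed) auto
  also have "\<dots> < \<infinity>" using compact_finite U(2) by blast
  finally show fin: "emeasure (restrict_space M U) (space (restrict_space M U)) < \<infinity>" .
  then show "finite_measure (restrict_space M U)" by (intro finite_measureI) simp
qed

text \<open>The Riesz measures may both be infinite, so the difference is formed on the relatively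
  compact \<open>U\<close>, where both are finite. The value 0 off the sigma-algebra follows the
  convention of \<open>finite_signed_measure\<close> and is needed for uniqueness as a set
  function.\<close>

definition riesz_diff :: "'a set \<Rightarrow> real" where
  "riesz_diff A = (if A \<in> sets (borel_of (subtopology T U))
     then measure (restrict_space (riesz p) U) A - measure (restrict_space (riesz q) U) A else 0)"

lemma riesz_diff_integral:
  fixes h :: "'a \<Rightarrow> real"
  assumes h: "h \<in> borel_measurable (borel_of T)" "\<And>x. x \<in> topspace T \<Longrightarrow> \<bar>h x\<bar> \<le> B" "\<And>x. x \<notin> U \<Longrightarrow> h x = 0"
  shows "signed_integral (borel_of (subtopology T U)) riesz_diff h = integral\<^sup>L (riesz p) h - integral\<^sup>L (riesz q) h"
proof -
  have UT: "U \<subseteq> topspace T" using U(1) by (rule openin_subset)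
  have r: "integral\<^sup>L (restrict_space M U) h = integral\<^sup>L M h" if "space M = topspace T" "sets M = sets (borel_of T)" for M
  proof -
    have "U \<inter> space M \<in> sets M" using that UT openin_borel[OF U(1)] by (simp add: Int_absorb2)
    then have "integral\<^sup>L (restrict_space M U) h = (\<integral>x. indicator U x *\<^sub>R h x \<partial>M)" by (rule integral_restrict_space)
    also have "(\<lambda>x. indicator U x *\<^sub>R h x) = h" using h(3) by (auto simp: indicator_def fun_eq_iff)
    finally show ?thesis .
  qed
  have "signed_integral (borel_of (subtopology T U)) riesz_diff h =
    integral\<^sup>L (restrict_space (riesz p) U) h - integral\<^sup>L (restrict_space (riesz q) U) h"
  proof (rule signed_integral_difference)
    show "h \<in> borel_measurable (borel_of (subtopology T U))"
      using openin_borel[OF U(1)] h(1) by (rule borel_measurable_subtopology)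
    show "\<bar>h x\<bar> \<le> B" if "x \<in> space (borel_of (subtopology T U))" for x using h(2) that by simp
  qed (simp_all add: finite_riesz_restrict p.riesz_regular q.riesz_regular riesz_diff_def)
  then show ?thesis by (simp add: r)
qed

text \<open>The variations are dominated by the two restricted Riesz measures, and domination by a
  finite regular measure preserves regularity. The negative variation is the positive one of the
  difference with \<open>p\<close> and \<open>q\<close> exchanged.\<close>

lemma riesz_diff_regular: "finite_signed_regular_borel (subtopology T U) riesz_diff"
proof -
  interpret U: lch "subtopology T U"
    by standard (use U hausdorff loc_compact in \<open>auto intro: Hausdorff_space_subtopology locally_compact_space_open_subset\<close>)
  note P = finite_riesz_restrict[OF p.riesz_regular] and Q = finite_riesz_restrict[OF q.riesz_regular]
  have fs: "finite_signed_measure (borel_of (subtopology T U)) riesz_diff"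
    by (rule finite_signed_difference[OF P(1,2) Q(1,2)]) (simp_all add: riesz_diff_def)
  have "regular_borel_measure (subtopology T U) (pos_variation (borel_of (subtopology T U)) riesz_diff)"
  proof (rule U.regular_dominated[OF P(3,4)])
    show "emeasure (pos_variation (borel_of (subtopology T U)) riesz_diff) A \<le> emeasure (restrict_space (riesz p) U) A"
      if "A \<in> sets (restrict_space (riesz p) U)" for A
      by (rule pos_variation_le[OF P(1,2) Q(1,2)]) (use that P in \<open>simp_all add: riesz_diff_def\<close>)
  qed (simp add: sets_pos_variation[OF fs] P)
  moreover have "regular_borel_measure (subtopology T U) (neg_variation (borel_of (subtopology T U)) riesz_diff)"
    unfolding neg_variation_def
  proof (rule U.regular_dominated[OF Q(3,4)])
    show "emeasure (pos_variation (borel_of (subtopology T U)) (- riesz_diff)) A \<le> emeasure (restrict_space (riesz q) U) A"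
      if "A \<in> sets (restrict_space (riesz q) U)" for A
      by (rule pos_variation_le[OF Q(1,2) P(1,2)]) (use that Q in \<open>simp_all add: riesz_diff_def\<close>)
  qed (simp add: sets_pos_variation[OF finite_signed_uminus[OF fs]] Q)
  ultimately show ?thesis using fs by (simp add: finite_signed_regular_borel_def)
qed

lemma riesz_diff_Cc_integral:
  assumes h: "h \<in> Cc T" "fsupp T h \<subseteq> U"
  shows "signed_integral (borel_of (subtopology T U)) riesz_diff h = (p - q) h"
proof -
  obtain B where B: "\<And>x. \<bar>h x\<bar> \<le> B" using Cc_bounded[OF h(1)] by metis
  have "h x = 0" if "x \<notin> U" for x using Cc_off_fsupp[OF h(1)] h(2) that by blast
  then show ?thesis
    using riesz_diff_integral[OF continuous_map_borel_measurable[OF Cc_cont[OF h(1)]] B]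
    by (simp add: p.riesz_representation[OF h(1)] q.riesz_representation[OF h(1)])
qed

lemma local_measure_eq: "local_measure T (p - q) U = riesz_diff"
  unfolding local_measure_def
proof (rule the_equality)
  show "finite_signed_regular_borel (subtopology T U) riesz_diff \<and>
    (\<forall>h\<in>Cc T. fsupp T h \<subseteq> U \<longrightarrow> (p - q) h = signed_integral (borel_of (subtopology T U)) riesz_diff h)"
    using riesz_diff_regular riesz_diff_Cc_integral by simp
next
  interpret U: lch "subtopology T U"
    by standard (use U hausdorff loc_compact in \<open>auto intro: Hausdorff_space_subtopology locally_compact_space_open_subset\<close>)
  fix \<nu> assume \<nu>: "finite_signed_regular_borel (subtopology T U) \<nu> \<and>
    (\<forall>h\<in>Cc T. fsupp T h \<subseteq> U \<longrightarrow> (p - q) h = signed_integral (borel_of (subtopology T U)) \<nu> h)"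
  show "\<nu> = riesz_diff"
  proof (rule U.signed_regular_unique)
    fix h assume "h \<in> Cc (subtopology T U)"
    then have "h \<in> Cc T" "fsupp T h \<subseteq> U" using Cc_open_subspace[OF U(1)] by blast+
    then show "signed_integral (borel_of (subtopology T U)) \<nu> h = signed_integral (borel_of (subtopology T U)) riesz_diff h"
      using \<nu> riesz_diff_Cc_integral by simp
  qed (use \<nu> riesz_diff_regular in auto)
qed

end

lemma rel_compact_open_nhd_exists:
  assumes ne: "topspace T \<noteq> {}" and K: "compactin T K"
  shows "\<exists>U. rel_compact_open_nhd T K U"
proof -
  obtain x where x: "x \<in> topspace T" using ne by blast
  \<comment> \<open>A point is added so that the neighbourhood is non-empty even when
    \<open>K\<close> is empty.\<close>
  have "compactin T (insert x K)" using compactin_Un[of T "{x}" K] x K by simp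
  then obtain W L where W: "openin T W" "compactin T L" "insert x K \<subseteq> W" "W \<subseteq> L"
    using compact_nbhd[OF _ openin_topspace] compactin_subset_topspace by metis
  have "T closure_of W \<subseteq> L" using W compactin_closedin by (intro closure_of_minimal)
  then have "compactin T (T closure_of W)" using closed_compactin[OF W(2)] by simp
  then show ?thesis using W by (auto simp: rel_compact_open_nhd_def)
qed

text \<open>The neighbourhood chosen by \<open>SOME\<close> disappears because the integrand
  vanishes off it, so that integrals over it equal integrals over the whole space.\<close>

lemma borel_mult_eq:
  assumes ne: "topspace T \<noteq> {}" and p: "positive_functional T p" and q: "positive_functional T q"
    and g: "bounded_borel T g" and f: "f \<in> Cc T"
  shows "borel_mult T g (p - q) f = (\<integral>x. f x * g x \<partial>riesz p) - (\<integral>x. f x * g x \<partial>riesz q)"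
proof -
  define U where "U = (SOME U. rel_compact_open_nhd T (fsupp T f) U)"
  have "rel_compact_open_nhd T (fsupp T f) U"
    unfolding U_def using rel_compact_open_nhd_exists[OF ne Cc_compactin[OF f]] by (rule someI_ex)
  then have U: "openin T U" "compactin T (T closure_of U)" "fsupp T f \<subseteq> U" by (auto simp: rel_compact_open_nhd_def)
  obtain B where B: "B > 0" "\<And>x. \<bar>f x\<bar> \<le> B" using Cc_bounded[OF f] by metis
  obtain C where C: "\<And>x. x \<in> topspace T \<Longrightarrow> \<bar>g x\<bar> \<le> C"
    using g by (auto simp: bounded_borel_def bounded_iff)
  have "borel_mult T g (p - q) f = signed_integral (borel_of (subtopology T U)) (local_measure T (p - q) U) (\<lambda>x. f x * g x)"
    using f by (simp add: borel_mult_def U_def Let_def)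
  also have "\<dots> = (\<integral>x. f x * g x \<partial>riesz p) - (\<integral>x. f x * g x \<partial>riesz q)"
    unfolding local_measure_eq[OF p q U(1,2)]
  proof (rule riesz_diff_integral[OF p q U(1,2)])
    show "(\<lambda>x. f x * g x) \<in> borel_measurable (borel_of T)"
      using g continuous_map_borel_measurable[OF Cc_cont[OF f]] by (auto simp: bounded_borel_def)
    show "\<bar>f x * g x\<bar> \<le> B * C" if "x \<in> topspace T" for x
      unfolding abs_mult using B C[OF that] by (intro mult_mono) auto
    show "f x * g x = 0" if "x \<notin> U" for x using Cc_off_fsupp[OF f] U(3) that by auto
  qed
  finally show ?thesis .
qed

end

section \<open>Measures and products under the adjoint\<close>

context lch_closed
begin

lemma R_positive:
  assumes "positive_functional XY p"
  shows "positive_functional X (R p)"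
proof -
  interpret p: positive_functional XY p by fact
  show ?thesis
    by standard (use p.p p.p0 R_le_iff[of 0 p] R_in in \<open>simp_all add: R_zero\<close>)
qed

lemma riesz_R:
  assumes p: "positive_functional XY p"
  shows "riesz (R p) = distr (Y.riesz p) (borel_of X) (\<lambda>x. x)"
proof -
  interpret p: positive_functional XY p by fact
  interpret Rp: positive_functional X "R p" using p by (rule R_positive)
  let ?M = "Y.riesz p" and ?N = "distr (Y.riesz p) (borel_of X) (\<lambda>x. x)"
  have Yb: "Y \<in> sets (borel_of X)" using closedY by (rule closedin_borel)
  have id: "(\<lambda>x. x) \<in> measurable ?M (borel_of X)"
    using Y_subset by (intro measurableI) (auto simp: sets_borel_of_subtopology[OF Yb] Int_commute)
  have em: "emeasure ?N A = emeasure ?M (A \<inter> Y)" if "A \<in> sets (borel_of X)" for A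
    using emeasure_distr[OF id that] by simp
  have op: "openin X V \<Longrightarrow> openin XY (V \<inter> Y)" for V by (auto simp: openin_subtopology)
  have "regular_borel_measure X ?N"
    unfolding regular_borel_measure_def
  proof (intro conjI allI impI ballI)
    fix K assume K: "compactin X K"
    then have "compactin X (K \<inter> Y)"
      using closed_compactin[OF K] compactin_closedin[OF K] closedY by (simp add: closedin_Int)
    then have "compactin XY (K \<inter> Y)" by (simp add: compactin_subtopology)
    then show "emeasure ?N K < \<infinity>" using p.riesz.compact_finite K by (simp add: em closedin_borel compactin_closedin)
  next
    fix A assume "A \<in> sets ?N"
    then have A: "A \<in> sets (borel_of X)" by simp
    have AY: "A \<inter> Y \<in> sets ?M" using A by (auto simp: sets_borel_of_subtopology[OF Yb])
    show "emeasure ?N A = (INF V\<in>{V. openin X V \<and> A \<subseteq> V}. emeasure ?N V)"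
    proof (rule antisym)
      show "emeasure ?N A \<le> (INF V\<in>{V. openin X V \<and> A \<subseteq> V}. emeasure ?N V)"
        by (intro INF_greatest emeasure_mono) (auto simp: openin_borel)
      show "(INF V\<in>{V. openin X V \<and> A \<subseteq> V}. emeasure ?N V) \<le> emeasure ?N A"
        unfolding em[OF A] p.riesz.outer_regular[OF AY]
      proof (rule INF_greatest)
        fix V assume "V \<in> {V. openin XY V \<and> A \<inter> Y \<subseteq> V}"
        then obtain W where W: "openin X W" "V = W \<inter> Y" "A \<inter> Y \<subseteq> W" by (auto simp: openin_subtopology)
        \<comment> \<open>The image measure gives the complement of \<open>Y\<close> measure 0, so
          this open set is added to cover the part of \<open>A\<close> outside \<open>Y\<close> at
          no cost.\<close>
        let ?W = "W \<union> (topspace X - Y)"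
        have oW: "openin X ?W" using W closedY by (intro openin_Un) auto
        have "A \<subseteq> ?W" using W sets.sets_into_space[OF A] by auto
        then have "(INF V\<in>{V. openin X V \<and> A \<subseteq> V}. emeasure ?N V) \<le> emeasure ?N ?W"
          using oW by (intro INF_lower) auto
        also have "\<dots> = emeasure ?M V"
          using oW W(2) by (simp add: em openin_borel Int_Un_distrib2 Diff_Int_distrib2)
        finally show "(INF V\<in>{V. openin X V \<and> A \<subseteq> V}. emeasure ?N V) \<le> emeasure ?M V" .
      qed
    qed
  next
    fix V assume V: "openin X V"
    show "emeasure ?N V = (SUP K\<in>{K. compactin X K \<and> K \<subseteq> V}. emeasure ?N K)"
    proof (rule antisym)
      show "(SUP K\<in>{K. compactin X K \<and> K \<subseteq> V}. emeasure ?N K) \<le> emeasure ?N V"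
        using V by (intro SUP_least emeasure_mono) (auto simp: openin_borel)
      show "emeasure ?N V \<le> (SUP K\<in>{K. compactin X K \<and> K \<subseteq> V}. emeasure ?N K)"
        unfolding em[OF openin_borel[OF V]] p.riesz.inner_regular[OF op[OF V]]
      proof (rule SUP_least)
        fix K assume "K \<in> {K. compactin XY K \<and> K \<subseteq> V \<inter> Y}"
        then have K: "compactin X K" "K \<subseteq> V" "K \<inter> Y = K" by (auto simp: compactin_subtopology)
        have "emeasure ?M K = emeasure ?N K"
          using em[OF closedin_borel[OF compactin_closedin[OF K(1)]]] K(3) by simp
        also have "\<dots> \<le> (SUP K\<in>{K. compactin X K \<and> K \<subseteq> V}. emeasure ?N K)"
          using K by (intro SUP_upper) auto
        finally show "emeasure ?M K \<le> \<dots>" .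
      qed
    qed
  qed simp_all
  moreover have "(\<integral>x. f x \<partial>riesz (R p)) = (\<integral>x. f x \<partial>?N)" if f: "f \<in> Cc X" for f
  proof -
    have "(\<integral>x. f x \<partial>?N) = (\<integral>x. f x \<partial>?M)"
      using integral_distr[OF id continuous_map_borel_measurable[OF Cc_cont[OF f]]] by simp
    also have "\<dots> = (\<integral>x. zero_off Y f x \<partial>?M)"
      by (intro Bochner_Integration.integral_cong) (auto simp: zero_off_def)
    also have "\<dots> = R p f" using p.riesz_representation[OF zero_off_in[OF f]] f by (simp add: R_apply)
    finally show ?thesis using Rp.riesz_representation[OF f] by simp
  qed
  ultimately show ?thesis using Rp.riesz_regular by (intro regular_unique)
qed

lemma bounded_borel_zero_off:
  assumes "bounded_borel XY g"
  shows "bounded_borel X (zero_off Y g)"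
proof -
  have "zero_off Y g ` topspace X \<subseteq> insert 0 (g ` Y)" by (auto simp: zero_off_def)
  moreover have "bounded (insert 0 (g ` Y))" using assms by (simp add: bounded_borel_def)
  ultimately have "bounded (zero_off Y g ` topspace X)" by (rule bounded_subset[rotated])
  then show ?thesis
    using assms borel_measurable_zero_off[OF closedin_borel[OF closedY]] by (simp add: bounded_borel_def)
qed

lemma R_borel_mult:
  assumes ne: "Y \<noteq> {}" and g: "bounded_borel XY g" and \<phi>: "\<phi> \<in> order_dual XY"
  shows "R (borel_mult XY g \<phi>) = borel_mult X (zero_off Y g) (R \<phi>)"
proof
  fix f
  \<comment> \<open>\<open>R\<close> is linear and positive, so a decomposition of
    \<open>\<phi>\<close> into positive functionals is carried to one of \<open>R \<phi>\<close>,
    and both products can be computed from the same \<open>p\<close> and \<open>q\<close>.\<close>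
  define p where "p = dual_pos XY \<phi>"
  define q where "q = dual_pos XY \<phi> - \<phi>"
  have p: "positive_functional XY p"
    by standard (use dual_pos_in[OF \<phi>] dual_pos_upper[OF \<phi>] in \<open>simp_all add: p_def\<close>)
  have q: "positive_functional XY q"
    by standard (use dual_pos_in[OF \<phi>] dual_pos_upper[OF \<phi>] order_dual_diff_closed[OF _ \<phi>] in \<open>auto simp: q_def dual_le_def\<close>)
  have \<phi>_eq: "\<phi> = p - q" by (simp add: p_def q_def)
  let ?g = "zero_off Y g"
  have g': "bounded_borel X ?g" using g by (rule bounded_borel_zero_off)
  show "R (borel_mult XY g \<phi>) f = borel_mult X ?g (R \<phi>) f"
  proof (cases "f \<in> Cc X")
    case f: True
    have eq: "(\<integral>x. zero_off Y f x * g x \<partial>Y.riesz p) = (\<integral>x. f x * ?g x \<partial>riesz (R p))"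
      if p: "positive_functional XY p" for p
    proof -
      interpret p: positive_functional XY p by fact
      have id: "(\<lambda>x. x) \<in> measurable (Y.riesz p) (borel_of X)"
        using Y_subset by (intro measurableI)
          (auto simp: sets_borel_of_subtopology[OF closedin_borel[OF closedY]] Int_commute)
      have "(\<lambda>x. f x * ?g x) \<in> borel_measurable (borel_of X)"
        using g' continuous_map_borel_measurable[OF Cc_cont[OF f]] by (auto simp: bounded_borel_def)
      then have "(\<integral>x. f x * ?g x \<partial>riesz (R p)) = (\<integral>x. f x * ?g x \<partial>Y.riesz p)"
        unfolding riesz_R[OF p] by (rule integral_distr[OF id])
      also have "\<dots> = (\<integral>x. zero_off Y f x * g x \<partial>Y.riesz p)"
        by (intro Bochner_Integration.integral_cong) (auto simp: zero_off_def)
      finally show ?thesis by simp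
    qed
    have "R (borel_mult XY g \<phi>) f = borel_mult XY g (p - q) (zero_off Y f)"
      using f by (simp add: R_apply \<phi>_eq)
    also have "\<dots> = (\<integral>x. zero_off Y f x * g x \<partial>Y.riesz p) - (\<integral>x. zero_off Y f x * g x \<partial>Y.riesz q)"
      using ne by (intro Y.borel_mult_eq p q g zero_off_in f) simp
    also have "\<dots> = (\<integral>x. f x * ?g x \<partial>riesz (R p)) - (\<integral>x. f x * ?g x \<partial>riesz (R q))"
      by (simp add: eq p q)
    also have "\<dots> = borel_mult X ?g (R p - R q) f"
      using ne Y_subset by (intro borel_mult_eq[symmetric] R_positive p q g' f) auto
    finally show ?thesis by (simp add: \<phi>_eq R_diff)
  qed (simp add: R_off borel_mult_def)
qed

end

theorem theorem6p3:
  fixes X :: "'a topology" and Y :: "'a set"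
  assumes "Hausdorff_space X" and "locally_compact_space X" and "topspace X \<noteq> {}"
    and "closedin X Y" and "Y \<noteq> {}"
  shows
    "let XY = subtopology X Y; R = order_adjoint X (zero_off Y) in
      (continuous_map (weak_star XY) (weak_star X) R \<and>
       inj_on R (order_dual XY) \<and>
       interval_preserving (order_dual XY) (dual_le XY) (order_dual X) (dual_le X) R \<and>
       lattice_homomorphism (order_dual XY) (dual_le XY) (order_dual X) (dual_le X) R)
    \<and> (\<forall>\<phi>\<in>order_dual XY. dual_supp XY \<phi> = dual_supp X (R \<phi>))
    \<and> (R ` order_dual XY = {\<Phi> \<in> order_dual X. dual_supp X \<Phi> \<subseteq> Y} \<and>
       order_ideal (order_dual X) (dual_le X) {\<Phi> \<in> order_dual X. dual_supp X \<Phi> \<subseteq> Y})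
    \<and> (\<forall>g. bounded_borel XY g \<longrightarrow>
         bounded_borel X (zero_off Y g) \<and>
         (\<forall>\<phi>\<in>order_dual XY. R (borel_mult XY g \<phi>) = borel_mult X (zero_off Y g) (R \<phi>)))"
proof -
  interpret lch_closed X Y
    using assms by unfold_locales
  show ?thesis
    unfolding Let_def R_def[symmetric]
    using R_weak_star R_inj R_interval_preserving R_lattice_homomorphism R_supp R_image
      R_order_ideal[unfolded R_image] bounded_borel_zero_off R_borel_mult[OF \<open>Y \<noteq> {}\<close>]
    by blast
qed

end
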